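(* Let $d\ge 3$ be an integer. Then there exist infinitely many numerical semigroups with embedding dimension $d$ which are of homogeneous type but are not homogeneous.
   Context: A numerical semigroup is a submonoid $S$ of $(\mathbb N,+)$ with finite complement; its embedding dimension is the number $d$ of its minimal generators $n_1<\cdots<n_d$. Let $\Bbbk$ be a field, $P=\Bbbk[x_1,\ldots,x_d]$, $R=\Bbbk[S]=\Bbbk[t^{n_1},\ldots,t^{n_d}]\cong P/I_S$ with $I_S$ the kernel of $x_i\mapsto t^{n_i}$. $G(S)$ is the associated graded ring of $R$ with respect to $(t^{n_1},\ldots,t^{n_d})$; $G(S)\cong P/(I_S)_*$, where $(I_S)_*$ is generated by the lowest-degree homogeneous components (standard grading) of the nonzero elements of $I_S$. $S$ is of homogeneous type if $\beta_i(R)=\beta_i(G(S))$ for all $i\ge1$, where $\beta_i(M)=\dim_\Bbbk\mathrm{Tor}_i^P(M,\Bbbk)$. $\mathrm{AP}(S,n_1)=\{x\in S:x-n_1\notin S\}$; $S$ is homogeneous if for each $0\ne s\in\mathrm{AP}(S,n_1)$ all $\mathbf a\in\mathbb N^d$ with $\sum a_in_i=s$ have the same $\sum_i a_i$. *)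

theory Defs
  imports
    "HOL-Library.Poly_Mapping"
    "HOL-Algebra.Ideal_Product"
    "HOL-Algebra.Module"
    "Jordan_Normal_Form.Matrix_Kernel"
    "Jordan_Normal_Form.DL_Rank"
begin

section \<open>Numerical semigroups\<close>

definition nat_submonoid :: "nat set \<Rightarrow> bool" where
  "nat_submonoid T \<longleftrightarrow> 0 \<in> T \<and> (\<forall>x\<in>T. \<forall>y\<in>T. x + y \<in> T)"

definition numerical_semigroup :: "nat set \<Rightarrow> bool" where
  "numerical_semigroup S \<longleftrightarrow> nat_submonoid S \<and> finite (- S)"

text \<open>A numerical semigroup has exactly one inclusion-minimal generating set.\<close>

definition min_gens :: "nat set \<Rightarrow> nat set" where
  "min_gens S = (THE A. nat_submonoid hull A = S \<and> (\<forall>B. B \<subset> A \<longrightarrow> nat_submonoid hull B \<noteq> S))"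

definition embdim :: "nat set \<Rightarrow> nat" where
  "embdim S = card (min_gens S)"

text \<open>Generators in increasing order, indexed from 0: \<open>gen S i\<close> is the usual $n_{i+1}$.\<close>

definition gen :: "nat set \<Rightarrow> nat \<Rightarrow> nat" where
  "gen S i = sorted_list_of_set (min_gens S) ! i"

text \<open>The disjunct \<open>x < n\<close> says that the integer $x-n$ is negative; subtraction on
  \<open>nat\<close> would truncate it to $0 \in S$.\<close>

definition Apery :: "nat set \<Rightarrow> nat \<Rightarrow> nat set" where
  "Apery S n = {x \<in> S. x < n \<or> x - n \<notin> S}"

definition homogeneous :: "nat set \<Rightarrow> bool" where
  "homogeneous S \<longleftrightarrow>
     (\<forall>s \<in> Apery S (gen S 0). s \<noteq> 0 \<longrightarrow>
        (\<forall>a b :: nat \<Rightarrow> nat.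
           (\<Sum>i<embdim S. a i * gen S i) = s \<and> (\<Sum>i<embdim S. b i * gen S i) = s \<longrightarrow>
           (\<Sum>i<embdim S. a i) = (\<Sum>i<embdim S. b i)))"


section \<open>The polynomial ring and Betti numbers\<close>

text \<open>Polynomials in variables $x_0, x_1, \ldots$; an exponent vector is a finitely supported
  function. The ring $P$ in $d$ variables is the carrier \<open>polys d\<close>.\<close>

type_synonym 'k mpoly = "(nat \<Rightarrow>\<^sub>0 nat) \<Rightarrow>\<^sub>0 'k"

definition polys :: "nat \<Rightarrow> 'k::zero mpoly set" where
  "polys d = {p. \<forall>m \<in> Poly_Mapping.keys p. Poly_Mapping.keys m \<subseteq> {..<d}}"

definition total_deg :: "(nat \<Rightarrow>\<^sub>0 nat) \<Rightarrow> nat" where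
  "total_deg m = (\<Sum>i\<in>Poly_Mapping.keys m. Poly_Mapping.lookup m i)"

definition hom_component :: "nat \<Rightarrow> 'k::comm_monoid_add mpoly \<Rightarrow> 'k mpoly" where
  "hom_component n p =
     (\<Sum>m | m \<in> Poly_Mapping.keys p \<and> total_deg m = n. Poly_Mapping.single m (Poly_Mapping.lookup p m))"

text \<open>The free module $P^n$.\<close>

definition free_mod :: "nat \<Rightarrow> nat \<Rightarrow> 'k::zero mpoly vec set" where
  "free_mod d n = {v \<in> carrier_vec n. \<forall>j<n. v $ j \<in> polys d}"

definition augmentation :: "('p, 'a, 'b) module_scheme \<Rightarrow> (nat \<Rightarrow> 'a) \<Rightarrow> 'p vec \<Rightarrow> 'a" where
  "augmentation M e v = (\<Oplus>\<^bsub>M\<^esub>j\<in>{..<dim_vec v}. v $ j \<odot>\<^bsub>M\<^esub> e j)"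

text \<open>A resolution
  $\cdots \to P^{b_2} \to P^{b_1} \to P^{b_0} \to M \to 0$ by free modules of finite rank:
  \<open>D i\<close> is the matrix of $P^{b_{i+1}} \to P^{b_i}$, and the augmentation maps the $j$-th unit
  vector to \<open>e j\<close>. Every finitely generated \<open>M\<close> has one since $P$ is Noetherian.\<close>

definition free_resolution ::
  "nat \<Rightarrow> ('k::comm_ring_1 mpoly, 'a, 'b) module_scheme \<Rightarrow>
   (nat \<Rightarrow> nat) \<Rightarrow> (nat \<Rightarrow> 'k mpoly mat) \<Rightarrow> (nat \<Rightarrow> 'a) \<Rightarrow> bool" where
  "free_resolution d M b D e \<longleftrightarrow>
     (\<forall>i. D i \<in> carrier_mat (b i) (b (Suc i)) \<and> elements_mat (D i) \<subseteq> polys d) \<and>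
     (\<forall>j<b 0. e j \<in> carrier M) \<and>
     augmentation M e ` free_mod d (b 0) = carrier M \<and>
     {v \<in> free_mod d (b 0). augmentation M e v = \<zero>\<^bsub>M\<^esub>} = (*\<^sub>v) (D 0) ` free_mod d (b 1) \<and>
     (\<forall>i. {v \<in> free_mod d (b (Suc i)). D i *\<^sub>v v = 0\<^sub>v (b i)}
            = (*\<^sub>v) (D (Suc i)) ` free_mod d (b (Suc (Suc i))))"

text \<open>Tensoring with $\Bbbk = P/(x_0, \ldots, x_{d-1})$ turns $P^b$ into $\Bbbk^b$ and replaces each
  matrix entry by its constant term.\<close>

definition tensor_residue :: "'k::zero mpoly mat \<Rightarrow> 'k mat" where
  "tensor_residue A = map_mat (\<lambda>p. Poly_Mapping.lookup p 0) A"

text \<open>The dimension of the homology (kernel modulo image) of the tensored complex in degree \<open>i\<close>.\<close>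

definition homology_dim :: "(nat \<Rightarrow> nat) \<Rightarrow> (nat \<Rightarrow> 'k::field mpoly mat) \<Rightarrow> nat \<Rightarrow> nat" where
  "homology_dim b D i =
     (case i of 0 \<Rightarrow> b 0 | Suc j \<Rightarrow> kernel_dim (tensor_residue (D j)))
     - vec_space.rank (b i) (tensor_residue (D i))"

text \<open>$\beta_i(M) = \dim_\Bbbk \mathrm{Tor}_i^P(M,\Bbbk)$; the value does not depend on the resolution.\<close>

definition betti :: "nat \<Rightarrow> ('k::field mpoly, 'a, 'b) module_scheme \<Rightarrow> nat \<Rightarrow> nat" where
  "betti d M i = (THE n. \<exists>b D e. free_resolution d M b D e \<and> n = homology_dim b D i)"


section \<open>Associated graded rings\<close>

primrec ideal_power :: "('a, 'b) ring_scheme \<Rightarrow> 'a set \<Rightarrow> nat \<Rightarrow> 'a set" where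
  "ideal_power R I 0 = carrier R"
| "ideal_power R I (Suc n) = ideal_prod R I (ideal_power R I n)"

text \<open>$\bigoplus_n I^n/I^{n+1}$: an element is the sequence of its graded components, each a coset
  of $I^{n+1}$ in $I^n$, almost all zero. In the product, \<open>u\<close> and \<open>v\<close> range over
  representatives of the components of the two factors.\<close>

definition assoc_graded :: "('a, 'b) ring_scheme \<Rightarrow> 'a set \<Rightarrow> (nat \<Rightarrow> 'a set) ring" where
  "assoc_graded R I =
     \<lparr> carrier = {g. (\<forall>n. \<exists>x \<in> ideal_power R I n. g n = ideal_power R I (Suc n) +>\<^bsub>R\<^esub> x)
                    \<and> finite {n. g n \<noteq> ideal_power R I (Suc n)}},
       mult = (\<lambda>g h n. {(\<Oplus>\<^bsub>R\<^esub>j\<in>{..n}. u j \<otimes>\<^bsub>R\<^esub> v (n - j)) \<oplus>\<^bsub>R\<^esub> x | u v x.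
                          (\<forall>j\<le>n. u j \<in> g j \<and> v j \<in> h j) \<and> x \<in> ideal_power R I (Suc n)}),
       one = (\<lambda>n. ideal_power R I (Suc n) +>\<^bsub>R\<^esub> (if n = 0 then \<one>\<^bsub>R\<^esub> else \<zero>\<^bsub>R\<^esub>)),
       zero = (\<lambda>n. ideal_power R I (Suc n)),
       add = (\<lambda>g h n. g n <+>\<^bsub>R\<^esub> h n) \<rparr>"


section \<open>The semigroup ring and its associated graded ring as modules over the polynomial ring\<close>

definition semigroup_ring :: "nat set \<Rightarrow> 'k::field poly ring" where
  "semigroup_ring S = class_ring \<lparr> carrier := {f. \<forall>n. coeff f n \<noteq> 0 \<longrightarrow> n \<in> S} \<rparr>"

definition irrelevant_ideal :: "nat set \<Rightarrow> 'k::field poly set" where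
  "irrelevant_ideal S = genideal (semigroup_ring S) ((\<lambda>n. monom 1 n) ` min_gens S)"

text \<open>The \<open>\<Bbbk>\<close>-algebra homomorphism $P \to \Bbbk[S]$ with $x_i \mapsto t^{\mathrm{gen}\,S\,i}$.\<close>

definition toric_map :: "nat set \<Rightarrow> 'k::field mpoly \<Rightarrow> 'k poly" where
  "toric_map S p =
     (\<Sum>m\<in>Poly_Mapping.keys p. monom (Poly_Mapping.lookup p m) (\<Sum>i<embdim S. Poly_Mapping.lookup m i * gen S i))"

definition gr :: "'k::field itself \<Rightarrow> nat set \<Rightarrow> (nat \<Rightarrow> 'k poly set) ring" where
  "gr K S = assoc_graded (semigroup_ring S) (irrelevant_ideal S)"

text \<open>The graded \<open>\<Bbbk>\<close>-algebra homomorphism from $P$ to the associated graded ring that maps $x_i$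
  to the class of $t^{\mathrm{gen}\,S\,i}$ in degree 1; hence a form of degree $n$ goes to the class
  in degree $n$ of its value in $\Bbbk[S]$.\<close>

definition gr_map :: "nat set \<Rightarrow> 'k::field mpoly \<Rightarrow> nat \<Rightarrow> 'k poly set" where
  "gr_map S p = (\<lambda>n. ideal_power (semigroup_ring S) (irrelevant_ideal S) (Suc n)
                       +>\<^bsub>semigroup_ring S\<^esub> toric_map S (hom_component n p))"

definition module_via :: "('p \<Rightarrow> 'a) \<Rightarrow> 'a ring \<Rightarrow> ('p, 'a) module" where
  "module_via \<theta> A =
     \<lparr> carrier = carrier A, mult = mult A, one = one A, zero = zero A, add = add A,
       smult = (\<lambda>p a. \<theta> p \<otimes>\<^bsub>A\<^esub> a) \<rparr>"

definition homogeneous_type :: "'k::field itself \<Rightarrow> nat set \<Rightarrow> bool" where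
  "homogeneous_type K S \<longleftrightarrow>
     (\<forall>i\<ge>1. betti (embdim S) (module_via (toric_map S :: 'k mpoly \<Rightarrow> _) (semigroup_ring S)) i
            = betti (embdim S) (module_via (gr_map S :: 'k mpoly \<Rightarrow> _) (gr K S)) i)"

end

theory Submission
  imports Defs "HOL-Number_Theory.Cong"
begin

text \<open>The semigroup with generators $n_1 = 2^d$ and $n_i = 2^{d-i}3^{i-2}m$ for $2 \le i \le d$, where
  $m \ge 5$ is odd, has $I_S = (x_2^4 - x_1^m,\ x_3^2 - x_2^3,\ \ldots,\ x_d^2 - x_{d-1}^3)$. Rewriting
  $x_2^4 \to x_1^m$ and $x_i^2 \to x_{i-1}^3$ preserves the weight, strictly raises the degree, and ends in
  one of the monomials with $a_2 < 4$ and $a_i < 2$ for $i \ge 3$, which have pairwise distinct weights.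
  Hence the order of an element of $S$ is the degree of its normal form, and
  $(I_S)_* = (x_2^4, x_3^2, \ldots, x_d^2)$. Both ideals are generated by $d-1$ polynomials, each monic in a
  new variable, hence by regular sequences; so both quotients are resolved by Koszul
  complexes with the same ranks whose differentials vanish modulo the variables. Finally, $x_2^3$ and
  $x_3^2$ have the same weight but different degrees, and $x_2^3$ is a normal form free of $x_1$, so its
  weight lies in the Apery set and \<open>S\<close> is not homogeneous.\<close>

section \<open>Linear algebra\<close>

text \<open>\<open>betti\<close> is a definite description over all finite-rank free resolutions,
  none of them assumed minimal. Exhibiting Koszul complexes is therefore not enough: every
  resolution has to give the same homology dimension, and this is why a comparison theorem for
  resolutions is proved here. Both rings enter only as quotients P/K, so the comparison takes place
  inside the polynomial ring. The constants: 2 n_i = 3 n_{i-1} and 4 n_2 = m n_1 give each new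
  variable one relation, whose side of smaller degree is a pure power of that variable; dropping the
  other side keeps the system triangular. The exponent 4 has to exceed 3: otherwise x_2^3 could be
  rewritten to a multiple of x_1 and its weight would leave the Apery set. The bound m > 4 makes the
  first relation raise the degree, and m odd lets powers of 2 separate the weights of normal forms
  and makes the generators coprime. Nothing else restricts m, so it supplies infinitely many
  semigroups.\<close>

lemma mult_mat_vec_zero:
  "X \<in> carrier_mat m n \<Longrightarrow> X *\<^sub>v 0\<^sub>v n = (0\<^sub>v m :: 'a::comm_ring_1 vec)"
  by (intro eq_vecI) auto

lemma mult_mat_smult_vec:
  "X \<in> carrier_mat m n \<Longrightarrow> v \<in> carrier_vec n \<Longrightarrow> X *\<^sub>v (c \<cdot>\<^sub>v v) = c \<cdot>\<^sub>v (X *\<^sub>v v :: 'a::comm_ring_1 vec)"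
  by (intro eq_vecI) auto

lemma zero_mult_mat_vec: "v \<in> carrier_vec n \<Longrightarrow> 0\<^sub>m m n *\<^sub>v v = (0\<^sub>v m :: 'a::comm_ring_1 vec)"
  by (intro eq_vecI) (auto simp: scalar_prod_def)

lemma mult_mat_vec_uminus:
  "X \<in> carrier_mat m n \<Longrightarrow> v \<in> carrier_vec n \<Longrightarrow> X *\<^sub>v (- v) = - (X *\<^sub>v v :: 'a::comm_ring_1 vec)"
  by (intro eq_vecI) auto

text \<open>Rank-nullity for \<open>X\<close> restricted to the kernel of \<open>N\<close>:
  \<open>Y\<close> is a section with values in that kernel, so the restriction is onto, and its
  kernel is the image of \<open>M\<close>. In the application \<open>N\<close> and \<open>M\<close>
  are consecutive differentials modulo the variables, and \<open>X\<close>, \<open>Y\<close> come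
  from chain maps to and from a minimal resolution. The additive form avoids truncated
  subtraction.\<close>

lemma kernel_dim_eq_add_rank:
  fixes N M X Y :: "'a::field mat"
  assumes N: "N \<in> carrier_mat p q" and M: "M \<in> carrier_mat q r"
    and X: "X \<in> carrier_mat s q" and Y: "Y \<in> carrier_mat q s"
    and NM: "N * M = 0\<^sub>m p r" and NY: "N * Y = 0\<^sub>m p s"
    and XM: "X * M = 0\<^sub>m s r" and XY: "X * Y = 1\<^sub>m s"
    and ex: "\<And>z. \<lbrakk>z \<in> carrier_vec q; N *\<^sub>v z = 0\<^sub>v p; X *\<^sub>v z = 0\<^sub>v s\<rbrakk>
               \<Longrightarrow> \<exists>y \<in> carrier_vec r. z = M *\<^sub>v y"
  shows "kernel_dim N = s + vec_space.rank q M"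
proof -
  interpret ker: kernel p q N by unfold_locales (rule N)
  interpret W: vec_space "TYPE('a)" s .
  have VK: "vectorspace class_ring ker.VK" by (rule ker.Ker.vectorspace_axioms)
  interpret L: linear_map class_ring ker.VK W.V "\<lambda>z. X *\<^sub>v z"
  proof (intro linear_map.intro mod_hom.intro mod_hom_axioms.intro)
    show "vectorspace class_ring ker.VK" by (rule VK)
    then show "Module.module class_ring ker.VK" by (simp add: vectorspace_def)
    show "vectorspace class_ring W.V" by (rule W.vectorspace_axioms)
    then show "Module.module class_ring W.V" by (simp add: vectorspace_def)
    show "(*\<^sub>v) X \<in> LinearCombinations.module_hom class_ring ker.VK W.V"
    proof -
      have sub: "z \<in> carrier_vec q" if "z \<in> mat_kernel N" for z
        using that mat_kernel_carrier[OF N] by blast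
      then have im: "X *\<^sub>v z \<in> carrier_vec s" if "z \<in> mat_kernel N" for z
        using mult_mat_vec_carrier[OF X] that by blast
      show ?thesis
        by (auto simp: LinearCombinations.module_hom_def class_ring_simps module_vec_simps im
            mult_add_distrib_mat_vec[OF X sub sub] mult_mat_vec[OF X sub])
    qed
  qed
  have fd: "vectorspace.fin_dim class_ring ker.VK"
    using kernel_basis_exists[OF N] unfolding ker.Ker.basis_def ker.Ker.fin_dim_def by blast
  have im: "L.im = carrier_vec s"
  proof
    show "L.im \<subseteq> carrier_vec s" 
    proof
      fix w assume "w \<in> L.im"
      then obtain z where "z \<in> mat_kernel N" "w = X *\<^sub>v z" unfolding L.im_def by auto
      then show "w \<in> carrier_vec s"
        using mult_mat_vec_carrier[OF X, of z] mat_kernelD(1)[OF N, of z] by blast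
    qed
    show "carrier_vec s \<subseteq> L.im"
    proof
      fix w :: "'a vec" assume w: "w \<in> carrier_vec s"
      have "N *\<^sub>v (Y *\<^sub>v w) = 0\<^sub>v p"
        using assoc_mult_mat_vec[OF N Y w] by (simp add: NY zero_mult_mat_vec[OF w])
      then have k: "Y *\<^sub>v w \<in> mat_kernel N" using Y w by (intro mat_kernelI[OF N]) auto
      have "X *\<^sub>v (Y *\<^sub>v w) = w" using assoc_mult_mat_vec[OF X Y w] XY w by simp
      then show "w \<in> L.im" unfolding L.im_def using k by (intro image_eqI[of _ _ "Y *\<^sub>v w"]) simp_all
    qed
  qed
  have kerT: "L.ker = ker.NC.span (set (cols M))"
  proof -
    have "L.ker = {z \<in> carrier_vec q. N *\<^sub>v z = 0\<^sub>v p \<and> X *\<^sub>v z = 0\<^sub>v s}"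
      unfolding L.ker_def by (auto simp: mat_kernel[OF N] module_vec_simps)
    also have "\<dots> = {z \<in> carrier_vec q. \<exists>y \<in> carrier_vec r. M *\<^sub>v y = z}"
    proof (intro Collect_cong conj_cong refl iffI)
      fix z assume "z \<in> carrier_vec q" "\<exists>y\<in>carrier_vec r. M *\<^sub>v y = z"
      then obtain y where y: "y \<in> carrier_vec r" "z = M *\<^sub>v y" by auto
      show "N *\<^sub>v z = 0\<^sub>v p \<and> X *\<^sub>v z = 0\<^sub>v s"
        unfolding y(2) assoc_mult_mat_vec[OF N M y(1), symmetric] assoc_mult_mat_vec[OF X M y(1), symmetric]
        by (simp add: NM XM zero_mult_mat_vec[OF y(1)])
    qed (use ex in force)
    also have "\<dots> = ker.NC.col_space M" using ker.NC.col_space_eq[OF M] M by auto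
    finally show ?thesis unfolding ker.NC.col_space_def .
  qed
  have "vectorspace.dim class_ring (W.V\<lparr>carrier := L.im\<rparr>) = s"
    unfolding im using W.dim_is_n by (simp add: module_vec_def)
  moreover have "vectorspace.dim class_ring (ker.VK\<lparr>carrier := L.ker\<rparr>) = ker.NC.rank M"
    unfolding ker.NC.rank_def kerT by simp
  ultimately show ?thesis using L.rank_nullity[OF fd] by simp
qed

section \<open>Comparison of free resolutions\<close>

text \<open>Vectors and matrices have entries in a type, whereas P is only the subset
  \<open>polys d\<close> of a type with infinitely many variables. The linear algebra is therefore
  done relative to a subring \<open>A\<close>, with membership of the entries carried along.\<close>

locale coeff_ring =
  fixes A :: "'r::comm_ring_1 set"
  assumes zero_mem [simp]: "0 \<in> A" and one_mem [simp]: "1 \<in> A"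
    and add_mem: "x \<in> A \<Longrightarrow> y \<in> A \<Longrightarrow> x + y \<in> A"
    and mult_mem: "x \<in> A \<Longrightarrow> y \<in> A \<Longrightarrow> x * y \<in> A"
    and uminus_mem: "x \<in> A \<Longrightarrow> - x \<in> A"
begin

lemma diff_mem: "x \<in> A \<Longrightarrow> y \<in> A \<Longrightarrow> x - y \<in> A"
  using add_mem[of x "- y"] uminus_mem by simp

lemma sum_mem: "(\<And>i. i \<in> I \<Longrightarrow> f i \<in> A) \<Longrightarrow> sum f I \<in> A"
  by (induction I rule: infinite_finite_induct) (auto intro: add_mem)

definition vecs :: "nat \<Rightarrow> 'r vec set" where
  "vecs n = {v \<in> carrier_vec n. \<forall>j<n. v $ j \<in> A}"

definition mats :: "nat \<Rightarrow> nat \<Rightarrow> 'r mat set" where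
  "mats m n = {X \<in> carrier_mat m n. \<forall>i<m. \<forall>j<n. X $$ (i, j) \<in> A}"

lemma vecs_carrier: "v \<in> vecs n \<Longrightarrow> v \<in> carrier_vec n" by (simp add: vecs_def)
lemma vecs_index: "v \<in> vecs n \<Longrightarrow> j < n \<Longrightarrow> v $ j \<in> A" by (simp add: vecs_def)
lemma mats_carrier: "X \<in> mats m n \<Longrightarrow> X \<in> carrier_mat m n" by (simp add: mats_def)

lemma scalar_prod_mem: "v \<in> vecs n \<Longrightarrow> w \<in> vecs n \<Longrightarrow> v \<bullet> w \<in> A"
  unfolding scalar_prod_def vecs_def by (auto intro!: sum_mem mult_mem)

lemma row_mem: "X \<in> mats m n \<Longrightarrow> i < m \<Longrightarrow> row X i \<in> vecs n"
  by (auto simp: mats_def vecs_def)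

lemma col_mem: "X \<in> mats m n \<Longrightarrow> j < n \<Longrightarrow> col X j \<in> vecs m"
  by (auto simp: mats_def vecs_def)

lemma mult_mat_vec_mem: "X \<in> mats m n \<Longrightarrow> v \<in> vecs n \<Longrightarrow> X *\<^sub>v v \<in> vecs m"
  using scalar_prod_mem[OF row_mem, of X m n _ v] mult_mat_vec_carrier[OF mats_carrier vecs_carrier, of X m n v]
    mats_carrier[of X m n]
  by (auto simp: vecs_def[of m])

lemma mult_mat_mem: "X \<in> mats m n \<Longrightarrow> Y \<in> mats n k \<Longrightarrow> X * Y \<in> mats m k"
  using scalar_prod_mem[OF row_mem[of X m n] col_mem[of Y n k]] mats_carrier[of X m n] mats_carrier[of Y n k]
  by (auto simp: mats_def[of m k])

lemma unit_vec_mem: "unit_vec n i \<in> vecs n" by (auto simp: vecs_def unit_vec_def)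
lemma add_vec_mem: "v \<in> vecs n \<Longrightarrow> w \<in> vecs n \<Longrightarrow> v + w \<in> vecs n"
  by (auto simp: vecs_def add_mem)
lemma minus_vec_mem: "v \<in> vecs n \<Longrightarrow> w \<in> vecs n \<Longrightarrow> v - w \<in> vecs n"
  by (auto simp: vecs_def diff_mem)
lemma uminus_vec_mem: "v \<in> vecs n \<Longrightarrow> - v \<in> vecs n"
  by (auto simp: vecs_def uminus_mem)
lemma smult_vec_mem: "c \<in> A \<Longrightarrow> v \<in> vecs n \<Longrightarrow> c \<cdot>\<^sub>v v \<in> vecs n"
  by (auto simp: vecs_def mult_mem)
lemma one_mat_mem: "1\<^sub>m n \<in> mats n n" by (auto simp: mats_def)
lemma zero_mat_mem: "0\<^sub>m m n \<in> mats m n" by (auto simp: mats_def)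
lemma minus_mat_mem: "X \<in> mats m n \<Longrightarrow> Y \<in> mats m n \<Longrightarrow> X - Y \<in> mats m n"
  by (auto simp: mats_def diff_mem)

text \<open>Freeness of the source: preimages of the columns of \<open>X\<close>, chosen one column
  at a time, are the columns of \<open>Y\<close>.\<close>

lemma mat_lift:
  assumes D: "D \<in> mats m n" and X: "X \<in> mats m k"
    and im: "\<And>v. v \<in> vecs k \<Longrightarrow> X *\<^sub>v v \<in> (*\<^sub>v) D ` vecs n"
  obtains Y where "Y \<in> mats n k" "D * Y = X"
proof -
  have "\<exists>y. y \<in> vecs n \<and> D *\<^sub>v y = col X j" if "j < k" for j
  proof -
    have "X *\<^sub>v unit_vec k j = col X j"
      using X that by (intro eq_vecI) (auto simp: mats_def)
    then show ?thesis using im[OF unit_vec_mem[of k j]] by auto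
  qed
  then obtain y where y: "\<And>j. j < k \<Longrightarrow> y j \<in> vecs n \<and> D *\<^sub>v y j = col X j" by metis
  define Y where "Y = mat n k (\<lambda>(i, j). y j $ i)"
  have col_Y: "col Y j = y j" if "j < k" for j
    using y[OF that] that by (intro eq_vecI) (auto simp: Y_def vecs_def)
  show thesis
  proof
    show Y: "Y \<in> mats n k" using y vecs_index by (fastforce simp: mats_def Y_def)
    show "D * Y = X"
    proof (rule mat_col_eqI)
      fix j assume "j < dim_col X"
      then have j: "j < k" using X by (auto simp: mats_def)
      then show "col (D * Y) j = col X j"
        using col_mult2[OF mats_carrier[OF D] mats_carrier[OF Y] j] y[OF j] col_Y[OF j] by simp
    qed (use D Y X in \<open>auto simp: mats_def\<close>)
  qed
qed

end

locale coeff_ideal = coeff_ring +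
  fixes K :: "'a set"
  assumes ideal_subset: "K \<subseteq> A" and ideal_zero: "0 \<in> K"
    and ideal_add: "x \<in> K \<Longrightarrow> y \<in> K \<Longrightarrow> x + y \<in> K"
    and ideal_mult: "c \<in> A \<Longrightarrow> x \<in> K \<Longrightarrow> c * x \<in> K"
begin

lemma ideal_uminus: "x \<in> K \<Longrightarrow> - x \<in> K"
  using ideal_mult[of "- 1" x] uminus_mem[OF one_mem] by simp

lemma ideal_sum: "(\<And>i. i \<in> I \<Longrightarrow> f i \<in> K) \<Longrightarrow> sum f I \<in> K"
  by (induction I rule: infinite_finite_induct) (auto intro: ideal_add ideal_zero)

text \<open>A resolution of the cyclic module $A/K$ whose augmentation $A^{b_0} \to A/K$ sends \<open>v\<close>
  to the class of \<open>\<epsilon> \<bullet> v\<close>.\<close>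

definition resolves :: "(nat \<Rightarrow> nat) \<Rightarrow> (nat \<Rightarrow> 'a mat) \<Rightarrow> 'a vec \<Rightarrow> bool" where
  "resolves b D \<epsilon> \<longleftrightarrow>
     (\<forall>i. D i \<in> mats (b i) (b (Suc i))) \<and> \<epsilon> \<in> vecs (b 0) \<and>
     (\<forall>p\<in>A. \<exists>v\<in>vecs (b 0). \<epsilon> \<bullet> v - p \<in> K) \<and>
     {v \<in> vecs (b 0). \<epsilon> \<bullet> v \<in> K} = (*\<^sub>v) (D 0) ` vecs (b 1) \<and>
     (\<forall>i. {v \<in> vecs (b (Suc i)). D i *\<^sub>v v = 0\<^sub>v (b i)} = (*\<^sub>v) (D (Suc i)) ` vecs (b (Suc (Suc i))))"

context
  fixes b D \<epsilon>
  assumes res: "resolves b D \<epsilon>"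
begin

lemma diff_mats: "D i \<in> mats (b i) (b (Suc i))"
  and augm_vecs: "\<epsilon> \<in> vecs (b 0)"
  and augm_surj: "p \<in> A \<Longrightarrow> \<exists>v\<in>vecs (b 0). \<epsilon> \<bullet> v - p \<in> K"
  and augm_exact: "v \<in> vecs (b 0) \<Longrightarrow> \<epsilon> \<bullet> v \<in> K \<longleftrightarrow> v \<in> (*\<^sub>v) (D 0) ` vecs (b 1)"
  and diff_exact: "v \<in> vecs (b (Suc i)) \<Longrightarrow>
        D i *\<^sub>v v = 0\<^sub>v (b i) \<longleftrightarrow> v \<in> (*\<^sub>v) (D (Suc i)) ` vecs (b (Suc (Suc i)))"
  using res unfolding resolves_def by blast+

lemmas diff_carrier = mats_carrier[OF diff_mats]

lemma diff_diff_vec: "v \<in> vecs (b (Suc (Suc i))) \<Longrightarrow> D i *\<^sub>v (D (Suc i) *\<^sub>v v) = 0\<^sub>v (b i)"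
  using diff_exact mult_mat_vec_mem[OF diff_mats] by blast

end

lemma mat_eqI_mult_vec:
  assumes X: "X \<in> mats m n" and Y: "Y \<in> mats m n"
    and eq: "\<And>v. v \<in> vecs n \<Longrightarrow> X *\<^sub>v v = Y *\<^sub>v v"
  shows "X = Y"
proof (rule mat_col_eqI)
  fix j assume "j < dim_col Y"
  then have j: "j < n" using Y by (auto simp: mats_def)
  have "X *\<^sub>v unit_vec n j = col X j" "Y *\<^sub>v unit_vec n j = col Y j"
    using X Y j by (auto intro!: eq_vecI simp: mats_def)
  then show "col X j = col Y j" using eq[OF unit_vec_mem[of n j]] by simp
qed (use X Y in \<open>auto simp: mats_def\<close>)

lemma diff_diff:
  assumes "resolves b D \<epsilon>"
  shows "D i * D (Suc i) = 0\<^sub>m (b i) (b (Suc (Suc i)))"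
proof (rule mat_eqI_mult_vec)
  show "D i * D (Suc i) \<in> mats (b i) (b (Suc (Suc i)))"
    by (rule mult_mat_mem[OF diff_mats[OF assms] diff_mats[OF assms]])
  show "D i * D (Suc i) *\<^sub>v v = 0\<^sub>m (b i) (b (Suc (Suc i))) *\<^sub>v v" if "v \<in> vecs (b (Suc (Suc i)))" for v
    using diff_diff_vec[OF assms that] vecs_carrier[OF that]
    by (simp add: assoc_mult_mat_vec[OF diff_carrier[OF assms] diff_carrier[OF assms] vecs_carrier[OF that]] zero_mult_mat_vec)
qed (rule zero_mat_mem)

text \<open>The comparison theorem, lifting the identity of A/K. The augmentations need to agree
  only modulo \<open>K\<close>, since their common target is A/K and not A.\<close>

lemma chain_map_exists:
  assumes F: "resolves b D \<epsilon>" and G: "resolves b' D' \<epsilon>'"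
  obtains a where "\<And>i. a i \<in> mats (b' i) (b i)"
    and "\<And>v. v \<in> vecs (b 0) \<Longrightarrow> \<epsilon>' \<bullet> (a 0 *\<^sub>v v) - \<epsilon> \<bullet> v \<in> K"
    and "\<And>i. D' i * a (Suc i) = a i * D i"
proof -
  note DF = diff_mats[OF F] and DG = diff_mats[OF G]
  \<comment> \<open>The invariant for the recursive choice: the composite with the next differential
    of \<open>F\<close> lands in the image of the next differential of \<open>G\<close>, which is
    exactly what \<open>mat_lift\<close> needs. The augmentation condition is attached to index 0
    alone.\<close>
  define P where "P i X \<longleftrightarrow> X \<in> mats (b' i) (b i)
      \<and> (\<forall>v\<in>vecs (b (Suc i)). (X * D i) *\<^sub>v v \<in> (*\<^sub>v) (D' i) ` vecs (b' (Suc i)))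
      \<and> (i = 0 \<longrightarrow> (\<forall>v\<in>vecs (b 0). \<epsilon>' \<bullet> (X *\<^sub>v v) - \<epsilon> \<bullet> v \<in> K))" for i X
  have "\<exists>X. P 0 X"
  proof -
    have "\<exists>u\<in>vecs (b' 0). \<epsilon>' \<bullet> u - \<epsilon> $ j \<in> K" if "j < b 0" for j
      using augm_surj[OF G] vecs_index[OF augm_vecs[OF F] that] by blast
    then obtain u where u: "\<And>j. j < b 0 \<Longrightarrow> u j \<in> vecs (b' 0) \<and> \<epsilon>' \<bullet> u j - \<epsilon> $ j \<in> K" by metis
    define X where "X = mat (b' 0) (b 0) (\<lambda>(i, j). u j $ i)"
    have X: "X \<in> mats (b' 0) (b 0)" using u vecs_index by (fastforce simp: mats_def X_def)
    have aug: "\<epsilon>' \<bullet> (X *\<^sub>v v) - \<epsilon> \<bullet> v \<in> K" if v: "v \<in> vecs (b 0)" for v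
    proof -
      have dims: "dim_vec v = b 0" "dim_vec \<epsilon> = b 0" "dim_vec \<epsilon>' = b' 0"
        using v augm_vecs[OF F] augm_vecs[OF G] by (auto simp: vecs_def)
      have du: "dim_vec (u j) = b' 0" if "j < b 0" for j using u[OF that] by (auto simp: vecs_def)
      have "\<epsilon>' \<bullet> (X *\<^sub>v v) = (\<Sum>i<b' 0. \<epsilon>' $ i * (\<Sum>j<b 0. u j $ i * v $ j))"
        by (simp add: scalar_prod_def X_def dims atLeast0LessThan)
      also have "\<dots> = (\<Sum>j<b 0. \<Sum>i<b' 0. \<epsilon>' $ i * (u j $ i * v $ j))"
        unfolding sum_distrib_left by (rule sum.swap)
      also have "\<dots> = (\<Sum>j<b 0. v $ j * (\<epsilon>' \<bullet> u j))"
        by (intro sum.cong refl) (simp add: scalar_prod_def du sum_distrib_left atLeast0LessThan mult_ac)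
      finally have "\<epsilon>' \<bullet> (X *\<^sub>v v) - \<epsilon> \<bullet> v = (\<Sum>j<b 0. v $ j * (\<epsilon>' \<bullet> u j - \<epsilon> $ j))"
        by (simp add: scalar_prod_def dims atLeast0LessThan sum_subtractf right_diff_distrib mult_ac)
      also have "\<dots> \<in> K" using u vecs_index[OF v] by (intro ideal_sum ideal_mult) auto
      finally show ?thesis .
    qed
    have "(X * D 0) *\<^sub>v v \<in> (*\<^sub>v) (D' 0) ` vecs (b' (Suc 0))" if v: "v \<in> vecs (b (Suc 0))" for v
    proof -
      have Dv: "D 0 *\<^sub>v v \<in> vecs (b 0)" using mult_mat_vec_mem[OF DF v] .
      have "\<epsilon> \<bullet> (D 0 *\<^sub>v v) \<in> K" using augm_exact[OF F Dv] v by auto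
      then have "\<epsilon>' \<bullet> (X *\<^sub>v (D 0 *\<^sub>v v)) \<in> K"
        using ideal_add[OF aug[OF Dv], of "\<epsilon> \<bullet> (D 0 *\<^sub>v v)"] by simp
      then show ?thesis
        using augm_exact[OF G mult_mat_vec_mem[OF X Dv]]
        by (simp add: assoc_mult_mat_vec[OF mats_carrier[OF X] mats_carrier[OF DF] vecs_carrier[OF v]])
    qed
    with X aug show ?thesis unfolding P_def by blast
  qed
  moreover have "\<exists>Y. P (Suc i) Y \<and> D' i * Y = X * D i" if "P i X" for X i
  proof -
    have X: "X \<in> mats (b' i) (b i)"
      and im: "\<And>v. v \<in> vecs (b (Suc i)) \<Longrightarrow> (X * D i) *\<^sub>v v \<in> (*\<^sub>v) (D' i) ` vecs (b' (Suc i))"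
      using that unfolding P_def by auto
    obtain Y where Y: "Y \<in> mats (b' (Suc i)) (b (Suc i))" and DY: "D' i * Y = X * D i"
      using mat_lift[OF DG mult_mat_mem[OF X DF] im] by auto
    have "(Y * D (Suc i)) *\<^sub>v v \<in> (*\<^sub>v) (D' (Suc i)) ` vecs (b' (Suc (Suc i)))"
      if v: "v \<in> vecs (b (Suc (Suc i)))" for v
    proof -
      have Dv: "D (Suc i) *\<^sub>v v \<in> vecs (b (Suc i))" using mult_mat_vec_mem[OF DF v] .
      have "D' i *\<^sub>v (Y *\<^sub>v (D (Suc i) *\<^sub>v v)) = (X * D i) *\<^sub>v (D (Suc i) *\<^sub>v v)"
        using assoc_mult_mat_vec[OF mats_carrier[OF DG] mats_carrier[OF Y] vecs_carrier[OF Dv]] DY by simp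
      also have "\<dots> = X *\<^sub>v (D i *\<^sub>v (D (Suc i) *\<^sub>v v))"
        using assoc_mult_mat_vec[OF mats_carrier[OF X] mats_carrier[OF DF] vecs_carrier[OF Dv]] .
      also have "\<dots> = 0\<^sub>v (b' i)" by (simp add: diff_diff_vec[OF F v] mult_mat_vec_zero[OF mats_carrier[OF X]])
      finally show ?thesis
        using diff_exact[OF G mult_mat_vec_mem[OF Y Dv]]
        by (simp add: assoc_mult_mat_vec[OF mats_carrier[OF Y] mats_carrier[OF DF] vecs_carrier[OF v]])
    qed
    with Y DY show ?thesis unfolding P_def by auto
  qed
  ultimately obtain a where "\<And>i. P i (a i) \<and> D' i * a (Suc i) = a i * D i"
    using dependent_nat_choice[of P "\<lambda>i X Y. D' i * Y = X * D i"] by auto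
  then show thesis using that unfolding P_def by blast
qed

text \<open>A chain map over the identity of A/K is homotopic to the identity. \<open>h i\<close>
  raises the index from i to i + 1; the homotopy identity is recorded from index 1 on, the range
  that computes positive Betti numbers.\<close>

lemma chain_homotopy_exists:
  assumes F: "resolves b D \<epsilon>"
    and c: "\<And>i. c i \<in> mats (b i) (b i)"
    and aug: "\<And>v. v \<in> vecs (b 0) \<Longrightarrow> \<epsilon> \<bullet> (c 0 *\<^sub>v v) - \<epsilon> \<bullet> v \<in> K"
    and chain: "\<And>i. D i * c (Suc i) = c i * D i"
  obtains h where "\<And>i. h i \<in> mats (b (Suc i)) (b i)"
    and "\<And>i. D (Suc i) * h (Suc i) = c (Suc i) - 1\<^sub>m (b (Suc i)) - h i * D i"
proof -
  note DF = diff_mats[OF F]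
  \<comment> \<open>The map that \<open>h (Suc i)\<close> has to lift through
    \<open>D (Suc i)\<close>, once \<open>h i\<close> has been chosen.\<close>
  define X where "X i h = c (Suc i) - 1\<^sub>m (b (Suc i)) - h * D i" for i h
  have X: "X i h \<in> mats (b (Suc i)) (b (Suc i))" if "h \<in> mats (b (Suc i)) (b i)" for i h
    unfolding X_def using that by (intro minus_mat_mem c one_mat_mem mult_mat_mem[OF _ DF])
  have X_vec: "X i h *\<^sub>v v = c (Suc i) *\<^sub>v v - v - h *\<^sub>v (D i *\<^sub>v v)"
    if h: "h \<in> mats (b (Suc i)) (b i)" and v: "v \<in> vecs (b (Suc i))" for i h v
    using mats_carrier[OF c[of "Suc i"]] mats_carrier[OF h] mats_carrier[OF DF[of i]] vecs_carrier[OF v]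
    unfolding X_def
    by (subst minus_mult_distrib_mat_vec[of _ "b (Suc i)" "b (Suc i)"], auto)
       (subst minus_mult_distrib_mat_vec[of _ "b (Suc i)" "b (Suc i)"], auto)
  have c_vec: "D i *\<^sub>v (c (Suc i) *\<^sub>v v) = c i *\<^sub>v (D i *\<^sub>v v)" if v: "v \<in> vecs (b (Suc i))" for i v
    using assoc_mult_mat_vec[OF mats_carrier[OF DF] mats_carrier[OF c] vecs_carrier[OF v]]
      assoc_mult_mat_vec[OF mats_carrier[OF c] mats_carrier[OF DF] vecs_carrier[OF v]] chain by simp
  have D_X: "D i *\<^sub>v (X i h *\<^sub>v v) = c i *\<^sub>v (D i *\<^sub>v v) - D i *\<^sub>v v - D i *\<^sub>v (h *\<^sub>v (D i *\<^sub>v v))"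
    if h: "h \<in> mats (b (Suc i)) (b i)" and v: "v \<in> vecs (b (Suc i))" for i h v
  proof -
    have hv: "h *\<^sub>v (D i *\<^sub>v v) \<in> carrier_vec (b (Suc i))"
      using mult_mat_vec_mem[OF h mult_mat_vec_mem[OF DF v]] vecs_carrier by blast
    have cv: "c (Suc i) *\<^sub>v v \<in> carrier_vec (b (Suc i))"
      using mult_mat_vec_mem[OF c v] vecs_carrier by blast
    show ?thesis
      unfolding X_vec[OF h v]
      using cv hv vecs_carrier[OF v] mats_carrier[OF DF[of i]] c_vec[OF v]
      by (simp add: mult_minus_distrib_mat_vec[of _ "b i" "b (Suc i)"])
  qed
  \<comment> \<open>A choice of \<open>h\<close> is good when the next map to be lifted consists of
    cycles; exactness then turns cycles into boundaries and the choice can continue.\<close>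
  define P where "P i h \<longleftrightarrow> h \<in> mats (b (Suc i)) (b i)
      \<and> (\<forall>v\<in>vecs (b (Suc i)). D i *\<^sub>v (X i h *\<^sub>v v) = 0\<^sub>v (b i))" for i h
  have "\<exists>h. P 0 h"
  proof -
    have c1: "c 0 - 1\<^sub>m (b 0) \<in> mats (b 0) (b 0)" by (intro minus_mat_mem c one_mat_mem)
    have c1_vec: "(c 0 - 1\<^sub>m (b 0)) *\<^sub>v v = c 0 *\<^sub>v v - v" if v: "v \<in> vecs (b 0)" for v
      using mats_carrier[OF c[of 0]] vecs_carrier[OF v]
      by (subst minus_mult_distrib_mat_vec[of _ "b 0" "b 0"]) auto
    \<comment> \<open>\<open>c 0\<close> and the identity have the same augmentation modulo
      \<open>K\<close>, so their difference maps into the image of \<open>D 0\<close>; this starts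
      the homotopy.\<close>
    have "(c 0 - 1\<^sub>m (b 0)) *\<^sub>v v \<in> (*\<^sub>v) (D 0) ` vecs (b (Suc 0))" if v: "v \<in> vecs (b 0)" for v
    proof -
      have cv: "c 0 *\<^sub>v v \<in> vecs (b 0)" using mult_mat_vec_mem[OF c v] .
      have "\<epsilon> \<bullet> (c 0 *\<^sub>v v - v) = \<epsilon> \<bullet> (c 0 *\<^sub>v v) - \<epsilon> \<bullet> v"
        using scalar_prod_minus_distrib vecs_carrier[OF augm_vecs[OF F]] vecs_carrier[OF cv] vecs_carrier[OF v] by blast
      then have "\<epsilon> \<bullet> (c 0 *\<^sub>v v - v) \<in> K" using aug[OF v] by simp
      then show ?thesis
        unfolding c1_vec[OF v] using augm_exact[OF F minus_vec_mem[OF cv v]] by simp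
    qed
    from mat_lift[OF DF c1 this] obtain h where h: "h \<in> mats (b (Suc 0)) (b 0)" and Dh: "D 0 * h = c 0 - 1\<^sub>m (b 0)"
      by auto
    have "D 0 *\<^sub>v (X 0 h *\<^sub>v v) = 0\<^sub>v (b 0)" if v: "v \<in> vecs (b (Suc 0))" for v
    proof -
      have Dv: "D 0 *\<^sub>v v \<in> vecs (b 0)" by (rule mult_mat_vec_mem[OF DF v])
      have "D 0 *\<^sub>v (h *\<^sub>v (D 0 *\<^sub>v v)) = c 0 *\<^sub>v (D 0 *\<^sub>v v) - D 0 *\<^sub>v v"
        using assoc_mult_mat_vec[OF mats_carrier[OF DF] mats_carrier[OF h] vecs_carrier[OF Dv]] Dh c1_vec[OF Dv] by simp
      then show ?thesis
        using D_X[OF h v] vecs_carrier[OF mult_mat_vec_mem[OF c[of 0] Dv]] vecs_carrier[OF Dv]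
          minus_vec_mem[OF mult_mat_vec_mem[OF c[of 0] Dv] Dv] vecs_carrier by auto
    qed
    with h show ?thesis unfolding P_def by blast
  qed
  moreover have "\<exists>h'. P (Suc i) h' \<and> D (Suc i) * h' = X i h" if "P i h" for h i
  proof -
    have h: "h \<in> mats (b (Suc i)) (b i)"
      and DX0: "\<And>v. v \<in> vecs (b (Suc i)) \<Longrightarrow> D i *\<^sub>v (X i h *\<^sub>v v) = 0\<^sub>v (b i)"
      using that unfolding P_def by auto
    have "X i h *\<^sub>v v \<in> (*\<^sub>v) (D (Suc i)) ` vecs (b (Suc (Suc i)))" if "v \<in> vecs (b (Suc i))" for v
      using diff_exact[OF F mult_mat_vec_mem[OF X[OF h] that]] DX0[OF that] by simp
    from mat_lift[OF DF X[OF h] this] obtain h' where h': "h' \<in> mats (b (Suc (Suc i))) (b (Suc i))"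
      and Dh': "D (Suc i) * h' = X i h" by auto
    have "D (Suc i) *\<^sub>v (X (Suc i) h' *\<^sub>v v) = 0\<^sub>v (b (Suc i))" if v: "v \<in> vecs (b (Suc (Suc i)))" for v
    proof -
      have Dv: "D (Suc i) *\<^sub>v v \<in> vecs (b (Suc i))" by (rule mult_mat_vec_mem[OF DF v])
      have cDv: "c (Suc i) *\<^sub>v (D (Suc i) *\<^sub>v v) \<in> vecs (b (Suc i))" by (rule mult_mat_vec_mem[OF c Dv])
      have "D (Suc i) *\<^sub>v (h' *\<^sub>v (D (Suc i) *\<^sub>v v)) = X i h *\<^sub>v (D (Suc i) *\<^sub>v v)"
        using assoc_mult_mat_vec[OF mats_carrier[OF DF] mats_carrier[OF h'] vecs_carrier[OF Dv]] Dh' by simp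
      also have "\<dots> = c (Suc i) *\<^sub>v (D (Suc i) *\<^sub>v v) - D (Suc i) *\<^sub>v v"
        using vecs_carrier[OF minus_vec_mem[OF cDv Dv]] mult_mat_vec_zero[OF mats_carrier[OF h]]
        by (simp add: X_vec[OF h Dv] diff_diff_vec[OF F v])
      finally show ?thesis
        unfolding D_X[OF h' v] using minus_vec_mem[OF cDv Dv] vecs_carrier by auto
    qed
    with h' Dh' show ?thesis unfolding P_def by auto
  qed
  ultimately obtain h where "\<And>i. P i (h i) \<and> D (Suc i) * h (Suc i) = X i (h i)"
    using dependent_nat_choice[of P "\<lambda>i h h'. D (Suc i) * h' = X i h"] by auto
  then show thesis using that unfolding P_def X_def by blast
qed

text \<open>\<open>D\<close> is arbitrary, while the differentials of \<open>D'\<close> die under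
  the ring homomorphism \<open>\<tau>\<close> to the field. After applying \<open>\<tau>\<close>,
  the chain maps \<open>f\<close> and \<open>g\<close> compose to the identity on the minimal side,
  because every homotopy term there contains a differential of \<open>D'\<close>. On the other side
  they compose to the identity up to homotopy, so the homology has the dimension
  \<open>b' (Suc i)\<close>.\<close>

theorem kernel_dim_resolution:
  fixes \<tau> :: "'a \<Rightarrow> 'k::field"
  assumes F: "resolves b D \<epsilon>" and G: "resolves b' D' \<epsilon>'" and hom: "comm_ring_hom \<tau>"
    and minimal: "\<And>i. map_mat \<tau> (D' i) = 0\<^sub>m (b' i) (b' (Suc i))"
  shows "kernel_dim (map_mat \<tau> (D i))
       = b' (Suc i) + vec_space.rank (b (Suc i)) (map_mat \<tau> (D (Suc i)))"
proof -
  interpret \<tau>: comm_ring_hom \<tau> by (rule hom)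
  note DF = diff_mats[OF F] and DG = diff_mats[OF G]
  obtain f where f: "\<And>i. f i \<in> mats (b' i) (b i)"
    and f_aug: "\<And>v. v \<in> vecs (b 0) \<Longrightarrow> \<epsilon>' \<bullet> (f 0 *\<^sub>v v) - \<epsilon> \<bullet> v \<in> K"
    and f_chain: "\<And>i. D' i * f (Suc i) = f i * D i"
    using chain_map_exists[OF F G] by blast
  obtain g where g: "\<And>i. g i \<in> mats (b i) (b' i)"
    and g_aug: "\<And>v. v \<in> vecs (b' 0) \<Longrightarrow> \<epsilon> \<bullet> (g 0 *\<^sub>v v) - \<epsilon>' \<bullet> v \<in> K"
    and g_chain: "\<And>i. D i * g (Suc i) = g i * D' i"
    using chain_map_exists[OF G F] by blast
  note C = mats_carrier[OF f] mats_carrier[OF g] mats_carrier[OF DF] mats_carrier[OF DG]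
  \<comment> \<open>Stated for arbitrary pairs of resolutions because it is needed twice, for g f on
    \<open>D\<close> and for f g on \<open>D'\<close>.\<close>
  have homotopy: "\<exists>h. (\<forall>i. h i \<in> mats (b (Suc i)) (b i)) \<and>
      (\<forall>i. D (Suc i) * h (Suc i) = g (Suc i) * f (Suc i) - 1\<^sub>m (b (Suc i)) - h i * D i)"
    if F: "resolves b D \<epsilon>" and G: "resolves b' D' \<epsilon>'"
      and f: "\<And>i. f i \<in> mats (b' i) (b i)" and g: "\<And>i. g i \<in> mats (b i) (b' i)"
      and f_aug: "\<And>v. v \<in> vecs (b 0) \<Longrightarrow> \<epsilon>' \<bullet> (f 0 *\<^sub>v v) - \<epsilon> \<bullet> v \<in> K"
      and f_chain: "\<And>i. D' i * f (Suc i) = f i * D i"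
      and g_aug: "\<And>v. v \<in> vecs (b' 0) \<Longrightarrow> \<epsilon> \<bullet> (g 0 *\<^sub>v v) - \<epsilon>' \<bullet> v \<in> K"
      and g_chain: "\<And>i. D i * g (Suc i) = g i * D' i" for b D \<epsilon> b' D' \<epsilon>' f g
  proof -
    note C = mats_carrier[OF f] mats_carrier[OF g] mats_carrier[OF diff_mats[OF F]] mats_carrier[OF diff_mats[OF G]]
    have "\<epsilon> \<bullet> (g 0 * f 0 *\<^sub>v v) - \<epsilon> \<bullet> v \<in> K" if v: "v \<in> vecs (b 0)" for v
      using ideal_add[OF g_aug[OF mult_mat_vec_mem[OF f v]] f_aug[OF v]]
      by (simp add: assoc_mult_mat_vec[OF C(2) C(1) vecs_carrier[OF v]])
    moreover have "D i * (g (Suc i) * f (Suc i)) = g i * f i * D i" for i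
      by (simp add: assoc_mult_mat[OF C(3) C(2) C(1), symmetric] g_chain
          assoc_mult_mat[OF C(2) C(4) C(1)] f_chain assoc_mult_mat[OF C(2) C(1) C(3)])
    ultimately show ?thesis
      using chain_homotopy_exists[OF F mult_mat_mem[OF g f]] by metis
  qed
  obtain h where h: "\<And>i. h i \<in> mats (b (Suc i)) (b i)"
    and Dh: "\<And>i. D (Suc i) * h (Suc i) = g (Suc i) * f (Suc i) - 1\<^sub>m (b (Suc i)) - h i * D i"
    using homotopy[OF F G f g f_aug f_chain g_aug g_chain] by blast
  obtain k where k: "\<And>i. k i \<in> mats (b' (Suc i)) (b' i)"
    and Dk: "\<And>i. D' (Suc i) * k (Suc i) = f (Suc i) * g (Suc i) - 1\<^sub>m (b' (Suc i)) - k i * D' i"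
    using homotopy[OF G F g f g_aug g_chain f_aug f_chain] by blast
  note C = C mats_carrier[OF h] mats_carrier[OF k]
  note \<tau>mult = \<tau>.mat_hom_mult
  let ?t = "map_mat \<tau>"
  have tC: "?t (f i) \<in> carrier_mat (b' i) (b i)" "?t (g i) \<in> carrier_mat (b i) (b' i)"
    "?t (D i) \<in> carrier_mat (b i) (b (Suc i))" "?t (h i) \<in> carrier_mat (b (Suc i)) (b i)"
    "?t (k i) \<in> carrier_mat (b' (Suc i)) (b' i)" for i
    using C(1)[of i] C(2)[of i] C(3)[of i] C(5)[of i] C(6)[of i] by auto
  have t_minus: "?t (X - Y - Z) = ?t X - ?t Y - ?t Z"
    if "X \<in> carrier_mat m n" "Y \<in> carrier_mat m n" "Z \<in> carrier_mat m n" for X Y Z m n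
    using that by (intro eq_matI) (auto simp: \<tau>.hom_minus)
  show ?thesis
  proof (rule kernel_dim_eq_add_rank[OF tC(3) tC(3) tC(1) tC(2)])
    show "?t (D i) * ?t (D (Suc i)) = 0\<^sub>m (b i) (b (Suc (Suc i)))"
      unfolding \<tau>mult[OF C(3) C(3), symmetric] diff_diff[OF F] by (intro eq_matI) auto
    show "?t (D i) * ?t (g (Suc i)) = 0\<^sub>m (b i) (b' (Suc i))"
      unfolding \<tau>mult[OF C(3) C(2), symmetric] g_chain \<tau>mult[OF C(2) C(4)] minimal
      using tC(2)[of i] by simp
    show "?t (f (Suc i)) * ?t (D (Suc i)) = 0\<^sub>m (b' (Suc i)) (b (Suc (Suc i)))"
      unfolding \<tau>mult[OF C(1) C(3), symmetric] f_chain[symmetric] \<tau>mult[OF C(4) C(1)] minimal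
      using tC(1)[of "Suc (Suc i)"] by simp
    \<comment> \<open>Under \<open>\<tau>\<close> both homotopy terms for f g vanish with
      \<open>D'\<close>, leaving f g - 1 = 0.\<close>
    have "0\<^sub>m (b' (Suc i)) (b' (Suc i)) = ?t (D' (Suc i) * k (Suc i))"
      unfolding \<tau>mult[OF C(4) C(6)] minimal using tC(5)[of "Suc i"] by simp
    also have "\<dots> = ?t (f (Suc i)) * ?t (g (Suc i)) - 1\<^sub>m (b' (Suc i)) - ?t (k i) * 0\<^sub>m (b' i) (b' (Suc i))"
      unfolding Dk by (subst t_minus[OF mult_carrier_mat[OF C(1) C(2)] one_carrier_mat mult_carrier_mat[OF C(6) C(4)]])
        (simp add: \<tau>mult[OF C(1) C(2)] \<tau>mult[OF C(6) C(4)] minimal \<tau>.mat_hom_one)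
    finally have eq: "?t (f (Suc i)) * ?t (g (Suc i)) - 1\<^sub>m (b' (Suc i)) - 0\<^sub>m (b' (Suc i)) (b' (Suc i)) = 0\<^sub>m (b' (Suc i)) (b' (Suc i))"
      using tC(5)[of i] by simp
    show "?t (f (Suc i)) * ?t (g (Suc i)) = 1\<^sub>m (b' (Suc i))"
    proof (rule eq_matI)
      fix p q assume "p < dim_row (1\<^sub>m (b' (Suc i)))" "q < dim_col (1\<^sub>m (b' (Suc i)))"
      then show "(?t (f (Suc i)) * ?t (g (Suc i))) $$ (p, q) = 1\<^sub>m (b' (Suc i)) $$ (p, q)"
        using arg_cong[OF eq, of "\<lambda>M. M $$ (p, q)"] tC(1)[of "Suc i"] tC(2)[of "Suc i"] by auto
    qed (use tC(1)[of "Suc i"] tC(2)[of "Suc i"] in auto)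
  next
    fix z assume z: "z \<in> carrier_vec (b (Suc i))" and Dz: "?t (D i) *\<^sub>v z = 0\<^sub>v (b i)"
      and fz: "?t (f (Suc i)) *\<^sub>v z = 0\<^sub>v (b' (Suc i))"
    let ?n = "b (Suc i)"
    \<comment> \<open>For \<open>z\<close> killed by both \<open>D i\<close> and \<open>f\<close>,
      two of the three terms of the homotopy formula vanish, leaving D h z = -z; hence
      \<open>z\<close> is a boundary.\<close>
    have "?t (D (Suc i)) * ?t (h (Suc i)) = ?t (g (Suc i)) * ?t (f (Suc i)) - 1\<^sub>m ?n - ?t (h i) * ?t (D i)"
      unfolding \<tau>mult[OF C(3) C(5), symmetric] Dh
      by (subst t_minus[OF mult_carrier_mat[OF C(2) C(1)] one_carrier_mat mult_carrier_mat[OF C(5) C(3)]])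
        (simp add: \<tau>mult[OF C(2) C(1)] \<tau>mult[OF C(5) C(3)] \<tau>.mat_hom_one)
    then have "?t (D (Suc i)) * ?t (h (Suc i)) *\<^sub>v z
        = (?t (g (Suc i)) * ?t (f (Suc i)) - 1\<^sub>m ?n - ?t (h i) * ?t (D i)) *\<^sub>v z" by simp
    also have "\<dots> = ?t (g (Suc i)) *\<^sub>v (?t (f (Suc i)) *\<^sub>v z) - z - ?t (h i) *\<^sub>v (?t (D i) *\<^sub>v z)"
      using tC(1,2)[of "Suc i"] tC(3,4)[of i] z
      by (subst minus_mult_distrib_mat_vec[of _ ?n ?n], auto)
         (subst minus_mult_distrib_mat_vec[of _ ?n ?n], auto)
    also have "\<dots> = - z"
      using tC(2)[of "Suc i"] tC(4)[of i] z by (auto simp: fz Dz)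
    finally have eq: "?t (D (Suc i)) * ?t (h (Suc i)) *\<^sub>v z = - z" .
    have hz: "?t (h (Suc i)) *\<^sub>v z \<in> carrier_vec (b (Suc (Suc i)))"
      using tC(4) z by (rule mult_mat_vec_carrier)
    have "?t (D (Suc i)) *\<^sub>v (- (?t (h (Suc i)) *\<^sub>v z)) = - (- z)"
      unfolding mult_mat_vec_uminus[OF tC(3) hz] assoc_mult_mat_vec[OF tC(3) tC(4) z, symmetric] eq ..
    then have "z = ?t (D (Suc i)) *\<^sub>v (- (?t (h (Suc i)) *\<^sub>v z))" by simp
    moreover have "- (?t (h (Suc i)) *\<^sub>v z) \<in> carrier_vec (b (Suc (Suc i)))"
      using hz by simp
    ultimately show "\<exists>y\<in>carrier_vec (b (Suc (Suc i))). z = ?t (D (Suc i)) *\<^sub>v y" by blast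
  qed
qed

end

section \<open>Mapping cones\<close>

context coeff_ideal begin

text \<open>The block matrices form the mapping cone of multiplication by \<open>f\<close> on the
  given resolution. \<open>c\<close> and \<open>E\<close> are the ranks and differentials of the
  shifted copy; the sign in \<open>E\<close> makes consecutive maps compose to zero, and in degree 0
  the shifted copy is empty. The augmentation vector is (1) both before and after, so the
  construction can be iterated.\<close>

lemma cone_resolves:
  assumes F: "resolves b D \<epsilon>" and b0: "b 0 = 1" and eps: "\<epsilon> = vec 1 (\<lambda>_. 1)"
    and f: "f \<in> A" and nzd: "\<And>r. r \<in> A \<Longrightarrow> f * r \<in> K \<Longrightarrow> r \<in> K"
    and K': "K' = {p + f * r | p r. p \<in> K \<and> r \<in> A}"
  defines "c \<equiv> \<lambda>i. case i of 0 \<Rightarrow> 0 | Suc j \<Rightarrow> b j"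
    and "E \<equiv> \<lambda>i. case i of 0 \<Rightarrow> 0\<^sub>m 0 (b 0) | Suc j \<Rightarrow> - D j"
  shows "coeff_ideal.resolves A K' (\<lambda>i. b i + c i)
           (\<lambda>i. four_block_mat (D i) (f \<cdot>\<^sub>m 1\<^sub>m (b i)) (0\<^sub>m (c i) (b (Suc i))) (E i)) \<epsilon>"
proof -
  note DF = diff_mats[OF F]
  interpret K': coeff_ideal A K'
  proof
    show "K' \<subseteq> A" unfolding K' using ideal_subset f by (auto intro!: add_mem mult_mem)
    have "0 = 0 + f * 0" by simp
    then show "0 \<in> K'" unfolding K' using ideal_zero zero_mem by blast
    show "x + y \<in> K'" if x: "x \<in> K'" and y: "y \<in> K'" for x y
    proof -
      obtain p r where "x = p + f * r" "p \<in> K" "r \<in> A" using x unfolding K' by auto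
      moreover obtain q s where "y = q + f * s" "q \<in> K" "s \<in> A" using y unfolding K' by auto
      ultimately have "x + y = (p + q) + f * (r + s)" "p + q \<in> K" "r + s \<in> A"
        by (auto simp: algebra_simps ideal_add add_mem)
      then show ?thesis unfolding K' by blast
    qed
    show "a * x \<in> K'" if a: "a \<in> A" and x: "x \<in> K'" for a x
    proof -
      obtain p r where "x = p + f * r" "p \<in> K" "r \<in> A" using x unfolding K' by auto
      then have "a * x = a * p + f * (a * r)" "a * p \<in> K" "a * r \<in> A"
        using a by (auto simp: algebra_simps ideal_mult mult_mem)
      then show ?thesis unfolding K' by blast
    qed
  qed
  have E: "E i \<in> mats (c i) (b i)" for i
  proof (cases i)
    case (Suc j)
    then show ?thesis using DF[of j] by (auto simp: E_def c_def mats_def uminus_mem)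
  qed (simp add: E_def c_def zero_mat_mem)
  define B where "B i = four_block_mat (D i) (f \<cdot>\<^sub>m 1\<^sub>m (b i)) (0\<^sub>m (c i) (b (Suc i))) (E i)" for i
  have B: "B i \<in> mats (b i + c i) (b (Suc i) + b i)" for i
    using DF[of i] E[of i] f by (auto simp: B_def mats_def mult_mem)
  have c_Suc: "c (Suc i) = b i" for i by (simp add: c_def)
  have E_Suc: "E (Suc i) = - D i" for i by (simp add: E_def)
  have B_vec: "B i *\<^sub>v (u @\<^sub>v w) = (D i *\<^sub>v u + f \<cdot>\<^sub>v w) @\<^sub>v (E i *\<^sub>v w)"
    if u: "u \<in> vecs (b (Suc i))" and w: "w \<in> vecs (b i)" for i u w
  proof -
    have "(f \<cdot>\<^sub>m 1\<^sub>m (b i)) *\<^sub>v w = f \<cdot>\<^sub>v w"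
      using vecs_carrier[OF w] by (intro eq_vecI) auto
    moreover have "0\<^sub>m (c i) (b (Suc i)) *\<^sub>v u + E i *\<^sub>v w = E i *\<^sub>v w"
      using mult_mat_vec_mem[OF E w] by (simp add: zero_mult_mat_vec[OF vecs_carrier[OF u]] vecs_def)
    ultimately show ?thesis
      unfolding B_def
      using four_block_mat_mult_vec[OF mats_carrier[OF DF] _ zero_carrier_mat mats_carrier[OF E] vecs_carrier[OF u] vecs_carrier[OF w], of "f \<cdot>\<^sub>m 1\<^sub>m (b i)"]
      by simp
  qed
  have cancel: "f \<cdot>\<^sub>v z + f \<cdot>\<^sub>v (- z) = 0\<^sub>v n" if "z \<in> carrier_vec n" for z n
    using that by (intro eq_vecI) auto
  have neg: "- X *\<^sub>v (- z) = X *\<^sub>v z" if "X \<in> carrier_mat m n" "z \<in> carrier_vec n" for X :: "'a mat" and z m n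
    using that by (auto simp: mult_mat_vec_uminus)
  have append_mem: "u @\<^sub>v w \<in> vecs (m + n)" if "u \<in> vecs m" "w \<in> vecs n" for u w m n
    using that by (auto simp: vecs_def)
  have append_cases: "\<exists>u w. v = u @\<^sub>v w \<and> u \<in> vecs m \<and> w \<in> vecs n" if v: "v \<in> vecs (m + n)" for v m n
  proof (intro exI conjI)
    show "v = vec_first v m @\<^sub>v vec_last v n"
      using vec_first_last_append[OF vecs_carrier[OF v]] by simp
    show "vec_first v m \<in> vecs m" using v by (auto simp: vecs_def vec_first_def)
    show "vec_last v n \<in> vecs n" using v by (auto simp: vecs_def vec_last_def)
  qed
  \<comment> \<open>In degree 0 this is the regularity of \<open>f\<close>, in higher degrees the exactness of \<open>D\<close>.\<close>
  have boundary: "w \<in> (*\<^sub>v) (D i) ` vecs (b (Suc i))"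
    if u: "u \<in> vecs (b (Suc i))" and w: "w \<in> vecs (b i)" and Ew: "E i *\<^sub>v w = 0\<^sub>v (c i)"
      and Du: "D i *\<^sub>v u + f \<cdot>\<^sub>v w = 0\<^sub>v (b i)" for i u w
  proof (cases i)
    case 0
    have D0: "D 0 *\<^sub>v u \<in> vecs (b 0)" using mult_mat_vec_mem[OF DF u] 0 by simp
    have eps_v: "\<epsilon> \<bullet> v = v $ 0" if "v \<in> vecs (b 0)" for v
      using that b0 by (auto simp: eps scalar_prod_def vecs_def)
    have "(D 0 *\<^sub>v u) $ 0 + f * w $ 0 = 0"
      using arg_cong[OF Du, of "\<lambda>v. v $ 0"] w D0 b0 0 by (auto simp add: vecs_def)
    moreover have "(D 0 *\<^sub>v u) $ 0 \<in> K"
      using augm_exact[OF F D0] u eps_v[OF D0] 0 by auto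
    ultimately have "f * w $ 0 \<in> K"
      using ideal_uminus by (metis add_eq_0_iff)
    then have "w $ 0 \<in> K" using nzd vecs_index[OF w] b0 0 by simp
    then show ?thesis using augm_exact[OF F] w eps_v 0 by simp
  next
    case (Suc j)
    have "- (D j *\<^sub>v w) = 0\<^sub>v (b j)"
      using Ew mats_carrier[OF DF[of j]] vecs_carrier[OF w] by (simp add: Suc E_Suc c_Suc)
    then have "D j *\<^sub>v w = 0\<^sub>v (b j)"
      using uminus_zero_vec_eq[OF mult_mat_vec_carrier[OF mats_carrier[OF DF[of j]]]]
        vecs_carrier[OF w] Suc by simp
    then show ?thesis using diff_exact[OF F, of w j] w Suc by simp
  qed
  show ?thesis
    unfolding K'.resolves_def B_def[symmetric]
  proof (intro conjI allI ballI)
    show "B i \<in> mats (b i + c i) (b (Suc i) + c (Suc i))" for i using B[of i] by (simp add: c_Suc)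
    show "\<epsilon> \<in> vecs (b 0 + c 0)" using augm_vecs[OF F] by (simp add: c_def)
    show "\<exists>v\<in>vecs (b 0 + c 0). \<epsilon> \<bullet> v - p \<in> K'" if p: "p \<in> A" for p
    proof -
      have "K \<subseteq> K'"
      proof
        fix x assume "x \<in> K"
        moreover have "x = x + f * 0" by simp
        ultimately show "x \<in> K'" unfolding K' using zero_mem by blast
      qed
      then show ?thesis using augm_surj[OF F p] by (auto simp: c_def)
    qed
    have eps_v: "\<epsilon> \<bullet> v = v $ 0" if "v \<in> vecs 1" for v
      using that b0 by (auto simp: eps scalar_prod_def vecs_def)
    have E0: "E 0 *\<^sub>v w = 0\<^sub>v 0" for w by (intro eq_vecI) (auto simp: E_def)
    show "{v \<in> vecs (b 0 + c 0). \<epsilon> \<bullet> v \<in> K'} = (*\<^sub>v) (B 0) ` vecs (b 1 + c 1)"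
    proof (intro equalityI subsetI)
      fix v assume "v \<in> {v \<in> vecs (b 0 + c 0). \<epsilon> \<bullet> v \<in> K'}"
      then have v: "v \<in> vecs 1" and "v $ 0 \<in> K'" using b0 eps_v by (auto simp: c_def)
      then obtain p r where p: "v $ 0 = p + f * r" "p \<in> K" and r: "r \<in> A" unfolding K' by auto
      define w where "w = vec 1 (\<lambda>_. r)"
      define v' where "v' = vec 1 (\<lambda>_. p)"
      have w: "w \<in> vecs (b 0)" using r b0 by (auto simp: w_def vecs_def)
      have v': "v' \<in> vecs (b 0)" using p ideal_subset b0 by (auto simp: v'_def vecs_def)
      have "\<epsilon> \<bullet> v' \<in> K" using p eps_v[of v'] v' b0 by (simp add: v'_def)
      then obtain u where u: "u \<in> vecs (b 1)" "v' = D 0 *\<^sub>v u" using augm_exact[OF F v'] by auto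
      have "(D 0 *\<^sub>v u) $ 0 = p" using arg_cong[OF u(2), of "\<lambda>x. x $ 0"] by (simp add: v'_def)
      then have "v = B 0 *\<^sub>v (u @\<^sub>v w)"
        using B_vec[of u 0 w] u(1) w v b0 p E0[of w] mult_mat_vec_mem[OF DF u(1)[unfolded One_nat_def]]
        by (intro eq_vecI) (auto simp: vecs_def w_def v'_def)
      then show "v \<in> (*\<^sub>v) (B 0) ` vecs (b 1 + c 1)"
        using append_mem[OF u(1) w] by (auto simp: c_def)
    next
      fix v assume "v \<in> (*\<^sub>v) (B 0) ` vecs (b 1 + c 1)"
      then obtain x where x: "x \<in> vecs (b 1 + b 0)" "v = B 0 *\<^sub>v x" by (auto simp: c_def)
      obtain u w where uw: "x = u @\<^sub>v w" "u \<in> vecs (b 1)" "w \<in> vecs (b 0)"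
        using append_cases[OF x(1)] by blast
      have v: "v \<in> vecs (b 0 + c 0)" using mult_mat_vec_mem[OF B[of 0]] x by simp
      have Du: "D 0 *\<^sub>v u \<in> vecs 1" using mult_mat_vec_mem[OF DF[of 0]] uw b0 by simp
      have "(D 0 *\<^sub>v u) $ 0 \<in> K"
        using augm_exact[OF F, of "D 0 *\<^sub>v u"] Du uw(2) eps_v[OF Du] b0 by auto
      moreover have "v $ 0 = (D 0 *\<^sub>v u) $ 0 + f * w $ 0"
        using B_vec[of u 0 w] uw x(2) b0 Du by (auto simp: vecs_def)
      ultimately have "v $ 0 \<in> K'" unfolding K' using vecs_index[OF uw(3)] b0 by auto
      then show "v \<in> {v \<in> vecs (b 0 + c 0). \<epsilon> \<bullet> v \<in> K'}"
        using v eps_v[of v] b0 by (simp add: c_def)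
    qed
    show "{v \<in> vecs (b (Suc i) + c (Suc i)). B i *\<^sub>v v = 0\<^sub>v (b i + c i)}
        = (*\<^sub>v) (B (Suc i)) ` vecs (b (Suc (Suc i)) + c (Suc (Suc i)))" for i
      unfolding c_Suc
    proof (intro equalityI subsetI)
      fix v assume "v \<in> {v \<in> vecs (b (Suc i) + b i). B i *\<^sub>v v = 0\<^sub>v (b i + c i)}"
      then have v: "v \<in> vecs (b (Suc i) + b i)" and Bv: "B i *\<^sub>v v = 0\<^sub>v (b i + c i)" by auto
      obtain u w where uw: "v = u @\<^sub>v w" "u \<in> vecs (b (Suc i))" "w \<in> vecs (b i)"
        using append_cases[OF v] by blast
      have Du: "D i *\<^sub>v u \<in> vecs (b i)" by (rule mult_mat_vec_mem[OF DF uw(2)])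
      have DuC: "D i *\<^sub>v u + f \<cdot>\<^sub>v w \<in> carrier_vec (b i)"
        using vecs_carrier[OF Du] vecs_carrier[OF uw(3)] by simp
      have "(D i *\<^sub>v u + f \<cdot>\<^sub>v w) @\<^sub>v (E i *\<^sub>v w) = 0\<^sub>v (b i) @\<^sub>v 0\<^sub>v (c i)"
        using Bv B_vec[OF uw(2,3)] uw(1) by (auto intro!: eq_vecI)
      then have Duw: "D i *\<^sub>v u + f \<cdot>\<^sub>v w = 0\<^sub>v (b i)" and Ew: "E i *\<^sub>v w = 0\<^sub>v (c i)"
        using append_vec_eq[OF DuC zero_carrier_vec] by auto
      \<comment> \<open>Diagram chase: \<open>w\<close> is a boundary D x, so u + f x is a cycle and
        equals D y; then (y, -x) is a preimage of (u, w).\<close>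
      obtain x where x: "x \<in> vecs (b (Suc i))" "w = D i *\<^sub>v x"
        using boundary[OF uw(2,3) Ew Duw] by auto
      have fx: "f \<cdot>\<^sub>v x \<in> vecs (b (Suc i))" by (rule smult_vec_mem[OF f x(1)])
      have "D i *\<^sub>v (u + f \<cdot>\<^sub>v x) = 0\<^sub>v (b i)"
        using Duw mult_add_distrib_mat_vec[OF mats_carrier[OF DF] vecs_carrier[OF uw(2)] vecs_carrier[OF fx]]
          mult_mat_smult_vec[OF mats_carrier[OF DF] vecs_carrier[OF x(1)]] by (simp add: x(2))
      then obtain y where y: "y \<in> vecs (b (Suc (Suc i)))" "u + f \<cdot>\<^sub>v x = D (Suc i) *\<^sub>v y"
        using diff_exact[OF F add_vec_mem[OF uw(2) fx]] by auto
      have x': "- x \<in> vecs (b (Suc i))" by (rule uminus_vec_mem[OF x(1)])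
      have "B (Suc i) *\<^sub>v (y @\<^sub>v - x) = (u + f \<cdot>\<^sub>v x + f \<cdot>\<^sub>v (- x)) @\<^sub>v (- D i *\<^sub>v (- x))"
        using B_vec[OF y(1) x'] y(2) by (simp add: E_Suc)
      also have "u + f \<cdot>\<^sub>v x + f \<cdot>\<^sub>v (- x) = u"
        using vecs_carrier[OF uw(2)] vecs_carrier[OF x(1)] by (intro eq_vecI) auto
      also have "- D i *\<^sub>v (- x) = w"
        using vecs_carrier[OF x(1)] mats_carrier[OF DF[of i]]
        by (simp add: x(2) mult_mat_vec_uminus[OF mats_carrier[OF DF] vecs_carrier[OF x(1)]])
      finally have "v = B (Suc i) *\<^sub>v (y @\<^sub>v - x)" by (simp add: uw(1))
      then show "v \<in> (*\<^sub>v) (B (Suc i)) ` vecs (b (Suc (Suc i)) + b (Suc i))"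
        using append_mem[OF y(1) x'] by blast
    next
      fix v assume "v \<in> (*\<^sub>v) (B (Suc i)) ` vecs (b (Suc (Suc i)) + b (Suc i))"
      then obtain z where z: "z \<in> vecs (b (Suc (Suc i)) + b (Suc i))" "v = B (Suc i) *\<^sub>v z" by auto
      obtain y x where yx: "z = y @\<^sub>v x" "y \<in> vecs (b (Suc (Suc i)))" "x \<in> vecs (b (Suc i))"
        using append_cases[OF z(1)] by blast
      have v: "v = (D (Suc i) *\<^sub>v y + f \<cdot>\<^sub>v x) @\<^sub>v (- D i *\<^sub>v x)"
        using z(2) B_vec[OF yx(2,3)] by (simp add: yx(1) E_Suc)
      have fx: "f \<cdot>\<^sub>v x \<in> vecs (b (Suc i))" by (rule smult_vec_mem[OF f yx(3)])
      have Dy: "D (Suc i) *\<^sub>v y \<in> vecs (b (Suc i))" by (rule mult_mat_vec_mem[OF DF yx(2)])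
      have Dx: "D i *\<^sub>v x \<in> vecs (b i)" by (rule mult_mat_vec_mem[OF DF yx(3)])
      have Dx': "- D i *\<^sub>v x = - (D i *\<^sub>v x)"
        using vecs_carrier[OF yx(3)] mats_carrier[OF DF[of i]] by simp
      have u: "D (Suc i) *\<^sub>v y + f \<cdot>\<^sub>v x \<in> vecs (b (Suc i))" by (rule add_vec_mem[OF Dy fx])
      have w: "- D i *\<^sub>v x \<in> vecs (b i)" unfolding Dx' by (rule uminus_vec_mem[OF Dx])
      have "D i *\<^sub>v (D (Suc i) *\<^sub>v y + f \<cdot>\<^sub>v x) = f \<cdot>\<^sub>v (D i *\<^sub>v x)"
        using mult_add_distrib_mat_vec[OF mats_carrier[OF DF] vecs_carrier[OF Dy] vecs_carrier[OF fx]]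
          mult_mat_smult_vec[OF mats_carrier[OF DF] vecs_carrier[OF yx(3)]] diff_diff_vec[OF F yx(2)]
          vecs_carrier[OF Dx] by simp
      then have "D i *\<^sub>v (D (Suc i) *\<^sub>v y + f \<cdot>\<^sub>v x) + f \<cdot>\<^sub>v (- D i *\<^sub>v x) = 0\<^sub>v (b i)"
        unfolding Dx' by (simp add: cancel[OF vecs_carrier[OF Dx]])
      moreover have "E i *\<^sub>v (- D i *\<^sub>v x) = 0\<^sub>v (c i)"
      proof (cases i)
        case 0
        then show ?thesis using E0 by (simp add: c_def)
      next
        case (Suc j)
        have "D j *\<^sub>v (D (Suc j) *\<^sub>v x) = 0\<^sub>v (b j)" using diff_diff_vec[OF F] yx(3) Suc by simp
        then show ?thesis
          unfolding Dx' using neg[OF mats_carrier[OF DF[of j]] vecs_carrier[OF Dx[unfolded Suc]]]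
          by (simp add: Suc E_Suc c_Suc)
      qed
      ultimately have "B i *\<^sub>v v = 0\<^sub>v (b i + c i)"
        unfolding v B_vec[OF u w] by (auto intro!: eq_vecI)
      then show "v \<in> {v \<in> vecs (b (Suc i) + b i). B i *\<^sub>v v = 0\<^sub>v (b i + c i)}"
        using append_mem[OF u w] v by simp
    qed
  qed
qed

end

section \<open>Koszul resolutions of triangular ideals\<close>

lemma keys_exp_add:
  fixes m n :: "nat \<Rightarrow>\<^sub>0 nat"
  shows "Poly_Mapping.keys (m + n) = Poly_Mapping.keys m \<union> Poly_Mapping.keys n"
  by (auto simp: in_keys_iff lookup_add)

lemma mpoly_eq_sum_single:
  fixes p :: "'a \<Rightarrow>\<^sub>0 'k::comm_monoid_add"
  shows "p = (\<Sum>m\<in>Poly_Mapping.keys p. Poly_Mapping.single m (Poly_Mapping.lookup p m))"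
  by (intro poly_mapping_eqI)
    (auto simp: lookup_sum lookup_single when_def sum.delta' in_keys_iff intro: finite_keys)

text \<open>Single terms are considered only at exponents that occur in \<open>p\<close>, so
  hypotheses on the support of \<open>p\<close> remain available in the induction.\<close>

lemma mpoly_induct [case_names zero single add]:
  fixes p :: "'a \<Rightarrow>\<^sub>0 'k::comm_monoid_add"
  assumes "P 0" and "\<And>m c. m \<in> Poly_Mapping.keys p \<Longrightarrow> P (Poly_Mapping.single m c)"
    and "\<And>p q. P p \<Longrightarrow> P q \<Longrightarrow> P (p + q)"
  shows "P p"
proof -
  have "P (\<Sum>m\<in>S. Poly_Mapping.single m (Poly_Mapping.lookup p m))" if "S \<subseteq> Poly_Mapping.keys p" for S
    using finite_subset[OF that finite_keys] that by (induction S rule: finite_induct) (auto intro: assms)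
  from this[OF subset_refl] show ?thesis using mpoly_eq_sum_single[of p] by simp
qed

lemma polysI: "(\<And>m. m \<in> Poly_Mapping.keys p \<Longrightarrow> Poly_Mapping.keys m \<subseteq> {..<d}) \<Longrightarrow> p \<in> polys d"
  by (auto simp: polys_def)

lemma polys_single: "Poly_Mapping.keys m \<subseteq> {..<d} \<Longrightarrow> Poly_Mapping.single m c \<in> polys d"
  by (auto simp: polys_def)

lemma polys_mono: "d \<le> e \<Longrightarrow> polys d \<subseteq> polys e"
  by (fastforce simp: polys_def)

lemma coeff_ring_polys: "coeff_ring (polys d :: 'k::comm_ring_1 mpoly set)"
proof
  show "(1 :: 'k mpoly) \<in> polys d" by (auto simp: polys_def)
  show "x + y \<in> polys d" if "x \<in> polys d" "y \<in> polys d" for x y :: "'k mpoly"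
    using that keys_add[of x y] by (fastforce simp: polys_def)
  show "x * y \<in> polys d" if "x \<in> polys d" "y \<in> polys d" for x y :: "'k mpoly"
    using that keys_mult[of x y] by (fastforce simp: polys_def keys_exp_add)
qed (auto simp: polys_def)

lemmas polys_zero = coeff_ring.zero_mem[OF coeff_ring_polys]
  and polys_one = coeff_ring.one_mem[OF coeff_ring_polys]
  and polys_add = coeff_ring.add_mem[OF coeff_ring_polys]
  and polys_mult = coeff_ring.mult_mem[OF coeff_ring_polys]
  and polys_diff = coeff_ring.diff_mem[OF coeff_ring_polys]

text \<open>Biadditive maps are determined by pairs of single terms; cancellation in the target
  forces the value 0 at zero arguments. This reduces multiplicativity claims (constant term,
  \<open>shift\<close>, graded components, \<open>toric_map\<close>) to monomials.\<close>

lemma additive_mult_induct: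
  fixes p q :: "'a::monoid_add \<Rightarrow>\<^sub>0 'k::comm_ring_1"
  assumes "\<And>p p' q. f (p + p') q = f p q + f p' q" "\<And>p q q'. f p (q + q') = f p q + f p q'"
    and "\<And>p p' q. g (p + p') q = g p q + g p' q" "\<And>p q q'. g p (q + q') = g p q + g p q'"
    and single: "\<And>m n b c. m \<in> Poly_Mapping.keys p \<Longrightarrow> n \<in> Poly_Mapping.keys q \<Longrightarrow>
      f (Poly_Mapping.single m b) (Poly_Mapping.single n c) = g (Poly_Mapping.single m b) (Poly_Mapping.single n c)"
  shows "f p q = (g p q :: 'c::cancel_comm_monoid_add)"
proof -
  have zero: "f 0 q = 0" "f p 0 = 0" "g 0 q = 0" "g p 0 = 0" for p q
    using assms(1)[of 0 0 q] assms(2)[of p 0 0] assms(3)[of 0 0 q] assms(4)[of p 0 0] by simp_all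
  show ?thesis
  proof (induction p rule: mpoly_induct)
    case (single m b)
    show ?case
      by (induction q rule: mpoly_induct) (simp_all add: zero assms single)
  qed (simp_all add: zero assms)
qed

text \<open>The residue map P -> k; applied entrywise it is \<open>tensor_residue\<close>. A product
  of monomials is constant only if both factors are.\<close>

lemma comm_ring_hom_const: "comm_ring_hom (\<lambda>p :: 'k::comm_ring_1 mpoly. Poly_Mapping.lookup p 0)"
proof
  show "Poly_Mapping.lookup (p * q) 0 = Poly_Mapping.lookup p 0 * Poly_Mapping.lookup q 0"
    for p q :: "'k mpoly"
  proof (rule additive_mult_induct)
    fix m n :: "nat \<Rightarrow>\<^sub>0 nat" and b c :: 'k
    have "m + n = 0 \<longleftrightarrow> m = 0 \<and> n = 0"
      by (auto simp: poly_mapping_eq_iff fun_eq_iff lookup_add)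
    then show "Poly_Mapping.lookup (Poly_Mapping.single m b * Poly_Mapping.single n c) 0
       = Poly_Mapping.lookup (Poly_Mapping.single m b) 0 * Poly_Mapping.lookup (Poly_Mapping.single n c) 0"
      by (auto simp: mult_single lookup_single when_def)
  qed (simp_all add: lookup_add algebra_simps)
qed (simp_all add: lookup_add)

text \<open>The quotient of the division by $x_v^a$, discarding the remainder.\<close>

definition shift :: "nat \<Rightarrow> nat \<Rightarrow> 'k::zero mpoly \<Rightarrow> 'k mpoly" where
  "shift v a = Poly_Mapping.map_key (\<lambda>m. m + Poly_Mapping.single v a)"

lemma inj_shift: "inj (\<lambda>m :: nat \<Rightarrow>\<^sub>0 nat. m + Poly_Mapping.single v a)"
  by (auto intro: injI)

lemma lookup_shift: "Poly_Mapping.lookup (shift v a p) m = Poly_Mapping.lookup p (m + Poly_Mapping.single v a)"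
  unfolding shift_def by (simp add: map_key.rep_eq[OF inj_shift])

lemma shift_add: "shift v a (p + q :: 'k::comm_ring_1 mpoly) = shift v a p + shift v a q"
  and shift_diff: "shift v a (p - q :: 'k::comm_ring_1 mpoly) = shift v a p - shift v a q"
  and shift_zero: "shift v a (0 :: 'k::comm_ring_1 mpoly) = 0"
  by (auto intro!: poly_mapping_eqI simp: lookup_shift lookup_add lookup_minus)

lemma shift_monom_mult:
  fixes p :: "'k::comm_ring_1 mpoly"
  shows "shift v a (Poly_Mapping.single (Poly_Mapping.single v a) 1 * p) = p"
proof (induction p rule: mpoly_induct)
  case (single m c)
  then show ?case
    by (intro poly_mapping_eqI) (auto simp: mult_single lookup_shift lookup_single when_def add.commute)
qed (simp_all add: shift_add shift_zero distrib_left)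

definition indep :: "nat \<Rightarrow> 'k::zero mpoly \<Rightarrow> bool" where
  "indep v p \<longleftrightarrow> (\<forall>m\<in>Poly_Mapping.keys p. Poly_Mapping.lookup m v = 0)"

text \<open>A term free of x_v leaves the exponent of x_v unchanged, so multiplying by it affects
  neither divisibility by x_v^a nor the quotient.\<close>

lemma shift_mult_indep:
  fixes h p :: "'k::comm_ring_1 mpoly"
  assumes "indep v h"
  shows "shift v a (h * p) = h * shift v a p"
proof (rule additive_mult_induct[where f = "\<lambda>h p. shift v a (h * p)" and g = "\<lambda>h p. h * shift v a p"])
  fix n m :: "nat \<Rightarrow>\<^sub>0 nat" and b c :: 'k assume "n \<in> Poly_Mapping.keys h"
  then have n: "Poly_Mapping.lookup n v = 0" using assms by (auto simp: indep_def)
  let ?s = "Poly_Mapping.single v a"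
  show "shift v a (Poly_Mapping.single n b * Poly_Mapping.single m c)
      = Poly_Mapping.single n b * shift v a (Poly_Mapping.single m c)"
  proof (cases "\<exists>m'. m = m' + ?s")
    case True
    then obtain m' where m': "m = m' + ?s" by blast
    have "shift v a (Poly_Mapping.single (k + ?s) x) = Poly_Mapping.single k x" for k and x :: 'k
      by (intro poly_mapping_eqI) (simp add: lookup_shift lookup_single when_def)
    from this[of m' c] this[of "n + m'" "b * c"] show ?thesis
      by (simp add: m' mult_single add.assoc)
  next
    case False
    have ne: "m \<noteq> k + ?s" for k using False by blast
    have ne': "n + m \<noteq> k + ?s" for k
    proof
      assume "n + m = k + ?s"
      then have eq: "k + ?s = n + m" ..
      have "a \<le> Poly_Mapping.lookup m v"
        using arg_cong[OF eq, of "\<lambda>x. Poly_Mapping.lookup x v"] n by (simp add: lookup_add)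
      then have "m = (m - ?s) + ?s"
        by (intro poly_mapping_eqI) (auto simp: lookup_add lookup_minus lookup_single when_def)
      then show False using False by blast
    qed
    have "shift v a (Poly_Mapping.single m c) = 0"
      by (intro poly_mapping_eqI) (simp add: lookup_shift lookup_single_not_eq[OF ne])
    moreover have "shift v a (Poly_Mapping.single (n + m) (b * c)) = 0"
      by (intro poly_mapping_eqI) (simp add: lookup_shift lookup_single_not_eq[OF ne'])
    ultimately show ?thesis by (simp add: mult_single)
  qed
qed (simp_all add: shift_add algebra_simps)

lemma shift_polys: "p \<in> polys d \<Longrightarrow> shift v a p \<in> polys d"
proof (rule polysI)
  fix m assume p: "p \<in> polys d" and "m \<in> Poly_Mapping.keys (shift v a p)"
  then have "m + Poly_Mapping.single v a \<in> Poly_Mapping.keys p" by (simp add: in_keys_iff lookup_shift)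
  then show "Poly_Mapping.keys m \<subseteq> {..<d}" using p unfolding polys_def keys_exp_add[symmetric]
    using keys_exp_add[of m "Poly_Mapping.single v a"] by blast
qed

text \<open>The n-th iterate divides by x_v^(n a), which eventually exceeds the degree of
  \<open>p\<close> in x_v.\<close>

lemma shift_nilpotent:
  fixes p :: "'k::comm_ring_1 mpoly"
  assumes "a > 0"
  shows "\<exists>n. (shift v a ^^ n) p = 0"
proof -
  have lookup: "Poly_Mapping.lookup ((shift v a ^^ n) p) m = Poly_Mapping.lookup p (m + Poly_Mapping.single v (n * a))" for n m
    by (induction n arbitrary: m) (simp_all add: lookup_shift add.assoc single_add[symmetric])
  \<comment> \<open>A crude bound: the sum of all exponents of x_v in \<open>p\<close> dominates
    each of them.\<close>
  define N where "N = Suc (\<Sum>m\<in>Poly_Mapping.keys p. Poly_Mapping.lookup m v)"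
  have "Poly_Mapping.lookup p (m + Poly_Mapping.single v (N * a)) = 0" for m
  proof (rule ccontr)
    assume "Poly_Mapping.lookup p (m + Poly_Mapping.single v (N * a)) \<noteq> 0"
    then have "m + Poly_Mapping.single v (N * a) \<in> Poly_Mapping.keys p" by (simp add: in_keys_iff)
    then have "Poly_Mapping.lookup (m + Poly_Mapping.single v (N * a)) v < N"
      unfolding N_def less_Suc_eq_le by (intro member_le_sum) auto
    then have "Poly_Mapping.lookup m v + N * a < N" by (simp add: lookup_add)
    then have "N * a < N" by linarith
    with mult_le_mono2[of 1 a N] show False using assms by simp
  qed
  then have "(shift v a ^^ N) p = 0" by (intro poly_mapping_eqI) (simp add: lookup)
  then show ?thesis by blast
qed

text \<open>Applying \<open>shift\<close> to $f r \in K$ gives $r \equiv h\,\sigma(r) \equiv h^2 \sigma^2(r) \equiv \cdots$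
  modulo $K$, and $\sigma = \mathtt{shift}$ is nilpotent on each \<open>r\<close>.\<close>

lemma monic_nonzerodivisor:
  fixes K :: "'k::comm_ring_1 mpoly set"
  assumes K: "coeff_ideal (polys d) K" and closed: "\<And>p. p \<in> K \<Longrightarrow> shift v a p \<in> K"
    and a: "a > 0" and h: "h \<in> polys d" "indep v h"
    and r: "r \<in> polys d" and fr: "(Poly_Mapping.single (Poly_Mapping.single v a) 1 - h) * r \<in> K"
  shows "r \<in> K"
proof -
  interpret coeff_ideal "polys d" K by (rule K)
  \<comment> \<open>The second conjunct is the one-step congruence between consecutive iterates. It
    is propagated by applying \<open>shift\<close>, and multiplied by \<open>h ^ n\<close> it
    advances the first conjunct.\<close>
  have "r - h ^ n * (shift v a ^^ n) r \<in> K \<and> (shift v a ^^ n) r - h * (shift v a ^^ Suc n) r \<in> K" for n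
  proof (induction n)
    case 0
    have "shift v a ((Poly_Mapping.single (Poly_Mapping.single v a) 1 - h) * r) = r - h * shift v a r"
      by (simp add: left_diff_distrib shift_diff shift_monom_mult shift_mult_indep[OF h(2)])
    then show ?case using closed[OF fr] ideal_zero by simp
  next
    case (Suc n)
    let ?s = "\<lambda>n. (shift v a ^^ n) r"
    have "h ^ n \<in> polys d" by (induction n) (auto intro: mult_mem h)
    then have "(r - h ^ n * ?s n) + h ^ n * (?s n - h * ?s (Suc n)) \<in> K"
      using Suc by (intro ideal_add ideal_mult) auto
    then have "r - h ^ Suc n * ?s (Suc n) \<in> K" by (simp add: algebra_simps)
    moreover have "shift v a (?s n - h * ?s (Suc n)) = ?s (Suc n) - h * ?s (Suc (Suc n))"
      by (simp add: shift_diff shift_mult_indep[OF h(2)])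
    then have "?s (Suc n) - h * ?s (Suc (Suc n)) \<in> K" using closed Suc by metis
    ultimately show ?case by blast
  qed
  moreover obtain n where "(shift v a ^^ n) r = 0" using shift_nilpotent[OF a] by blast
  ultimately show ?thesis by (metis diff_zero mult_zero_right)
qed

text \<open>The ideal (q_1, ..., q_c) of P, built up as in \<open>cone_resolves\<close>. Counting
  starts at 1 because q_i introduces the variable x_i, and x_0 has no relation of its own.\<close>

primrec rel_ideal :: "nat \<Rightarrow> (nat \<Rightarrow> 'k::comm_ring_1 mpoly) \<Rightarrow> nat \<Rightarrow> 'k mpoly set" where
  "rel_ideal d q 0 = {0}"
| "rel_ideal d q (Suc c) = {p + q (Suc c) * r | p r. p \<in> rel_ideal d q c \<and> r \<in> polys d}"

text \<open>The binomial coefficient c choose i, in the form of Pascal's rule that the mapping cone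
  produces.\<close>

primrec koszul_rank :: "nat \<Rightarrow> nat \<Rightarrow> nat" where
  "koszul_rank 0 i = (if i = 0 then 1 else 0)"
| "koszul_rank (Suc c) i = koszul_rank c i + (case i of 0 \<Rightarrow> 0 | Suc j \<Rightarrow> koszul_rank c j)"

text \<open>Covers the toric relations and, with h = 0, their initial forms. Being monic in x_i over
  the earlier variables gives regularity; the missing constant term gives minimality of the
  resolution.\<close>

definition triangular_rel :: "nat \<Rightarrow> 'k::comm_ring_1 mpoly \<Rightarrow> bool" where
  "triangular_rel i f \<longleftrightarrow> (\<exists>a h. a > 0 \<and> h \<in> polys i \<and> Poly_Mapping.lookup h 0 = 0
     \<and> f = Poly_Mapping.single (Poly_Mapping.single i a) 1 - h)"

lemma triangular_rel_polys: "triangular_rel i f \<Longrightarrow> i < d \<Longrightarrow> f \<in> polys d"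
  unfolding triangular_rel_def
  using polys_mono[of i d] by (auto intro!: polys_diff polys_single)

lemma triangular_rel_const: "triangular_rel i f \<Longrightarrow> Poly_Mapping.lookup f 0 = 0"
  unfolding triangular_rel_def
  by (auto simp: lookup_minus lookup_single when_def poly_mapping_eq_iff fun_eq_iff)

lemma polys_indep: "p \<in> polys i \<Longrightarrow> i \<le> v \<Longrightarrow> indep v p"
  by (force simp: polys_def indep_def in_keys_iff)

lemma coeff_ideal_rel_ideal:
  assumes "\<And>i. i \<in> {1..c} \<Longrightarrow> q i \<in> polys d"
  shows "coeff_ideal (polys d) (rel_ideal d q c)"
  using assms
proof (induction c)
  case 0
  show ?case
    by (intro coeff_ideal.intro coeff_ideal_axioms.intro coeff_ring_polys) (auto simp: polys_zero)
next
  case (Suc c)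
  then interpret coeff_ideal "polys d" "rel_ideal d q c" by simp
  show ?case
  proof
    show "rel_ideal d q (Suc c) \<subseteq> polys d"
      using ideal_subset Suc.prems by (auto intro!: polys_add polys_mult)
    have "0 = 0 + q (Suc c) * 0" by simp
    then show "0 \<in> rel_ideal d q (Suc c)" 
      unfolding rel_ideal.simps mem_Collect_eq using ideal_zero zero_mem by blast
    show "x + y \<in> rel_ideal d q (Suc c)" if xy: "x \<in> rel_ideal d q (Suc c)" "y \<in> rel_ideal d q (Suc c)" for x y
    proof -
      obtain p r p' s where "x = p + q (Suc c) * r" "y = p' + q (Suc c) * s"
        "p \<in> rel_ideal d q c" "p' \<in> rel_ideal d q c" "r \<in> polys d" "s \<in> polys d"
        using xy by auto
      then have "x + y = (p + p') + q (Suc c) * (r + s)" "p + p' \<in> rel_ideal d q c" "r + s \<in> polys d"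
        by (auto simp: algebra_simps ideal_add add_mem)
      then show ?thesis by auto
    qed
    show "a * x \<in> rel_ideal d q (Suc c)" if a: "a \<in> polys d" and x: "x \<in> rel_ideal d q (Suc c)" for a x
    proof -
      obtain p r where "x = p + q (Suc c) * r" "p \<in> rel_ideal d q c" "r \<in> polys d" using x by auto
      then have "a * x = a * p + q (Suc c) * (a * r)" "a * p \<in> rel_ideal d q c" "a * r \<in> polys d"
        using a by (auto simp: algebra_simps ideal_mult mult_mem)
      then show ?thesis by auto
    qed
  qed
qed

text \<open>\<open>shift\<close> is linear over polynomials free of x_v, hence over all the
  generators. This is the closure hypothesis of \<open>monic_nonzerodivisor\<close>.\<close>

lemma shift_rel_ideal:
  assumes "\<And>i. i \<in> {1..c} \<Longrightarrow> indep v (q i)" and "p \<in> rel_ideal d q c"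
  shows "shift v a p \<in> rel_ideal d q c"
  using assms
proof (induction c arbitrary: p)
  case (Suc c)
  then obtain p' r where p: "p = p' + q (Suc c) * r" "p' \<in> rel_ideal d q c" "r \<in> polys d" by auto
  have "indep v (q (Suc c))" using Suc.prems(1) by simp
  then have "shift v a p = shift v a p' + q (Suc c) * shift v a r"
    by (simp add: p(1) shift_add shift_mult_indep)
  moreover have "shift v a p' \<in> rel_ideal d q c" using Suc.IH p(2) Suc.prems(1) by simp
  ultimately show ?case using shift_polys[OF p(3)] by auto
qed (simp add: shift_zero)

lemma tensor_residue_zero: "tensor_residue (0\<^sub>m m n :: 'k::comm_ring_1 mpoly mat) = 0\<^sub>m m n"
  by (intro eq_matI) (auto simp: tensor_residue_def)

lemma tensor_residue_smult_one:
  fixes f :: "'k::comm_ring_1 mpoly"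
  assumes "Poly_Mapping.lookup f 0 = 0"
  shows "tensor_residue (f \<cdot>\<^sub>m 1\<^sub>m n) = 0\<^sub>m n n"
  using assms by (intro eq_matI) (auto simp: tensor_residue_def)

lemma tensor_residue_uminus:
  fixes X :: "'k::comm_ring_1 mpoly mat"
  assumes "X \<in> carrier_mat m n" "tensor_residue X = 0\<^sub>m m n"
  shows "tensor_residue (- X) = 0\<^sub>m m n"
proof -
  have "tensor_residue (- X) = - tensor_residue X"
    by (intro eq_matI) (auto simp: tensor_residue_def)
  also have "\<dots> = 0\<^sub>m m n" unfolding assms(2) by (intro eq_matI) auto
  finally show ?thesis .
qed

lemma tensor_residue_four_block:
  fixes X Y Z W :: "'k::comm_ring_1 mpoly mat"
  assumes "X \<in> carrier_mat m n" "Y \<in> carrier_mat m n'" "Z \<in> carrier_mat m' n" "W \<in> carrier_mat m' n'"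
    and "tensor_residue X = 0\<^sub>m m n" "tensor_residue Y = 0\<^sub>m m n'"
    and "tensor_residue Z = 0\<^sub>m m' n" "tensor_residue W = 0\<^sub>m m' n'"
  shows "tensor_residue (four_block_mat X Y Z W) = 0\<^sub>m (m + m') (n + n')"
  using assms(5-8) unfolding tensor_residue_def
  by (simp add: map_four_block_mat[OF assms(1-4)])

text \<open>Each relation is monic in a variable that the earlier ones do not contain, hence a
  nonzerodivisor modulo them, and mapping cones can be stacked. The entries of a cone are the old
  entries up to sign, zeros and the new relation, none of which has a constant term.\<close>

lemma koszul_resolution:
  fixes q :: "nat \<Rightarrow> 'k::comm_ring_1 mpoly"
  assumes "c < d" and "\<And>i. i \<in> {1..c} \<Longrightarrow> triangular_rel i (q i)"
  shows "\<exists>D. coeff_ideal.resolves (polys d) (rel_ideal d q c) (koszul_rank c) D (vec 1 (\<lambda>_. 1))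
    \<and> (\<forall>i. tensor_residue (D i) = 0\<^sub>m (koszul_rank c i) (koszul_rank c (Suc i)))"
  using assms
proof (induction c)
  case 0
  interpret coeff_ideal "polys d" "rel_ideal d q 0"
    by (rule coeff_ideal_rel_ideal) simp
  \<comment> \<open>The ideal is zero, so P resolves itself: rank 1 in degree 0, rank 0 elsewhere,
    and every differential an empty matrix.\<close>
  define D where "D i = (0\<^sub>m (koszul_rank 0 i) (koszul_rank 0 (Suc i)) :: 'k mpoly mat)" for i
  have eps: "vec 1 (\<lambda>_. 1) \<bullet> v = v $ 0" if "v \<in> carrier_vec 1" for v :: "'k mpoly vec"
    using that by (simp add: scalar_prod_def)
  have vecs0: "vecs 0 = {0\<^sub>v 0}" by (auto simp: vecs_def)
  have D: "D i *\<^sub>v v = 0\<^sub>v (koszul_rank 0 i)" if "v \<in> carrier_vec 0" for i v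
    using that unfolding D_def by (intro eq_vecI) (auto simp: scalar_prod_def)
  have "resolves (koszul_rank 0) D (vec 1 (\<lambda>_. 1))"
    unfolding resolves_def
  proof (intro conjI allI ballI)
    show "D i \<in> mats (koszul_rank 0 i) (koszul_rank 0 (Suc i))" for i
      unfolding D_def by (rule zero_mat_mem)
    show "vec 1 (\<lambda>_. 1) \<in> vecs (koszul_rank 0 0)" by (auto simp: vecs_def)
    show "\<exists>v\<in>vecs (koszul_rank 0 0). vec 1 (\<lambda>_. 1) \<bullet> v - p \<in> rel_ideal d q 0" if p: "p \<in> polys d" for p
      using p by (intro bexI[of _ "vec 1 (\<lambda>_. p)"]) (auto simp: scalar_prod_def vecs_def)
    show "{v \<in> vecs (koszul_rank 0 0). vec 1 (\<lambda>_. 1) \<bullet> v \<in> rel_ideal d q 0} = (*\<^sub>v) (D 0) ` vecs (koszul_rank 0 1)"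
    proof -
      have "{v \<in> vecs (Suc 0). vec 1 (\<lambda>_. 1) \<bullet> v = 0} = {0\<^sub>v 1}"
        using eps by (auto simp: vecs_def intro!: eq_vecI)
      then show ?thesis using D[of "0\<^sub>v 0" 0] by (simp add: vecs0)
    qed
    show "{v \<in> vecs (koszul_rank 0 (Suc i)). D i *\<^sub>v v = 0\<^sub>v (koszul_rank 0 i)} =
      (*\<^sub>v) (D (Suc i)) ` vecs (koszul_rank 0 (Suc (Suc i)))" for i
      using D[of "0\<^sub>v 0"] by (auto simp: vecs0)
  qed
  moreover have "tensor_residue (D i) = 0\<^sub>m (koszul_rank 0 i) (koszul_rank 0 (Suc i))" for i
    unfolding D_def tensor_residue_def by (intro eq_matI) auto
  ultimately show ?case by blast
next
  case (Suc c)
  let ?b = "koszul_rank c"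
  have q_polys: "q i \<in> polys d" if "i \<in> {1..Suc c}" for i
    using triangular_rel_polys[OF Suc.prems(2)[OF that], of d] that Suc.prems(1) by auto
  interpret coeff_ideal "polys d" "rel_ideal d q c"
    by (rule coeff_ideal_rel_ideal) (simp add: q_polys)
  obtain D where F: "resolves ?b D (vec 1 (\<lambda>_. 1))"
    and min: "\<And>i. tensor_residue (D i) = 0\<^sub>m (?b i) (?b (Suc i))"
    using Suc by auto
  obtain a h where a: "a > 0" and h: "h \<in> polys (Suc c)" and "Poly_Mapping.lookup h 0 = 0"
     and q: "q (Suc c) = Poly_Mapping.single (Poly_Mapping.single (Suc c) a) 1 - h"
    using Suc.prems(2)[of "Suc c"] unfolding triangular_rel_def by auto
  \<comment> \<open>An earlier relation q_i lies in k[x_0, ..., x_i] with i <= c, so it is free of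
    x_{c+1}.\<close>
  have indep: "indep (Suc c) (q i)" if "i \<in> {1..c}" for i
    using that triangular_rel_polys[OF Suc.prems(2)[of i], of "Suc c"] by (intro polys_indep) auto
  have nzd: "r \<in> rel_ideal d q c" if "r \<in> polys d" "q (Suc c) * r \<in> rel_ideal d q c" for r
  proof (rule monic_nonzerodivisor[OF coeff_ideal_axioms _ a _ polys_indep[OF h order_refl] that(1)])
    show "h \<in> polys d" using h polys_mono[of "Suc c" d] Suc.prems(1) by auto
    show "shift (Suc c) a p \<in> rel_ideal d q c" if "p \<in> rel_ideal d q c" for p
      by (rule shift_rel_ideal[OF indep that])
  qed (use that(2) q in auto)
  define E where "E i = (case i of 0 \<Rightarrow> 0\<^sub>m 0 (?b 0) | Suc j \<Rightarrow> - D j)" for i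
  define k where "k i = (case i of 0 \<Rightarrow> 0 | Suc j \<Rightarrow> ?b j)" for i
  let ?B = "\<lambda>i. four_block_mat (D i) (q (Suc c) \<cdot>\<^sub>m 1\<^sub>m (?b i)) (0\<^sub>m (k i) (?b (Suc i))) (E i)"
  have b0: "?b 0 = 1" by (induction c) auto
  have ranks: "(\<lambda>i. ?b i + k i) = koszul_rank (Suc c)" by (auto simp: k_def)
  have "coeff_ideal.resolves (polys d) (rel_ideal d q (Suc c)) (koszul_rank (Suc c)) ?B (vec 1 (\<lambda>_. 1))"
    unfolding ranks[symmetric]
    unfolding E_def k_def
    by (rule cone_resolves[OF F b0 refl _ nzd]) (use q_polys[of "Suc c"] in auto)
  moreover have "tensor_residue (?B i) = 0\<^sub>m (koszul_rank (Suc c) i) (koszul_rank (Suc c) (Suc i))" for i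
  proof -
    note DC = diff_carrier[OF F]
    have E: "E i \<in> carrier_mat (k i) (?b i)"
      using DC by (cases i) (auto simp: E_def k_def)
    have resE: "tensor_residue (E i) = 0\<^sub>m (k i) (?b i)"
    proof (cases i)
      case 0
      then show ?thesis by (simp add: E_def k_def tensor_residue_zero)
    next
      case (Suc j)
      then show ?thesis using tensor_residue_uminus[OF DC[of j]] by (simp add: E_def k_def min)
    qed
    have "Poly_Mapping.lookup (q (Suc c)) 0 = 0"
      using triangular_rel_const[OF Suc.prems(2)[of "Suc c"]] by simp
    then have "tensor_residue (q (Suc c) \<cdot>\<^sub>m 1\<^sub>m (?b i)) = 0\<^sub>m (?b i) (?b i)"
      by (rule tensor_residue_smult_one)
    then have "tensor_residue (?B i) = 0\<^sub>m (?b i + k i) (?b (Suc i) + ?b i)"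
      using tensor_residue_four_block[OF DC[of i] _ zero_carrier_mat E] resE min[of i] by (simp add: tensor_residue_zero)
    then show ?thesis by (simp add: k_def)
  qed
  ultimately show ?case by blast
qed

section \<open>Betti numbers of cyclic modules\<close>

text \<open>Comparison with the Koszul resolution shows that the kernel dimension exceeds the rank
  by exactly the Koszul rank, so the truncated subtraction in \<open>homology_dim\<close> loses
  nothing.\<close>

theorem homology_dim_eq_koszul_rank:
  fixes q :: "nat \<Rightarrow> 'k::field mpoly"
  assumes c: "c < d" and q: "\<And>i. i \<in> {1..c} \<Longrightarrow> triangular_rel i (q i)"
    and res: "coeff_ideal.resolves (polys d) (rel_ideal d q c) b D \<epsilon>"
  shows "homology_dim b D (Suc i) = koszul_rank c (Suc i)"
proof -
  have q_polys: "q i \<in> polys d" if "i \<in> {1..c}" for i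
    using triangular_rel_polys[OF q[OF that], of d] that c by auto
  interpret coeff_ideal "polys d" "rel_ideal d q c"
    by (rule coeff_ideal_rel_ideal) (simp add: q_polys)
  obtain D' where D': "resolves (koszul_rank c) D' (vec 1 (\<lambda>_. 1))"
    and min: "\<And>i. tensor_residue (D' i) = 0\<^sub>m (koszul_rank c i) (koszul_rank c (Suc i))"
    using koszul_resolution[OF c q] by blast
  show ?thesis
    using kernel_dim_resolution[OF res D' comm_ring_hom_const min[unfolded tensor_residue_def], of i]
    by (simp add: homology_dim_def tensor_residue_def)
qed

text \<open>Presents \<open>M\<close> as P/K by the quotient map \<open>\<theta>\<close>. This is
  the common interface of the semigroup ring and its associated graded ring, through which
  statements about \<open>M\<close> become congruences modulo \<open>K\<close> in P.\<close>

locale cyclic_module =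
  fixes d :: nat and K :: "'k::field mpoly set" and \<theta> :: "'k mpoly \<Rightarrow> 'a" and M :: "('k mpoly, 'a, 'b) module_scheme"
  assumes surj: "\<theta> ` polys d = carrier M"
    and eq_iff: "\<And>p q. p \<in> polys d \<Longrightarrow> q \<in> polys d \<Longrightarrow> \<theta> p = \<theta> q \<longleftrightarrow> p - q \<in> K"
    and add: "\<And>p q. p \<in> polys d \<Longrightarrow> q \<in> polys d \<Longrightarrow> \<theta> p \<oplus>\<^bsub>M\<^esub> \<theta> q = \<theta> (p + q)"
    and smult: "\<And>p q. p \<in> polys d \<Longrightarrow> q \<in> polys d \<Longrightarrow> p \<odot>\<^bsub>M\<^esub> \<theta> q = \<theta> (p * q)"
    and zero: "\<zero>\<^bsub>M\<^esub> = \<theta> 0"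
begin

lemma abelian_monoid: "abelian_monoid M"
proof (rule abelian_monoidI)
  show "\<zero>\<^bsub>M\<^esub> \<in> carrier M" unfolding surj[symmetric] zero using polys_zero by blast
qed (auto simp: surj[symmetric] add polys_add zero polys_zero ac_simps)

lemma augmentation_eq:
  assumes v: "v \<in> free_mod d n" and \<epsilon>: "\<epsilon> \<in> free_mod d n"
    and e: "\<And>j. j < n \<Longrightarrow> e j = \<theta> (\<epsilon> $ j)"
  shows "augmentation M e v = \<theta> (\<epsilon> \<bullet> v)"
proof -
  interpret abelian_monoid M by (rule abelian_monoid)
  have dims: "dim_vec v = n" "dim_vec \<epsilon> = n" using v \<epsilon> by (auto simp: free_mod_def)
  have mem: "v $ j \<in> polys d" "\<epsilon> $ j \<in> polys d" if "j < n" for j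
    using v \<epsilon> that by (auto simp: free_mod_def)
  have carrier: "v $ j \<odot>\<^bsub>M\<^esub> e j \<in> carrier M" if "j < n" for j
    using mem[OF that] surj by (auto simp: e[OF that] smult polys_mult)
  have "(\<Sum>j<k. \<epsilon> $ j * v $ j) \<in> polys d \<and>
     (\<Oplus>\<^bsub>M\<^esub>j\<in>{..<k}. v $ j \<odot>\<^bsub>M\<^esub> e j) = \<theta> (\<Sum>j<k. \<epsilon> $ j * v $ j)" if "k \<le> n" for k
    using that
  proof (induction k)
    case 0
    show ?case by (simp add: zero polys_zero)
  next
    case (Suc k)
    then have IH: "(\<Sum>j<k. \<epsilon> $ j * v $ j) \<in> polys d"
      "(\<Oplus>\<^bsub>M\<^esub>j\<in>{..<k}. v $ j \<odot>\<^bsub>M\<^esub> e j) = \<theta> (\<Sum>j<k. \<epsilon> $ j * v $ j)" and k: "k < n" by auto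
    have "(\<Oplus>\<^bsub>M\<^esub>j\<in>{..<Suc k}. v $ j \<odot>\<^bsub>M\<^esub> e j)
        = v $ k \<odot>\<^bsub>M\<^esub> e k \<oplus>\<^bsub>M\<^esub> (\<Oplus>\<^bsub>M\<^esub>j\<in>{..<k}. v $ j \<odot>\<^bsub>M\<^esub> e j)"
      unfolding lessThan_Suc using carrier k by (intro finsum_insert) auto
    also have "\<dots> = \<theta> (v $ k * \<epsilon> $ k + (\<Sum>j<k. \<epsilon> $ j * v $ j))"
      using mem[OF k] IH(1) by (simp add: IH(2) e[OF k] smult add polys_mult)
    finally show ?case using IH(1) mem[OF k] by (simp add: ac_simps polys_add polys_mult)
  qed
  then show ?thesis by (simp add: augmentation_def scalar_prod_def dims atLeast0LessThan)
qed

text \<open>Preimages in P of the elements \<open>e j\<close> form the vector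
  \<open>\<epsilon>\<close>; equality in \<open>M\<close> then becomes congruence modulo
  \<open>K\<close>, and each condition on a resolution of \<open>M\<close> translates
  separately.\<close>

lemma free_resolution_iff_resolves:
  assumes K: "coeff_ideal (polys d) K" and \<epsilon>: "\<epsilon> \<in> free_mod d (b 0)"
    and e: "\<And>j. j < b 0 \<Longrightarrow> e j = \<theta> (\<epsilon> $ j)"
  shows "free_resolution d M b D e \<longleftrightarrow> coeff_ideal.resolves (polys d) K b D \<epsilon>"
proof -
  interpret coeff_ideal "polys d" K by (rule K)
  have vecs: "free_mod d n = vecs n" for n by (auto simp: free_mod_def vecs_def)
  have mats: "X \<in> carrier_mat m n \<and> elements_mat X \<subseteq> polys d \<longleftrightarrow> X \<in> mats m n" for X m n
    by (fastforce simp: mats_def)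
  have eps_mem: "\<epsilon> \<bullet> v \<in> polys d" if "v \<in> vecs (b 0)" for v
    using that \<epsilon> scalar_prod_mem by (simp add: vecs)
  have aug: "augmentation M e v = \<theta> (\<epsilon> \<bullet> v)" if "v \<in> vecs (b 0)" for v
    using augmentation_eq[OF _ \<epsilon> e] that by (simp add: vecs)
  have e_mem: "\<forall>j<b 0. e j \<in> carrier M"
    using \<epsilon> surj by (auto simp: e free_mod_def)
  have "augmentation M e ` vecs (b 0) = carrier M \<longleftrightarrow> (\<forall>p\<in>polys d. \<exists>v\<in>vecs (b 0). \<epsilon> \<bullet> v - p \<in> K)"
  proof -
    have "augmentation M e ` vecs (b 0) = (\<lambda>v. \<theta> (\<epsilon> \<bullet> v)) ` vecs (b 0)"
      by (intro image_cong refl aug)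
    also have "\<dots> = \<theta> ` polys d \<longleftrightarrow> (\<forall>p\<in>polys d. \<exists>v\<in>vecs (b 0). \<theta> (\<epsilon> \<bullet> v) = \<theta> p)"
      using eps_mem by (auto simp: image_iff set_eq_iff) metis+
    also have "\<dots> \<longleftrightarrow> (\<forall>p\<in>polys d. \<exists>v\<in>vecs (b 0). \<epsilon> \<bullet> v - p \<in> K)"
      using eps_mem by (intro ball_cong bex_cong refl eq_iff) auto
    finally show ?thesis unfolding surj .
  qed
  moreover have "{v \<in> vecs (b 0). augmentation M e v = \<zero>\<^bsub>M\<^esub>} = {v \<in> vecs (b 0). \<epsilon> \<bullet> v \<in> K}"
  proof (intro Collect_cong conj_cong refl)
    fix v assume v: "v \<in> vecs (b 0)"
    show "augmentation M e v = \<zero>\<^bsub>M\<^esub> \<longleftrightarrow> \<epsilon> \<bullet> v \<in> K"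
      unfolding aug[OF v] zero using eq_iff[OF eps_mem[OF v] polys_zero] by simp
  qed
  ultimately show ?thesis
    unfolding free_resolution_def resolves_def vecs mats using \<epsilon> e_mem by (simp add: vecs)
qed

text \<open>The definite description in \<open>betti\<close> is justified here: the Koszul complex
  provides a resolution, and comparison with it fixes the value for every other one.\<close>

theorem betti_eq_koszul_rank:
  assumes K: "K = rel_ideal d q c" and c: "c < d" and q: "\<And>i. i \<in> {1..c} \<Longrightarrow> triangular_rel i (q i)"
  shows "betti d M (Suc i) = koszul_rank c (Suc i)"
proof -
  have q_polys: "q i \<in> polys d" if "i \<in> {1..c}" for i
    using triangular_rel_polys[OF q[OF that], of d] that c by auto
  have ideal: "coeff_ideal (polys d) K"
    unfolding K by (rule coeff_ideal_rel_ideal) (simp add: q_polys)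
  have unique: "homology_dim b D (Suc i) = koszul_rank c (Suc i)" if res: "free_resolution d M b D e" for b D e
  proof -
    have "\<exists>p\<in>polys d. e j = \<theta> p" if "j < b 0" for j
      using res that surj unfolding free_resolution_def by (auto simp: image_iff)
    then obtain p where p: "\<And>j. j < b 0 \<Longrightarrow> p j \<in> polys d \<and> e j = \<theta> (p j)" by metis
    have "coeff_ideal.resolves (polys d) K b D (vec (b 0) p)"
      using res by (subst (asm) free_resolution_iff_resolves[OF ideal, of "vec (b 0) p"]) (auto simp: p free_mod_def)
    then show ?thesis using homology_dim_eq_koszul_rank[OF c q] K by simp
  qed
  obtain D where D: "coeff_ideal.resolves (polys d) K (koszul_rank c) D (vec 1 (\<lambda>_. 1))"
    using koszul_resolution[OF c q] K by blast
  have b0: "koszul_rank c 0 = 1" by (induction c) auto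
  have "free_resolution d M (koszul_rank c) D (\<lambda>_. \<theta> 1)"
    using D by (subst free_resolution_iff_resolves[OF ideal, of "vec 1 (\<lambda>_. 1)"]) (auto simp: b0 free_mod_def polys_one)
  then show ?thesis unfolding betti_def using unique by (intro the_equality) metis+
qed

end

section \<open>A family of semigroups\<close>

text \<open>Removing an irreducible element from \<open>S\<close> leaves a submonoid, so every
  generating set contains all irreducibles. A generating set made of irreducibles is thus the least
  one, and the only minimal one.\<close>

lemma min_gens_eqI:
  assumes A: "nat_submonoid hull A = S" and zero: "0 \<notin> A"
    and irred: "\<And>y z. \<lbrakk>y \<in> S; z \<in> S; y \<noteq> 0; z \<noteq> 0\<rbrakk> \<Longrightarrow> y + z \<notin> A"
  shows "min_gens S = A"
proof -
  have submonoid: "nat_submonoid (nat_submonoid hull B)" for B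
    by (rule hull_in) (auto simp: nat_submonoid_def)
  have AS: "A \<subseteq> S" using hull_subset[of A nat_submonoid] A by simp
  have S: "nat_submonoid S" using submonoid[of A] A by simp
  have sub: "A \<subseteq> B" if B: "nat_submonoid hull B = S" for B
  proof
    fix a assume a: "a \<in> A"
    show "a \<in> B"
    proof (rule ccontr)
      assume "a \<notin> B"
      then have "B \<subseteq> S - {a}" using hull_subset[of B nat_submonoid] B by blast
      moreover have "nat_submonoid (S - {a})"
        unfolding nat_submonoid_def
      proof (intro conjI ballI)
        have "a \<noteq> 0" using zero a by metis
        then show "0 \<in> S - {a}" using S by (simp add: nat_submonoid_def)
        show "y + z \<in> S - {a}" if y: "y \<in> S - {a}" and z: "z \<in> S - {a}" for y z
        proof (cases "y = 0 \<or> z = 0")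
          case False
          then have "y + z \<noteq> a" using irred[of y z] y z a by blast
          then show ?thesis using S y z by (auto simp: nat_submonoid_def)
        qed (use y z in auto)
      qed
      ultimately have "nat_submonoid hull B \<subseteq> S - {a}" by (rule hull_minimal)
      then show False using B a AS by blast
    qed
  qed
  show ?thesis
    unfolding min_gens_def
  proof (rule the_equality)
    show "nat_submonoid hull A = S \<and> (\<forall>B. B \<subset> A \<longrightarrow> nat_submonoid hull B \<noteq> S)"
      using A sub by blast
    show "B = A" if "nat_submonoid hull B = S \<and> (\<forall>C. C \<subset> B \<longrightarrow> nat_submonoid hull C \<noteq> S)" for B
      using that A sub by blast
  qed
qed

lemma total_deg_add: "total_deg (u + v) = total_deg u + total_deg v"
  unfolding total_deg_def by (rule setsum_keys_plus_distrib) auto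

lemma total_deg_single: "total_deg (Poly_Mapping.single i a) = a"
  by (simp add: total_deg_def)

lemma total_deg_eq_0_iff: "total_deg e = 0 \<longleftrightarrow> e = 0"
  by (auto simp: total_deg_def in_keys_iff intro: poly_mapping_eqI)

lemma exp_split:
  assumes "a \<le> Poly_Mapping.lookup e i"
  obtains u where "e = u + Poly_Mapping.single i (a::nat)" "Poly_Mapping.keys u \<subseteq> Poly_Mapping.keys e"
proof
  show "e = (e - Poly_Mapping.single i a) + Poly_Mapping.single i a"
    using assms by (intro poly_mapping_eqI) (auto simp: lookup_add lookup_minus lookup_single when_def)
  show "Poly_Mapping.keys (e - Poly_Mapping.single i a) \<subseteq> Poly_Mapping.keys e"
    by (auto simp: in_keys_iff lookup_minus)
qed

text \<open>Variables and generators are indexed from 0, so \<open>g i\<close> is $n_{i+1}$.\<close>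

locale ladder =
  fixes d m :: nat
  assumes d: "d \<ge> 3" and m_odd: "odd m" and m_ge: "m \<ge> 5"
begin

definition g :: "nat \<Rightarrow> nat" where
  "g i = (if i = 0 then 2 ^ d else m * 2 ^ (d - 1 - i) * 3 ^ (i - 1))"

text \<open>The rewriting rules are x_i^(\<open>bnd i\<close>) -> \<open>target i\<close> for i >=
  1. The value 4 at index 1 keeps x_1^3, the right-hand side of the rule for x_2,
  irreducible.\<close>

definition bnd :: "nat \<Rightarrow> nat" where
  "bnd i = (if i = 1 then 4 else 2)"

definition target :: "nat \<Rightarrow> nat \<Rightarrow>\<^sub>0 nat" where
  "target i = (if i = 1 then Poly_Mapping.single 0 m else Poly_Mapping.single (i - 1) 3)"

definition wt :: "(nat \<Rightarrow>\<^sub>0 nat) \<Rightarrow> nat" where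
  "wt e = (\<Sum>i<d. Poly_Mapping.lookup e i * g i)"

definition exps :: "(nat \<Rightarrow>\<^sub>0 nat) set" where
  "exps = {e. Poly_Mapping.keys e \<subseteq> {..<d}}"

text \<open>Index 0 carries no bound, so multiplication by x_0 preserves normal forms; the Apery
  argument rests on this.\<close>

definition normal :: "(nat \<Rightarrow>\<^sub>0 nat) \<Rightarrow> bool" where
  "normal e \<longleftrightarrow> e \<in> exps \<and> (\<forall>i\<in>{1..<d}. Poly_Mapping.lookup e i < bnd i)"

definition sg :: "nat set" where
  "sg = wt ` exps"

section \<open>Weights, rewriting rules and the two ideals\<close>

lemma wt_add: "wt (u + v) = wt u + wt v"
  by (simp add: wt_def lookup_add sum.distrib distrib_right)

lemma wt_single: "i < d \<Longrightarrow> wt (Poly_Mapping.single i a) = a * g i"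
  by (simp add: wt_def lookup_single when_def if_distrib[of "\<lambda>x. x * _"] cong: if_cong)

lemma exps_add: "u + v \<in> exps \<longleftrightarrow> u \<in> exps \<and> v \<in> exps"
  by (simp add: exps_def keys_exp_add)

lemma exps_single: "i < d \<Longrightarrow> Poly_Mapping.single i a \<in> exps"
  by (auto simp: exps_def)

lemma polys_iff: "p \<in> polys d \<longleftrightarrow> Poly_Mapping.keys p \<subseteq> exps"
  by (auto simp: polys_def exps_def)

lemma pow_d: "(2::nat) ^ d = 4 * 2 ^ (d - 2)"
proof -
  have "2 + (d - 2) = d" using d by simp
  moreover have "(2::nat) ^ (2 + (d - 2)) = 4 * 2 ^ (d - 2)" by (simp only: power_add) simp
  ultimately show ?thesis by simp
qed

text \<open>The generators are chosen for this: 4 g_1 = m g_0, and 2 g_i = 3 g_{i-1} for i >=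
  2.\<close>

lemma rel_wt: "i \<in> {1..<d} \<Longrightarrow> wt (target i) = bnd i * g i"
proof -
  assume i: "i \<in> {1..<d}"
  show ?thesis
  proof (cases "i = 1")
    case True
    have "d - 1 - 1 = d - 2" by simp
    then show ?thesis using True d pow_d by (simp add: target_def bnd_def wt_single g_def)
  next
    case False
    then obtain j where j: "i = Suc (Suc j)" using i by (cases i; cases "i - 1") auto
    have "d - 1 - Suc j = Suc (d - 1 - i)" using i j by auto
    then show ?thesis using i False by (simp add: target_def bnd_def wt_single g_def j)
  qed
qed

lemma target_exps: "i \<in> {1..<d} \<Longrightarrow> target i \<in> exps"
  by (auto simp: target_def intro!: exps_single)

lemma target_deg: "i \<in> {1..<d} \<Longrightarrow> total_deg (target i) > bnd i"
  using m_ge by (auto simp: target_def bnd_def total_deg_single)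

lemma target_polys: "i \<in> {1..<d} \<Longrightarrow> Poly_Mapping.single (target i) 1 \<in> polys i"
  by (auto simp: target_def intro!: polys_single split: if_splits)

definition toric_rel :: "nat \<Rightarrow> 'k::comm_ring_1 mpoly" where
  "toric_rel i = Poly_Mapping.single (Poly_Mapping.single i (bnd i)) 1 - Poly_Mapping.single (target i) 1"

text \<open>The lower-degree term of \<open>toric_rel i\<close>, by
  \<open>target_deg\<close>.\<close>

definition initial_rel :: "nat \<Rightarrow> 'k::comm_ring_1 mpoly" where
  "initial_rel i = Poly_Mapping.single (Poly_Mapping.single i (bnd i)) 1"

lemma triangular_toric_rel: "i \<in> {1..<d} \<Longrightarrow> triangular_rel i (toric_rel i)"
  unfolding triangular_rel_def toric_rel_def
proof (intro exI conjI)
  assume i: "i \<in> {1..<d}"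
  show "bnd i > 0" by (simp add: bnd_def)
  show "Poly_Mapping.single (target i) 1 \<in> polys i" by (rule target_polys[OF i])
  have "target i \<noteq> 0" using target_deg[OF i] total_deg_eq_0_iff[of "target i"] by auto
  then show "Poly_Mapping.lookup (Poly_Mapping.single (target i) 1) 0 = 0"
    by (simp add: lookup_single when_def)
qed (rule refl)

lemma triangular_initial_rel: "triangular_rel i (initial_rel i)"
  unfolding triangular_rel_def initial_rel_def
  by (intro exI[of _ "bnd i"] exI[of _ 0]) (auto simp: bnd_def polys_zero)

definition toric_ideal :: "'k::comm_ring_1 mpoly set" where
  "toric_ideal = rel_ideal d toric_rel (d - 1)"

definition initial_ideal :: "'k::comm_ring_1 mpoly set" where
  "initial_ideal = rel_ideal d initial_rel (d - 1)"

lemma coeff_ideal_toric: "coeff_ideal (polys d) (toric_ideal :: 'k::comm_ring_1 mpoly set)"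
  unfolding toric_ideal_def
  by (rule coeff_ideal_rel_ideal) (auto intro!: triangular_rel_polys triangular_toric_rel)

lemma coeff_ideal_initial: "coeff_ideal (polys d) (initial_ideal :: 'k::comm_ring_1 mpoly set)"
  unfolding initial_ideal_def
  by (rule coeff_ideal_rel_ideal) (auto intro!: triangular_rel_polys triangular_initial_rel)

lemma rel_in_rel_ideal:
  fixes q :: "nat \<Rightarrow> 'k::comm_ring_1 mpoly"
  assumes "\<And>j. j \<in> {1..c} \<Longrightarrow> q j \<in> polys d" and "i \<in> {1..c}" and "r \<in> polys d"
  shows "q i * r \<in> rel_ideal d q c"
  using assms
proof (induction c)
  case (Suc c)
  interpret coeff_ideal "polys d" "rel_ideal d q c"
    by (rule coeff_ideal_rel_ideal) (use Suc.prems in auto)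
  show ?case
  proof (cases "i = Suc c")
    case True
    have "q i * r = 0 + q (Suc c) * r" by (simp add: True)
    then show ?thesis unfolding rel_ideal.simps mem_Collect_eq using ideal_zero Suc.prems(3) by blast
  next
    case False
    then have "q i * r \<in> rel_ideal d q c" using Suc by auto
    moreover have "q i * r = q i * r + q (Suc c) * 0" by simp
    ultimately show ?thesis unfolding rel_ideal.simps mem_Collect_eq using polys_zero by blast
  qed
qed simp

section \<open>Existence and uniqueness of normal forms\<close>

lemma rewrite_step:
  assumes e: "e \<in> exps" and nn: "\<not> normal e"
  obtains i u where "i \<in> {1..<d}" "u \<in> exps" "e = u + Poly_Mapping.single i (bnd i)"
proof -
  obtain i where i: "i \<in> {1..<d}" "bnd i \<le> Poly_Mapping.lookup e i"
    using e nn by (auto simp: normal_def not_less)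
  obtain u where "e = u + Poly_Mapping.single i (bnd i)" "Poly_Mapping.keys u \<subseteq> Poly_Mapping.keys e"
    using exp_split[OF i(2)] .
  then show thesis using that[OF i(1)] e by (auto simp: exps_add)
qed

lemma normal_form:
  assumes "e \<in> exps"
  shows "\<exists>n. normal n \<and> wt n = wt e \<and> (n = e \<or> total_deg n > total_deg e)
    \<and> Poly_Mapping.single e 1 - Poly_Mapping.single n 1 \<in> (toric_ideal :: 'k::comm_ring_1 mpoly set)"
proof -
  interpret coeff_ideal "polys d" "toric_ideal :: 'k mpoly set" by (rule coeff_ideal_toric)
  \<comment> \<open>Rewriting raises the degree, so termination needs another measure. With x_0
    counted as 0 and x_i as 4^i, the first rule replaces 16 by 0 and the others replace 2 * 4^i by 3
    * 4^(i-1).\<close>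
  define w :: "nat \<Rightarrow> nat" where "w i = (if i = 0 then 0 else 4 ^ i)" for i
  define \<mu> where "\<mu> e = (\<Sum>i<d. Poly_Mapping.lookup e i * w i)" for e :: "nat \<Rightarrow>\<^sub>0 nat"
  have \<mu>_add: "\<mu> (u + v) = \<mu> u + \<mu> v" for u v
    by (simp add: \<mu>_def lookup_add sum.distrib distrib_right)
  have \<mu>_single: "i < d \<Longrightarrow> \<mu> (Poly_Mapping.single i a) = a * w i" for i a
    by (simp add: \<mu>_def lookup_single when_def if_distrib[of "\<lambda>x. x * _"] cong: if_cong)
  have \<mu>_target: "\<mu> (target i) < \<mu> (Poly_Mapping.single i (bnd i))" if i: "i \<in> {1..<d}" for i
  proof (cases "i = 1")
    case True
    then show ?thesis using d by (simp add: target_def bnd_def \<mu>_single w_def)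
  next
    case False
    then obtain j where j: "i = Suc (Suc j)" using i by (cases i; cases "i - 1") auto
    then show ?thesis using i by (simp add: target_def bnd_def \<mu>_single w_def)
  qed
  show ?thesis
    using assms
  proof (induction "\<mu> e" arbitrary: e rule: less_induct)
    case less
    show ?case
    proof (cases "normal e")
      case True
      then show ?thesis using ideal_zero by (intro exI[of _ e]) simp
    next
      case False
      then obtain i u where i: "i \<in> {1..<d}" and u: "u \<in> exps" and e: "e = u + Poly_Mapping.single i (bnd i)"
        using rewrite_step[OF less.prems] by blast
      let ?e' = "u + target i"
      have e': "?e' \<in> exps" using u target_exps[OF i] by (simp add: exps_add)
      have "\<mu> ?e' < \<mu> e" using \<mu>_target[OF i] by (simp add: e \<mu>_add)
      from less.hyps[OF this e'] obtain n where n: "normal n" "wt n = wt ?e'"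
        "n = ?e' \<or> total_deg n > total_deg ?e'"
        "Poly_Mapping.single ?e' 1 - Poly_Mapping.single n 1 \<in> (toric_ideal :: 'k mpoly set)" by blast
      have "wt ?e' = wt e" using i by (simp add: e wt_add rel_wt wt_single)
      moreover have "total_deg ?e' > total_deg e"
        using target_deg[OF i] by (simp add: e total_deg_add total_deg_single)
      moreover have "Poly_Mapping.single e 1 - Poly_Mapping.single n 1 \<in> (toric_ideal :: 'k mpoly set)"
      proof -
        have "toric_rel i * Poly_Mapping.single u 1 \<in> (toric_ideal :: 'k mpoly set)"
          unfolding toric_ideal_def
        proof (rule rel_in_rel_ideal)
          show "toric_rel j \<in> polys d" if "j \<in> {1..d - 1}" for j
            using that d by (intro triangular_rel_polys[of j] triangular_toric_rel) auto
        qed (use i u in \<open>auto simp: polys_iff\<close>)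
        moreover have "toric_rel i * Poly_Mapping.single u (1::'k) = Poly_Mapping.single e 1 - Poly_Mapping.single ?e' 1"
          by (simp add: toric_rel_def left_diff_distrib mult_single e add.commute)
        ultimately have "(Poly_Mapping.single e 1 - Poly_Mapping.single ?e' 1) +
           (Poly_Mapping.single ?e' 1 - Poly_Mapping.single n 1) \<in> (toric_ideal :: 'k mpoly set)"
          using n(4) by (intro ideal_add) simp_all
        then show ?thesis by simp
      qed
      ultimately show ?thesis using n by (intro exI[of _ n]) auto
    qed
  qed
qed

text \<open>A comparison of 2-adic valuations: since m is odd, that of g_k is exactly d - 1 - k. All
  earlier generators have at least one more factor 2, and for k = 1 the only earlier one, 2^d, has
  two more.\<close>

lemma bnd_dvd:
  assumes "k \<in> {1..<d}" "i < k"
  shows "bnd k * 2 ^ (d - 1 - k) dvd g i"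
proof (cases "i = 0")
  case True
  have "bnd k * 2 ^ (d - 1 - k) dvd (2::nat) ^ d"
  proof (cases "k = 1")
    case True
    have "(4::nat) * 2 ^ (d - 1 - 1) = 2 ^ (2 + (d - 1 - 1))" by (simp add: power_add)
    also have "\<dots> = 2 ^ d" using d by (intro arg_cong2[of _ _ _ _ "(^)"]) auto
    finally show ?thesis by (simp add: bnd_def True)
  next
    case False
    then have "bnd k * 2 ^ (d - 1 - k) = (2::nat) ^ Suc (d - 1 - k)" by (simp add: bnd_def)
    also have "\<dots> dvd 2 ^ d" by (intro le_imp_power_dvd) (use assms in auto)
    finally show ?thesis .
  qed
  then show ?thesis by (simp add: g_def True)
next
  case False
  then have "bnd k * 2 ^ (d - 1 - k) = (2::nat) ^ Suc (d - 1 - k)" using assms by (simp add: bnd_def)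
  also have "\<dots> dvd 2 ^ (d - 1 - i)" by (intro le_imp_power_dvd) (use assms in auto)
  finally show ?thesis using False by (auto simp: g_def intro: dvd_mult2 dvd_mult)
qed

text \<open>The top index where two normal exponent vectors of equal weight differ gives a contradiction:
  all smaller generators carry a higher power of 2.\<close>

lemma normal_unique:
  assumes n: "normal e" "normal e'" and wt: "wt e = wt e'"
  shows "e = e'"
proof (rule ccontr)
  assume neq: "e \<noteq> e'"
  define z where "z i = int (Poly_Mapping.lookup e i) - int (Poly_Mapping.lookup e' i)" for i
  have "Poly_Mapping.lookup u i = 0" if "\<not> i < d" "normal u" for i u
    using that by (auto simp: normal_def exps_def in_keys_iff subset_iff)
  then have outside: "z i = 0" if "\<not> i < d" for i
    using that n by (simp add: z_def)
  have "\<exists>i. z i \<noteq> 0" using neq by (auto simp: z_def intro!: poly_mapping_eqI)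
  then have ne: "{i. z i \<noteq> 0} \<noteq> {}" and fin: "finite {i. z i \<noteq> 0}"
    using outside by (auto intro!: finite_subset[of _ "{..<d}"])
  define k where "k = Max {i. z i \<noteq> 0}"
  have zk: "z k \<noteq> 0" using Max_in[OF fin ne] by (simp add: k_def)
  have above: "z i = 0" if "i > k" for i using Max_ge[OF fin, of i] that by (auto simp: k_def)
  have kd: "k < d" using outside zk by blast
  have "(\<Sum>i<d. z i * int (g i)) = 0"
    using arg_cong[OF wt, of int] by (simp add: wt_def z_def left_diff_distrib sum_subtractf)
  moreover have "(\<Sum>i<d. z i * int (g i)) = (\<Sum>i\<in>{..k}. z i * int (g i))"
    using kd above by (intro sum.mono_neutral_right) auto
  ultimately have sum0: "(\<Sum>i<k. z i * int (g i)) + z k * int (g k) = 0"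
    by (simp add: lessThan_Suc_atMost[symmetric])
  show False
  proof (cases "k = 0")
    case True
    then show False using sum0 zk by (simp add: g_def)
  next
    case False
    then have k: "k \<in> {1..<d}" using kd by simp
    let ?p = "int (2 ^ (d - 1 - k))"
    have "int (bnd k * 2 ^ (d - 1 - k)) dvd (\<Sum>i<k. z i * int (g i))"
      using bnd_dvd[OF k] by (intro dvd_sum dvd_mult) (simp add: int_dvd_int_iff del: of_nat_mult)
    then have "int (bnd k * 2 ^ (d - 1 - k)) dvd z k * int (g k)"
      using dvd_add_right_iff[of _ _ "z k * int (g k)"] sum0 by (metis dvd_0_right)
    then have "int (bnd k) * ?p dvd z k * int (g k)" by (simp only: of_nat_mult)
    also have "z k * int (g k) = (z k * int (m * 3 ^ (k - 1))) * ?p"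
      using False by (simp add: g_def)
    finally have "int (bnd k) dvd z k * int (m * 3 ^ (k - 1))"
      by (subst (asm) dvd_times_right_cancel_iff) simp_all
    \<comment> \<open>\<open>bnd k\<close> is 2 or 4, and the part of g_k left after cancelling its
      powers of 2 is odd.\<close>
    moreover have "coprime (int (bnd k)) (int (m * 3 ^ (k - 1)))"
    proof -
      have "odd (m * 3 ^ (k - 1))" using m_odd by simp
      then have "coprime 2 (m * 3 ^ (k - 1))" by simp
      then have "coprime (2 ^ 2) (m * 3 ^ (k - 1))" "coprime 2 (m * 3 ^ (k - 1))"
        by (simp_all only: coprime_power_left_iff) simp_all
      then have "coprime (bnd k) (m * 3 ^ (k - 1))" by (simp add: bnd_def)
      then show ?thesis by (simp only: coprime_int_iff)
    qed
    ultimately have "int (bnd k) dvd z k" by (simp add: coprime_dvd_mult_left_iff)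
    \<comment> \<open>A nonzero multiple of \<open>bnd k\<close> is at least that large, but the
      difference of two exponents below \<open>bnd k\<close> is smaller.\<close>
    then have "int (bnd k) \<le> \<bar>z k\<bar>" using dvd_imp_le_int[OF zk, of "int (bnd k)"] by simp
    moreover have "Poly_Mapping.lookup e k < bnd k" "Poly_Mapping.lookup e' k < bnd k"
      using n k by (auto simp: normal_def)
    ultimately show False by (simp add: z_def)
  qed
qed

text \<open>Any other monomial of this weight rewrites to the normal form and gains degree on the
  way. Thus the degree of the normal form is the order of the semigroup element, attained only
  there.\<close>

lemma normal_deg_max:
  assumes "normal n" "e \<in> exps" "wt e = wt n"
  shows "e = n \<or> total_deg e < total_deg n"
proof -
  obtain n' where "normal n'" "wt n' = wt e" "n' = e \<or> total_deg n' > total_deg e"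
    \<comment> \<open>Weights and degrees do not depend on the coefficients; \<open>int\<close> only
      fixes the ring in which \<open>normal_form\<close> also asserts an ideal membership.\<close>
    using normal_form[OF assms(2), where 'k = int] by blast
  then show ?thesis using normal_unique[of n' n] assms by auto
qed

section \<open>The semigroup, its minimal generators and its inhomogeneity\<close>

lemma normal_single: "i < d \<Longrightarrow> normal (Poly_Mapping.single i 1)"
  by (auto simp: normal_def exps_single lookup_single when_def bnd_def)

lemma sg_submonoid: "nat_submonoid sg"
  unfolding nat_submonoid_def sg_def
proof (intro conjI ballI)
  have "0 = wt 0" "0 \<in> exps" by (simp_all add: wt_def exps_def)
  then show "0 \<in> wt ` exps" by blast
  show "x + y \<in> wt ` exps" if x: "x \<in> wt ` exps" and y: "y \<in> wt ` exps" for x y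
  proof -
    obtain u v where "x = wt u" "y = wt v" "u \<in> exps" "v \<in> exps" using x y by blast
    then have "x + y = wt (u + v)" "u + v \<in> exps" by (simp_all add: wt_add exps_add)
    then show ?thesis by blast
  qed
qed

lemma g_in_sg: "i < d \<Longrightarrow> g i \<in> sg"
  unfolding sg_def using wt_single[of i 1] exps_single[of i 1] by (metis imageI mult_1)

text \<open>The first and the last generator suffice: 2^d and the odd number m 3^(d-2) are
  coprime.\<close>

lemma sg_cofinite: "finite (- sg)"
proof -
  let ?a = "g (d - 1)"
  have a: "?a = m * 3 ^ (d - 2)" using d by (simp add: g_def numeral_2_eq_2)
  have "odd ?a" using m_odd a by simp
  then have "coprime ?a (2 ^ d)" by simp
  then obtain x where x: "[?a * x = Suc 0] (mod 2 ^ d)" using cong_solve_coprime_nat by blast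
  have "N \<in> sg" if N: "2 ^ d * ?a \<le> N" for N
  proof -
    \<comment> \<open>As \<open>x\<close> inverts \<open>?a\<close> modulo 2^d, the product
      \<open>?a * t\<close> is congruent to N; the reduction of \<open>t\<close> below 2^d keeps it
      at most N.\<close>
    define t where "t = (x * N) mod 2 ^ d"
    have "[?a * t = ?a * (x * N)] (mod 2 ^ d)"
      unfolding t_def by (intro cong_mult cong_refl) (simp add: cong_def)
    moreover have "[?a * x * N = Suc 0 * N] (mod 2 ^ d)" by (intro cong_mult x cong_refl)
    ultimately have "[?a * t = N] (mod 2 ^ d)" by (simp add: mult.assoc cong_def)
    moreover have le: "?a * t \<le> N"
    proof -
      have "t \<le> 2 ^ d" unfolding t_def by (simp add: less_imp_le)
      then have "?a * t \<le> ?a * 2 ^ d" by (rule mult_le_mono2)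
      then show ?thesis using N unfolding mult.commute[of "2 ^ d"] by (rule order_trans)
    qed
    ultimately have "2 ^ d dvd N - ?a * t" by (metis cong_sym cong_altdef_nat)
    then obtain k where "N - ?a * t = 2 ^ d * k" by (elim dvdE)
    then have "N = 2 ^ d * k + ?a * t" using le by simp
    also have "\<dots> = wt (Poly_Mapping.single 0 k + Poly_Mapping.single (d - 1) t)"
      using d by (simp add: wt_add wt_single g_def)
    finally show ?thesis
      unfolding sg_def using d by (intro image_eqI[of _ wt]) (auto simp: exps_add exps_single)
  qed
  then have "- sg \<subseteq> {..<2 ^ d * ?a}" by (auto simp: not_le[symmetric])
  then show ?thesis by (rule finite_subset) simp
qed

lemma numerical_semigroup_sg: "numerical_semigroup sg"
  unfolding numerical_semigroup_def using sg_submonoid sg_cofinite by blast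

text \<open>The first step compares 4 with m; afterwards consecutive generators have ratio
  3/2.\<close>

lemma g_step: "Suc i < d \<Longrightarrow> g i < g (Suc i)"
proof (cases "i = 0")
  case True
  assume "Suc i < d"
  have "g 0 < m * 2 ^ (d - 2)" using m_ge by (simp add: g_def pow_d)
  moreover have "d - 1 - 1 = d - 2" by simp
  ultimately show ?thesis using True by (simp add: g_def)
next
  case False
  assume i: "Suc i < d"
  have "bnd (Suc i) * g (Suc i) = wt (target (Suc i))" using rel_wt[of "Suc i"] i by simp
  then have "2 * g (Suc i) = 3 * g i" using False i by (simp add: bnd_def target_def wt_single)
  moreover have "g i > 0" using m_ge False by (simp add: g_def)
  ultimately show ?thesis by simp
qed

lemma g_mono: "i < j \<Longrightarrow> j < d \<Longrightarrow> g i < g j"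
proof (induction j)
  case (Suc j)
  then show ?case using g_step[of j] by (cases "i = j") auto
qed simp

lemma g_pos: "i < d \<Longrightarrow> g i > 0"
  using m_ge by (simp add: g_def)

lemma hull_gens: "nat_submonoid hull (g ` {..<d}) = sg"
proof (rule hull_unique)
  show "g ` {..<d} \<subseteq> sg" using g_in_sg by blast
  show "nat_submonoid sg" by (rule sg_submonoid)
  fix T assume T: "g ` {..<d} \<subseteq> T" "nat_submonoid T"
  have mult: "a * x \<in> T" if "x \<in> T" for a x
    using T(2) that by (induction a) (auto simp: nat_submonoid_def)
  have "(\<Sum>i<k. Poly_Mapping.lookup e i * g i) \<in> T" if "k \<le> d" for k e
    using that
  proof (induction k)
    case (Suc k)
    then have "g k \<in> T" using T(1) by auto
    from mult[OF this] Suc show ?case using T(2) by (simp add: nat_submonoid_def)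
  qed (use T(2) in \<open>simp add: nat_submonoid_def\<close>)
  then show "sg \<subseteq> T" by (auto simp: sg_def wt_def)
qed

text \<open>The monomial x_i is a normal form of degree 1, hence of maximal degree for its weight,
  while a sum of two nonzero elements has a factorization of degree at least 2.\<close>

lemma min_gens_sg: "min_gens sg = g ` {..<d}"
proof (rule min_gens_eqI[OF hull_gens])
  show "0 \<notin> g ` {..<d}" using g_pos by fastforce
  fix y z assume "y \<in> sg" "z \<in> sg" and nz: "y \<noteq> 0" "z \<noteq> 0"
  then obtain u v where uv: "u \<in> exps" "v \<in> exps" "y = wt u" "z = wt v" by (auto simp: sg_def)
  have "wt 0 = 0" by (simp add: wt_def)
  then have "total_deg u \<noteq> 0" "total_deg v \<noteq> 0" using nz uv by (auto simp: total_deg_eq_0_iff)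
  then have deg: "total_deg (u + v) > 1" by (simp add: total_deg_add)
  show "y + z \<notin> g ` {..<d}"
  proof
    assume "y + z \<in> g ` {..<d}"
    then obtain i where i: "i < d" "y + z = g i" by blast
    then have "wt (u + v) = wt (Poly_Mapping.single i 1)" using uv by (simp add: wt_add wt_single)
    then have "u + v = Poly_Mapping.single i 1 \<or> total_deg (u + v) < total_deg (Poly_Mapping.single i (1::nat))"
      using normal_deg_max[OF normal_single[OF i(1)]] uv by (simp add: exps_add)
    then show False using deg by (auto simp: total_deg_single)
  qed
qed

lemma g_inj: "inj_on g {..<d}"
  by (intro inj_onI) (metis g_mono lessThan_iff less_irrefl linorder_neqE_nat)

lemma embdim_sg: "embdim sg = d"
  by (simp add: embdim_def min_gens_sg card_image g_inj)

lemma gen_sg: "i < d \<Longrightarrow> gen sg i = g i"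
proof -
  assume i: "i < d"
  have "sorted (map g [0..<d])"
    unfolding sorted_iff_nth_mono by (auto simp: le_less g_mono)
  moreover have "distinct (map g [0..<d])"
    using g_inj by (simp add: distinct_map atLeast0LessThan)
  ultimately have "sorted_list_of_set (set (map g [0..<d])) = map g [0..<d]"
    by (rule sorted_list_of_set.idem_if_sorted_distinct)
  moreover have "set (map g [0..<d]) = min_gens sg" by (simp add: min_gens_sg atLeast0LessThan)
  ultimately show ?thesis using i by (simp add: gen_def)
qed

lemma not_homogeneous_sg: "\<not> homogeneous sg"
proof
  assume hom: "homogeneous sg"
  \<comment> \<open>The weight shared by x_1^3 and x_2^2; the index 2 exists because d >= 3.\<close>
  let ?s = "wt (Poly_Mapping.single 1 3)"
  let ?a = "Poly_Mapping.lookup (Poly_Mapping.single 1 (3::nat))" and ?b = "Poly_Mapping.lookup (Poly_Mapping.single 2 (2::nat))"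
  have s: "?s = 3 * g 1" "3 * g 1 = 2 * g 2"
    using d rel_wt[of 2] by (simp_all add: wt_single target_def bnd_def)
  have n: "normal (Poly_Mapping.single 1 3)"
    using d by (auto simp: normal_def exps_single lookup_single when_def bnd_def)
  have "?s \<in> Apery sg (gen sg 0)"
    unfolding Apery_def
  proof (intro CollectI conjI)
    show "?s \<in> sg" unfolding sg_def using n by (auto simp: normal_def)
    show "?s < gen sg 0 \<or> ?s - gen sg 0 \<notin> sg"
    proof (rule disjCI)
      assume "\<not> ?s - gen sg 0 \<notin> sg"
      then obtain e where e: "e \<in> exps" "?s - g 0 = wt e"
        using d gen_sg[of 0] unfolding sg_def by auto
      obtain n' where n': "normal n'" "wt n' = wt e"
        using normal_form[OF e(1), where 'k = int] by blast
      show "?s < gen sg 0"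
      proof (rule ccontr)
        assume "\<not> ?s < gen sg 0"
        \<comment> \<open>Multiplying a normal form of weight s - g_0 by x_0 gives a normal form of
          weight s that contains x_0. Uniqueness would make it x_1^3, which does not contain
          x_0.\<close>
        then have "wt (n' + Poly_Mapping.single 0 1) = ?s"
          using e n' d by (simp add: wt_add wt_single[of 0] gen_sg)
        moreover have "normal (n' + Poly_Mapping.single 0 1)"
          using n' d by (auto simp: normal_def exps_add exps_single lookup_add lookup_single when_def)
        ultimately have "n' + Poly_Mapping.single 0 1 = Poly_Mapping.single 1 3"
          using normal_unique n by blast
        from arg_cong[OF this, of "\<lambda>e. Poly_Mapping.lookup e 0"] show False
          by (simp add: lookup_add lookup_single when_def)
      qed
    qed
  qed
  moreover have "?s \<noteq> 0" using s g_pos[of 1] d by simp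
  moreover have wt_gen: "(\<Sum>i<embdim sg. Poly_Mapping.lookup e i * gen sg i) = wt e" for e
    by (simp add: wt_def embdim_sg gen_sg)
  moreover have "wt (Poly_Mapping.single 2 2) = ?s" using d s by (simp add: wt_single)
  ultimately have "(\<Sum>i<embdim sg. ?a i) = (\<Sum>i<embdim sg. ?b i)"
    using hom[unfolded homogeneous_def, rule_format, of ?s ?a ?b] by simp
  then show False using d by (simp add: embdim_sg lookup_single when_def)
qed

end

section \<open>The semigroup ring and its associated graded ring\<close>

lemma lookup_hom_component:
  "Poly_Mapping.lookup (hom_component n p) e = (if total_deg e = n then Poly_Mapping.lookup p e else 0)"
  unfolding hom_component_def
  by (auto simp: lookup_sum lookup_single when_def sum.delta' in_keys_iff)

lemma hom_component_add: "hom_component n (p + q) = hom_component n p + hom_component n q"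
  by (intro poly_mapping_eqI) (simp add: lookup_hom_component lookup_add)

lemma hom_component_diff:
  "hom_component n (p - q) = hom_component n p - hom_component n (q :: 'k::ab_group_add mpoly)"
  by (intro poly_mapping_eqI) (simp add: lookup_hom_component lookup_minus)

lemma hom_component_zero: "hom_component n 0 = 0"
  by (intro poly_mapping_eqI) (simp add: lookup_hom_component)

lemma hom_component_sum: "hom_component n (sum f I) = (\<Sum>i\<in>I. hom_component n (f i))"
  by (induction I rule: infinite_finite_induct) (simp_all add: hom_component_zero hom_component_add)

lemma hom_component_single:
  "hom_component n (Poly_Mapping.single e c) = (if total_deg e = n then Poly_Mapping.single e c else 0)"
  by (intro poly_mapping_eqI) (auto simp: lookup_hom_component lookup_single when_def)

lemma keys_hom_component: "Poly_Mapping.keys (hom_component n p) = {e \<in> Poly_Mapping.keys p. total_deg e = n}"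
  by (auto simp: in_keys_iff lookup_hom_component split: if_splits)

lemma hom_component_idem:
  "hom_component i (hom_component j p) = (if i = j then hom_component i p else 0)"
  by (intro poly_mapping_eqI) (simp add: lookup_hom_component)

lemma hom_component_polys: "p \<in> polys d \<Longrightarrow> hom_component n p \<in> polys d"
  by (auto simp: polys_def keys_hom_component)

lemma hom_component_mult:
  fixes p q :: "'k::comm_ring_1 mpoly"
  shows "hom_component n (p * q) = (\<Sum>j\<le>n. hom_component j p * hom_component (n - j) q)"
proof (rule additive_mult_induct[where f = "\<lambda>p q. hom_component n (p * q)"
      and g = "\<lambda>p q. \<Sum>j\<le>n. hom_component j p * hom_component (n - j) q"])
  fix u v :: "nat \<Rightarrow>\<^sub>0 nat" and b c :: 'k
  let ?s = "Poly_Mapping.single"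
  have "(\<Sum>j\<le>n. hom_component j (?s u b) * hom_component (n - j) (?s v c))
     = (\<Sum>j\<le>n. if j = total_deg u then (if n - total_deg u = total_deg v then ?s (u + v) (b * c) else 0) else 0)"
    by (intro sum.cong refl) (simp add: hom_component_single mult_single)
  also have "\<dots> = hom_component n (?s u b * ?s v c)"
    by (auto simp: mult_single hom_component_single total_deg_add)
  finally show "hom_component n (?s u b * ?s v c) = (\<Sum>j\<le>n. hom_component j (?s u b) * hom_component (n - j) (?s v c))" ..
qed (simp_all add: hom_component_add distrib_left distrib_right sum.distrib)

context ladder
begin

section \<open>The toric map and the two ideals as kernels\<close>

lemma toric_map_eq: "toric_map sg p = (\<Sum>e\<in>Poly_Mapping.keys p. monom (Poly_Mapping.lookup p e) (wt e))"
  unfolding toric_map_def wt_def embdim_sg by (simp add: gen_sg)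

lemma toric_add: "toric_map sg (p + q) = toric_map sg p + toric_map sg q"
  unfolding toric_map_eq
  by (rule setsum_keys_plus_distrib[of "\<lambda>e c. monom c (wt e)"]) (simp_all add: add_monom)

lemma toric_zero: "toric_map sg 0 = 0"
  by (simp add: toric_map_eq)

lemma toric_diff: "toric_map sg (p - q) = toric_map sg p - toric_map sg q"
  using toric_add[of "p - q" q] by simp

lemma toric_sum: "toric_map sg (sum f I) = (\<Sum>i\<in>I. toric_map sg (f i))"
  by (induction I rule: infinite_finite_induct) (simp_all add: toric_zero toric_add)

lemma toric_single: "toric_map sg (Poly_Mapping.single e c) = monom c (wt e)"
  by (simp add: toric_map_eq)

lemma toric_mult: "toric_map sg (p * q) = toric_map sg p * toric_map sg q"
  by (rule additive_mult_induct[where f = "\<lambda>p q. toric_map sg (p * q)" and g = "\<lambda>p q. toric_map sg p * toric_map sg q"])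
    (simp_all add: toric_add distrib_left distrib_right toric_single mult_single mult_monom wt_add)

text \<open>A coefficient of the image adds up all terms of one weight; the hypothesis isolates a
  single term. It is met by normal monomials, and within one degree by a monomial of maximal degree
  for its weight.\<close>

lemma coeff_toric_unique:
  assumes "\<And>e. e \<in> Poly_Mapping.keys p \<Longrightarrow> wt e = wt n \<Longrightarrow> e = n"
  shows "coeff (toric_map sg p) (wt n) = Poly_Mapping.lookup p n"
proof -
  have "coeff (toric_map sg p) (wt n) = (\<Sum>e\<in>Poly_Mapping.keys p. if e = n then Poly_Mapping.lookup p e else 0)"
    unfolding toric_map_eq coeff_sum using assms by (intro sum.cong refl) auto
  then show ?thesis by (simp add: in_keys_iff)
qed

lemma toric_rel_ideal_zero:
  fixes p :: "'k::field mpoly"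
  assumes "\<And>i. i \<in> {1..c} \<Longrightarrow> toric_map sg (q i) = 0" and "p \<in> rel_ideal d q c"
  shows "toric_map sg p = 0"
  using assms
proof (induction c arbitrary: p)
  case (Suc c)
  then obtain p' r where "p = p' + q (Suc c) * r" "p' \<in> rel_ideal d q c" by auto
  then show ?case using Suc by (simp add: toric_add toric_mult)
qed (simp add: toric_zero)

text \<open>For the harder inclusion, \<open>p\<close> is reduced modulo the ideal to a combination
  of normal monomials. Their weights are pairwise distinct, so no cancellation occurs in the image
  and the reduced polynomial must be zero.\<close>

lemma toric_kernel:
  fixes p :: "'k::field mpoly"
  assumes p: "p \<in> polys d"
  shows "toric_map sg p = 0 \<longleftrightarrow> p \<in> toric_ideal"
proof
  have toric_rel: "toric_map sg (toric_rel i :: 'k mpoly) = 0" if "i \<in> {1..<d}" for i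
    using that by (simp add: toric_rel_def toric_diff toric_single wt_single rel_wt)
  have ideal: "toric_map sg x = 0" if "x \<in> toric_ideal" for x :: "'k mpoly"
  proof (rule toric_rel_ideal_zero)
    show "x \<in> rel_ideal d toric_rel (d - 1)" using that by (simp add: toric_ideal_def)
    show "toric_map sg (toric_rel i :: 'k mpoly) = 0" if "i \<in> {1..d - 1}" for i
      using that d by (intro toric_rel) auto
  qed
  show "p \<in> toric_ideal \<Longrightarrow> toric_map sg p = 0" by (rule ideal)
  interpret coeff_ideal "polys d" "toric_ideal :: 'k mpoly set" by (rule coeff_ideal_toric)
  assume zero: "toric_map sg p = 0"
  have "\<exists>n. normal n \<and> Poly_Mapping.single e 1 - Poly_Mapping.single n 1 \<in> (toric_ideal :: 'k mpoly set)"
    if "e \<in> exps" for e using normal_form[OF that] by blast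
  then obtain nf where nf: "\<And>e. e \<in> exps \<Longrightarrow> normal (nf e)"
    "\<And>e. e \<in> exps \<Longrightarrow> Poly_Mapping.single e 1 - Poly_Mapping.single (nf e) 1 \<in> (toric_ideal :: 'k mpoly set)"
    by metis
  have keys: "Poly_Mapping.keys p \<subseteq> exps" using p by (simp add: polys_iff)
  \<comment> \<open>Every monomial is replaced by its normal form; terms with the same normal form
    merge.\<close>
  define p' where "p' = (\<Sum>e\<in>Poly_Mapping.keys p. Poly_Mapping.single (nf e) (Poly_Mapping.lookup p e))"
  have "p - p' = (\<Sum>e\<in>Poly_Mapping.keys p. Poly_Mapping.single 0 (Poly_Mapping.lookup p e) *
      (Poly_Mapping.single e 1 - Poly_Mapping.single (nf e) 1))"
    unfolding p'_def by (subst (1) mpoly_eq_sum_single[of p]) (simp add: right_diff_distrib mult_single sum_subtractf)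
  also have "\<dots> \<in> toric_ideal"
    using keys nf(2) by (intro ideal_sum ideal_mult) (auto intro!: polys_single)
  finally have diff: "p - p' \<in> toric_ideal" .
  have normal: "normal n" if "n \<in> Poly_Mapping.keys p'" for n
    using that keys_sum[of "\<lambda>e. Poly_Mapping.single (nf e) (Poly_Mapping.lookup p e)" "Poly_Mapping.keys p"]
      nf(1) keys unfolding p'_def by (auto split: if_splits)
  have "toric_map sg p' = 0" using ideal[OF diff] zero by (simp add: toric_diff)
  then have "Poly_Mapping.lookup p' n = 0" if "n \<in> Poly_Mapping.keys p'" for n
    using coeff_toric_unique[of p' n] normal normal_unique that by force
  then have "p' = 0" by (intro poly_mapping_eqI) (metis in_keys_iff lookup_zero)
  then show "p \<in> toric_ideal" using diff by simp
qed

text \<open>A monomial ideal is recognised on supports, and a monomial of P is divisible by some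
  x_i^(\<open>bnd i\<close>) with i >= 1 exactly when it is not normal.\<close>

lemma initial_ideal_iff:
  fixes p :: "'k::field mpoly"
  assumes p: "p \<in> polys d"
  shows "p \<in> initial_ideal \<longleftrightarrow> (\<forall>e\<in>Poly_Mapping.keys p. \<not> normal e)"
proof
  have "\<forall>e\<in>Poly_Mapping.keys p. \<not> normal e" if "p \<in> rel_ideal d initial_rel c" "c < d" for c and p :: "'k mpoly"
    using that
  proof (induction c arbitrary: p)
    case (Suc c)
    obtain p' r where pr: "p = p' + initial_rel (Suc c) * r" "p' \<in> rel_ideal d initial_rel c"
      using Suc.prems(1) by auto
    have "\<not> normal e" if e: "e \<in> Poly_Mapping.keys (initial_rel (Suc c) * r)" for e
    proof -
      obtain u where "e = Poly_Mapping.single (Suc c) (bnd (Suc c)) + u"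
        using e keys_mult[of "initial_rel (Suc c)" r] by (auto simp: initial_rel_def split: if_splits)
      then have "bnd (Suc c) \<le> Poly_Mapping.lookup e (Suc c)" by (simp add: lookup_add)
      then show ?thesis using Suc.prems(2) by (auto simp: normal_def not_less)
    qed
    then show ?case using Suc.IH[OF pr(2)] Suc.prems(2) keys_add[of p' "initial_rel (Suc c) * r"]
      unfolding pr(1) by auto
  qed simp
  from this[of p "d - 1"] show "p \<in> initial_ideal \<Longrightarrow> \<forall>e\<in>Poly_Mapping.keys p. \<not> normal e"
    using d unfolding initial_ideal_def by simp
  interpret coeff_ideal "polys d" "initial_ideal :: 'k mpoly set" by (rule coeff_ideal_initial)
  assume nn: "\<forall>e\<in>Poly_Mapping.keys p. \<not> normal e"
  have "Poly_Mapping.single e (Poly_Mapping.lookup p e) \<in> initial_ideal" if e: "e \<in> Poly_Mapping.keys p" for e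
  proof -
    have "e \<in> exps" "\<not> normal e" using e nn p by (auto simp: polys_iff)
    then obtain i u where iu: "i \<in> {1..<d}" "u \<in> exps" "e = u + Poly_Mapping.single i (bnd i)"
      using rewrite_step by blast
    have "initial_rel i * Poly_Mapping.single u (Poly_Mapping.lookup p e) \<in> initial_ideal"
      unfolding initial_ideal_def
    proof (rule rel_in_rel_ideal)
      show "initial_rel j \<in> polys d" if "j \<in> {1..d - 1}" for j
        using that d by (intro triangular_rel_polys[of j] triangular_initial_rel) auto
    qed (use iu in \<open>auto simp: polys_iff\<close>)
    then show ?thesis by (simp add: initial_rel_def mult_single iu(3) add.commute)
  qed
  then have "(\<Sum>e\<in>Poly_Mapping.keys p. Poly_Mapping.single e (Poly_Mapping.lookup p e)) \<in> initial_ideal"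
    by (rule ideal_sum)
  then show "p \<in> initial_ideal" using mpoly_eq_sum_single[of p] by simp
qed

definition weights :: "nat \<Rightarrow> nat set" where
  "weights n = {wt e | e. e \<in> exps \<and> total_deg e \<ge> n}"

text \<open>An explicit form of the n-th power of the irrelevant ideal, spanned by the t^s for which
  s has a factorization of length at least n; \<open>J 0\<close> is the whole ring. The
  identification is \<open>ideal_power_eq\<close>.\<close>

definition J :: "nat \<Rightarrow> 'k::field poly set" where
  "J n = {f. \<forall>s. coeff f s \<noteq> 0 \<longrightarrow> s \<in> weights n}"

lemma weights_add: "s \<in> weights a \<Longrightarrow> t \<in> weights b \<Longrightarrow> s + t \<in> weights (a + b)"
proof -
  assume "s \<in> weights a" "t \<in> weights b"
  then obtain u v where "s = wt u" "t = wt v" "u \<in> exps" "v \<in> exps" "total_deg u \<ge> a" "total_deg v \<ge> b"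
    by (auto simp: weights_def)
  then show ?thesis unfolding weights_def
    by (intro CollectI exI[of _ "u + v"]) (simp add: wt_add exps_add total_deg_add)
qed

lemma weights_0: "weights 0 = sg" by (auto simp: weights_def sg_def)

lemma J_mono: "a \<le> b \<Longrightarrow> J b \<subseteq> J a"
  by (fastforce simp: J_def weights_def)

lemma J_zero: "0 \<in> J n" by (simp add: J_def)

lemma J_add: "f \<in> J n \<Longrightarrow> h \<in> J n \<Longrightarrow> f + h \<in> J n"
  by (auto simp: J_def) (metis add_0)

lemma J_uminus: "f \<in> J n \<Longrightarrow> - f \<in> J n"
  by (auto simp: J_def)

lemma J_diff: "f \<in> J n \<Longrightarrow> h \<in> J n \<Longrightarrow> f - h \<in> J n"
  using J_add[of f n "- h"] J_uminus[of h n] by simp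

lemma J_sum: "(\<And>i. i \<in> I \<Longrightarrow> f i \<in> J n) \<Longrightarrow> sum f I \<in> J n"
  by (induction I rule: infinite_finite_induct) (auto simp: J_zero J_add)

lemma J_mult:
  assumes f: "f \<in> J a" and h: "h \<in> J b"
  shows "f * h \<in> J (a + b)"
  unfolding J_def
proof (intro CollectI allI impI)
  fix s assume "coeff (f * h) s \<noteq> 0"
  then obtain i where i: "i \<le> s" "coeff f i * coeff h (s - i) \<noteq> 0"
    unfolding coeff_mult by (metis (no_types, lifting) atMost_iff sum.neutral)
  then have "i \<in> weights a" "s - i \<in> weights b" using f h by (auto simp: J_def)
  from weights_add[OF this] show "s \<in> weights (a + b)" using i by simp
qed

lemma J_monom: "s \<in> weights n \<Longrightarrow> monom c s \<in> J n"
  by (auto simp: J_def coeff_monom)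

lemma J_induct:
  assumes "0 \<in> X" and "\<And>x y. x \<in> X \<Longrightarrow> y \<in> X \<Longrightarrow> x + y \<in> X"
    and monom: "\<And>s c. s \<in> weights n \<Longrightarrow> monom c s \<in> X"
  shows "J n \<subseteq> X"
proof
  fix f :: "'a poly" assume f: "f \<in> J n"
  have sum: "sum h I \<in> X" if "\<And>i. i \<in> I \<Longrightarrow> h i \<in> X" for h :: "nat \<Rightarrow> 'a poly" and I
    using that by (induction I rule: infinite_finite_induct) (auto intro: assms)
  have "(\<Sum>s\<le>degree f. monom (coeff f s) s) \<in> X"
  proof (rule sum)
    fix s
    show "monom (coeff f s) s \<in> X"
    proof (cases "coeff f s = 0")
      case False
      then show ?thesis using f by (intro monom) (auto simp: J_def)
    qed (use assms(1) in simp)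
  qed
  then show "f \<in> X" by (simp add: poly_as_sum_of_monoms)
qed

lemma toric_in_J: "(\<And>e. e \<in> Poly_Mapping.keys p \<Longrightarrow> wt e \<in> weights n) \<Longrightarrow> toric_map sg p \<in> J n"
  unfolding toric_map_eq by (intro J_sum J_monom)

lemma toric_hom_component_in_J:
  assumes "p \<in> polys d"
  shows "toric_map sg (hom_component n p) \<in> J n"
proof (rule toric_in_J)
  fix e assume "e \<in> Poly_Mapping.keys (hom_component n p)"
  then have "e \<in> exps" "total_deg e = n" using assms by (auto simp: keys_hom_component polys_iff)
  then show "wt e \<in> weights n" by (auto simp: weights_def)
qed

text \<open>Each t^s in the span lifts to a monomial of degree at least n. The degree bound on the
  lift is what surjectivity onto the associated graded ring needs.\<close>

lemma J_eq_toric: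
  fixes f :: "'k::field poly"
  assumes "f \<in> J n"
  obtains p where "p \<in> polys d" "\<And>e. e \<in> Poly_Mapping.keys p \<Longrightarrow> total_deg e \<ge> n" "toric_map sg p = f"
proof -
  define X where "X = {toric_map sg p | p :: 'k mpoly. p \<in> polys d \<and> (\<forall>e\<in>Poly_Mapping.keys p. total_deg e \<ge> n)}"
  have "J n \<subseteq> X"
  proof (rule J_induct)
    have "0 = toric_map sg (0 :: 'k mpoly)" by (simp add: toric_zero)
    then show "0 \<in> X" unfolding X_def using polys_zero by fastforce
    show "x + y \<in> X" if x: "x \<in> X" and y: "y \<in> X" for x y
    proof -
      obtain p q :: "'k mpoly" where "x = toric_map sg p" "y = toric_map sg q" "p \<in> polys d" "q \<in> polys d"
        "\<forall>e\<in>Poly_Mapping.keys p. total_deg e \<ge> n" "\<forall>e\<in>Poly_Mapping.keys q. total_deg e \<ge> n"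
        using x y unfolding X_def by blast
      then have "x + y = toric_map sg (p + q)" "p + q \<in> polys d" "\<forall>e\<in>Poly_Mapping.keys (p + q). total_deg e \<ge> n"
        using keys_add[of p q] by (auto simp: toric_add polys_add)
      then show ?thesis unfolding X_def by blast
    qed
    show "monom c s \<in> X" if s: "s \<in> weights n" for s c
    proof -
      obtain e where "s = wt e" "e \<in> exps" "total_deg e \<ge> n" using s by (auto simp: weights_def)
      then show ?thesis unfolding X_def
        by (intro CollectI exI[of _ "Poly_Mapping.single e c"]) (auto simp: toric_single polys_iff)
    qed
  qed
  then show thesis using assms that unfolding X_def by blast
qed

section \<open>The semigroup ring and the powers of its irrelevant ideal\<close>

lemma semigroup_ring_simps:
  "carrier (semigroup_ring sg) = J 0" "monoid.mult (semigroup_ring sg) = (*)" "monoid.one (semigroup_ring sg) = 1"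
  "ring.zero (semigroup_ring sg) = 0" "ring.add (semigroup_ring sg) = (+)"
  by (simp_all add: semigroup_ring_def J_def weights_0)

lemma one_in_J: "1 \<in> J 0"
  using sg_submonoid by (auto simp: J_def weights_0 nat_submonoid_def coeff_1)

lemma cring_semigroup_ring: "cring (semigroup_ring sg :: 'k::field poly ring)"
proof (intro cringI abelian_groupI comm_monoidI)
  show "\<exists>y\<in>carrier (semigroup_ring sg). y \<oplus>\<^bsub>semigroup_ring sg\<^esub> x = \<zero>\<^bsub>semigroup_ring sg\<^esub>"
    if "x \<in> carrier (semigroup_ring sg)" for x :: "'k poly"
    using that by (intro bexI[of _ "- x"]) (simp_all add: semigroup_ring_simps J_uminus)
qed (use J_mult[of _ 0 _ 0] in \<open>simp_all add: semigroup_ring_simps J_zero J_add one_in_J algebra_simps\<close>)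

lemma a_inv_semigroup_ring:
  assumes "x \<in> J 0"
  shows "\<ominus>\<^bsub>semigroup_ring sg\<^esub> x = - (x :: 'k::field poly)"
proof -
  interpret cring "semigroup_ring sg :: 'k poly ring" by (rule cring_semigroup_ring)
  show ?thesis using assms by (intro minus_equality) (simp_all add: semigroup_ring_simps J_uminus)
qed

lemma ideal_J: "ideal (J n) (semigroup_ring sg :: 'k::field poly ring)"
proof (rule idealI)
  interpret cring "semigroup_ring sg :: 'k poly ring" by (rule cring_semigroup_ring)
  show "ring (semigroup_ring sg :: 'k poly ring)" by (rule ring_axioms)
  have sub: "J n \<subseteq> J 0" by (rule J_mono) simp
  show "subgroup (J n) (add_monoid (semigroup_ring sg :: 'k poly ring))"
  proof
    show "inv\<^bsub>add_monoid (semigroup_ring sg)\<^esub> x \<in> J n" if "x \<in> J n" for x :: "'k poly"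
      using a_inv_semigroup_ring[of x] that sub J_uminus[OF that] by (auto simp: a_inv_def)
  qed (use sub in \<open>auto simp: semigroup_ring_simps J_add J_zero\<close>)
  fix f h :: "'k poly" assume "f \<in> J n" "h \<in> carrier (semigroup_ring sg)"
  then show "h \<otimes>\<^bsub>semigroup_ring sg\<^esub> f \<in> J n" "f \<otimes>\<^bsub>semigroup_ring sg\<^esub> h \<in> J n"
    using J_mult[of h 0 f n] J_mult[of f n h 0] by (simp_all add: semigroup_ring_simps)
qed

text \<open>Splitting one variable off a monomial; this lets \<open>J (Suc n)\<close> be generated
  by products from \<open>J 1\<close> and \<open>J n\<close>.\<close>

lemma weights_Suc: "s \<in> weights (Suc n) \<Longrightarrow> \<exists>i<d. \<exists>t\<in>weights n. s = g i + t"
proof -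
  assume "s \<in> weights (Suc n)"
  then obtain e where e: "s = wt e" "e \<in> exps" "total_deg e \<ge> Suc n" by (auto simp: weights_def)
  then have "e \<noteq> 0" using total_deg_eq_0_iff[of e] by auto
  then obtain i where i: "i \<in> Poly_Mapping.keys e" by (metis all_not_in_conv keys_eq_empty)
  then have "1 \<le> Poly_Mapping.lookup e i" by (simp add: in_keys_iff)
  from exp_split[OF this] obtain u where u: "e = u + Poly_Mapping.single i 1" by blast
  have "i < d" using i e(2) by (auto simp: exps_def)
  then have "s = g i + wt u" using e u by (simp add: wt_add wt_single)
  moreover have "wt u \<in> weights n"
    using e u unfolding weights_def by (auto simp: exps_add total_deg_add total_deg_single)
  ultimately show ?thesis using \<open>i < d\<close> by blast
qed

lemma g_weights: "i < d \<Longrightarrow> g i \<in> weights 1"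
  unfolding weights_def
  by (intro CollectI exI[of _ "Poly_Mapping.single i 1"]) (simp add: wt_single exps_single total_deg_single)

lemma irrelevant_ideal_eq: "irrelevant_ideal sg = (J 1 :: 'k::field poly set)"
proof
  interpret cring "semigroup_ring sg :: 'k poly ring" by (rule cring_semigroup_ring)
  show "irrelevant_ideal sg \<subseteq> (J 1 :: 'k poly set)"
    unfolding irrelevant_ideal_def min_gens_sg
    by (rule genideal_minimal[OF ideal_J]) (auto intro!: J_monom g_weights[unfolded One_nat_def])
  have gens: "(\<lambda>n. monom 1 n :: 'k poly) ` min_gens sg \<subseteq> carrier (semigroup_ring sg)"
    unfolding min_gens_sg semigroup_ring_simps by (auto intro!: J_monom simp: weights_0 g_in_sg)
  interpret I: ideal "irrelevant_ideal sg" "semigroup_ring sg :: 'k poly ring"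
    unfolding irrelevant_ideal_def by (rule genideal_ideal[OF gens])
  show "(J 1 :: 'k poly set) \<subseteq> irrelevant_ideal sg"
  proof (rule J_induct)
    show "(0 :: 'k poly) \<in> irrelevant_ideal sg" using I.zero_closed by (simp add: semigroup_ring_simps)
    show "x + y \<in> irrelevant_ideal sg" if "x \<in> irrelevant_ideal sg" "y \<in> irrelevant_ideal sg" for x y :: "'k poly"
      using I.a_closed[OF that] by (simp add: semigroup_ring_simps)
    fix s and c :: 'k assume "s \<in> weights 1"
    then obtain i t where s: "i < d" "t \<in> weights 0" "s = g i + t" using weights_Suc[of s 0] by auto
    have "monom 1 (g i) \<in> (irrelevant_ideal sg :: 'k poly set)"
      using genideal_self[OF gens] s(1) unfolding irrelevant_ideal_def min_gens_sg by blast
    from I.I_r_closed[OF this, of "monom c t"] J_monom[OF s(2), of c]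
    show "monom c s \<in> irrelevant_ideal sg" by (simp add: semigroup_ring_simps mult_monom s(3))
  qed
qed

text \<open>Factorization lengths add under multiplication, which gives one inclusion. For the
  other, t^s with s of length at least n + 1 is t^(g_i) times an element of \<open>J n\<close>, and
  such monomials span.\<close>

lemma ideal_power_eq: "ideal_power (semigroup_ring sg) (irrelevant_ideal sg) n = (J n :: 'k::field poly set)"
proof (induction n)
  case 0
  show ?case by (simp add: semigroup_ring_simps)
next
  case (Suc n)
  let ?P = "ideal_prod (semigroup_ring sg) (J 1) (J n :: 'k poly set)"
  have "?P \<subseteq> J (Suc n)"
  proof
    fix x assume "x \<in> ?P"
    then show "x \<in> J (Suc n)"
    proof (induction rule: ideal_prod.induct)
      case (prod f h)
      then show ?case using J_mult[of f 1 h n] by (simp add: semigroup_ring_simps)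
    qed (simp add: semigroup_ring_simps J_add)
  qed
  moreover have "J (Suc n) \<subseteq> ?P"
  proof (rule J_induct)
    show "0 \<in> ?P" using ideal_prod.prod[OF J_zero J_zero, of "semigroup_ring sg"] by (simp add: semigroup_ring_simps)
    show "x + y \<in> ?P" if "x \<in> ?P" "y \<in> ?P" for x y
      using ideal_prod.sum[OF that] by (simp add: semigroup_ring_simps)
    fix s and c :: 'k assume "s \<in> weights (Suc n)"
    then obtain i t where s: "i < d" "t \<in> weights n" "s = g i + t" using weights_Suc by blast
    show "monom c s \<in> ?P"
      using ideal_prod.prod[OF J_monom[OF g_weights[OF s(1)], of 1] J_monom[OF s(2), of c], of "semigroup_ring sg"]
      by (simp add: semigroup_ring_simps mult_monom s(3))
  qed
  ultimately show ?case
    unfolding ideal_power.simps Suc.IH unfolding irrelevant_ideal_eq by (rule equalityI)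
qed

lemma cyclic_module_toric:
  "cyclic_module d toric_ideal (toric_map sg) (module_via (toric_map sg :: 'k::field mpoly \<Rightarrow> _) (semigroup_ring sg))"
proof
  show "toric_map sg ` polys d = carrier (module_via (toric_map sg :: 'k mpoly \<Rightarrow> _) (semigroup_ring sg))"
  proof (intro equalityI subsetI)
    fix f assume "f \<in> toric_map sg ` (polys d :: 'k mpoly set)"
    then obtain p :: "'k mpoly" where p: "p \<in> polys d" "f = toric_map sg p" by blast
    have "toric_map sg p \<in> J 0" by (rule toric_in_J) (use p in \<open>auto simp: weights_0 sg_def polys_iff\<close>)
    then show "f \<in> carrier (module_via (toric_map sg :: 'k mpoly \<Rightarrow> _) (semigroup_ring sg))"
      by (simp add: module_via_def semigroup_ring_simps p)
  next
    fix f assume "f \<in> carrier (module_via (toric_map sg :: 'k mpoly \<Rightarrow> _) (semigroup_ring sg))"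
    then have "f \<in> J 0" by (simp add: module_via_def semigroup_ring_simps)
    then show "f \<in> toric_map sg ` polys d" by (metis J_eq_toric image_eqI)
  qed
  fix p q :: "'k mpoly" assume "p \<in> polys d" "q \<in> polys d"
  then show "toric_map sg p = toric_map sg q \<longleftrightarrow> p - q \<in> toric_ideal"
    using toric_kernel[OF polys_diff, of p q] by (simp add: toric_diff)
qed (simp_all add: module_via_def semigroup_ring_simps toric_add toric_mult toric_zero)

section \<open>The associated graded ring as a quotient of P\<close>

lemma finsum_semigroup_ring:
  assumes "finite I" "\<And>i. i \<in> I \<Longrightarrow> f i \<in> J 0"
  shows "finsum (semigroup_ring sg) f I = (sum f I :: 'k::field poly)"
proof -
  interpret cring "semigroup_ring sg :: 'k poly ring" by (rule cring_semigroup_ring)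
  show ?thesis
    using assms
  proof (induction I)
    case (insert i I)
    then have "finsum (semigroup_ring sg) f (insert i I) = f i \<oplus>\<^bsub>semigroup_ring sg\<^esub> finsum (semigroup_ring sg) f I"
      by (intro finsum_insert) (auto simp: semigroup_ring_simps)
    then show ?case using insert by (simp add: semigroup_ring_simps)
  qed (simp add: semigroup_ring_simps)
qed

lemma coset_mem: "y \<in> J n +>\<^bsub>semigroup_ring sg\<^esub> x \<longleftrightarrow> y - x \<in> (J n :: 'k::field poly set)"
  unfolding a_r_coset_def' semigroup_ring_simps by (auto intro: bexI[of _ "y - x"])

lemma coset_eq_iff:
  "J n +>\<^bsub>semigroup_ring sg\<^esub> x = J n +>\<^bsub>semigroup_ring sg\<^esub> y \<longleftrightarrow> x - y \<in> (J n :: 'k::field poly set)"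
proof
  assume "J n +>\<^bsub>semigroup_ring sg\<^esub> x = J n +>\<^bsub>semigroup_ring sg\<^esub> y"
  moreover have "x \<in> J n +>\<^bsub>semigroup_ring sg\<^esub> x" by (simp add: coset_mem J_zero)
  ultimately show "x - y \<in> J n" using coset_mem by blast
next
  assume xy: "x - y \<in> J n"
  show "J n +>\<^bsub>semigroup_ring sg\<^esub> x = J n +>\<^bsub>semigroup_ring sg\<^esub> y"
  proof (intro Set.set_eqI)
    fix z
    have "z - x \<in> J n \<longleftrightarrow> z - y \<in> J n"
      using J_add[OF _ xy, of "z - x"] J_diff[OF _ xy, of "z - y"] by (auto simp: algebra_simps)
    then show "z \<in> J n +>\<^bsub>semigroup_ring sg\<^esub> x \<longleftrightarrow> z \<in> J n +>\<^bsub>semigroup_ring sg\<^esub> y"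
      by (simp add: coset_mem)
  qed
qed

lemma coset_zero: "J n +>\<^bsub>semigroup_ring sg\<^esub> 0 = (J n :: 'k::field poly set)"
  by (auto simp: coset_mem)

lemma gr_map_eq:
  "gr_map sg p n = J (Suc n) +>\<^bsub>semigroup_ring sg\<^esub> toric_map sg (hom_component n p)"
  by (simp add: gr_map_def ideal_power_eq del: ideal_power.simps)

lemma gr_map_mem: "f \<in> gr_map sg p n \<longleftrightarrow> f - toric_map sg (hom_component n p) \<in> J (Suc n)"
  by (simp only: gr_map_eq coset_mem)

text \<open>A non-normal monomial shares its weight with its normal form, which has larger degree,
  so its image drops one step deeper in the filtration. A normal monomial is the only one of its
  weight in its degree and no longer factorization exists, so its coefficient survives and obstructs
  membership in the next power.\<close>

lemma gr_kernel:
  fixes p :: "'k::field mpoly"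
  assumes p: "p \<in> polys d"
  shows "(\<forall>n. toric_map sg (hom_component n p) \<in> J (Suc n)) \<longleftrightarrow> p \<in> initial_ideal"
  unfolding initial_ideal_iff[OF p]
proof
  assume nn: "\<forall>e\<in>Poly_Mapping.keys p. \<not> normal e"
  show "\<forall>n. toric_map sg (hom_component n p) \<in> J (Suc n)"
  proof (intro allI toric_in_J)
    fix n e assume "e \<in> Poly_Mapping.keys (hom_component n p)"
    then have e: "e \<in> Poly_Mapping.keys p" "e \<in> exps" "total_deg e = n"
      using p by (auto simp: keys_hom_component polys_iff)
    obtain e' where e': "normal e'" "wt e' = wt e" "e' = e \<or> total_deg e' > total_deg e"
      using normal_form[OF e(2), where 'k = int] by blast
    then have "total_deg e' \<ge> Suc n" using nn e by auto
    then show "wt e \<in> weights (Suc n)"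
      unfolding weights_def using e' by (auto simp: normal_def intro!: exI[of _ e'])
  qed
next
  assume J: "\<forall>n. toric_map sg (hom_component n p) \<in> J (Suc n)"
  show "\<forall>e\<in>Poly_Mapping.keys p. \<not> normal e"
  proof (intro ballI notI)
    fix e assume e: "e \<in> Poly_Mapping.keys p" "normal e"
    let ?n = "total_deg e"
    have "coeff (toric_map sg (hom_component ?n p)) (wt e) = Poly_Mapping.lookup (hom_component ?n p) e"
    proof (rule coeff_toric_unique)
      fix e' assume "e' \<in> Poly_Mapping.keys (hom_component ?n p)" and wt: "wt e' = wt e"
      then have "e' \<in> exps" "total_deg e' = ?n" using p by (auto simp: keys_hom_component polys_iff)
      then show "e' = e" using normal_deg_max[OF e(2) _ wt] by auto
    qed
    also have "\<dots> \<noteq> 0" using e(1) by (simp add: lookup_hom_component in_keys_iff)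
    finally have "wt e \<in> weights (Suc ?n)" using J by (auto simp: J_def)
    then obtain e' where "e' \<in> exps" "wt e' = wt e" "total_deg e' \<ge> Suc ?n" by (auto simp: weights_def)
    then show False using normal_deg_max[OF e(2), of e'] by auto
  qed
qed

lemma gr_simps:
  "carrier (gr TYPE('k::field) sg) = {h. (\<forall>n. \<exists>x\<in>J n. h n = J (Suc n) +>\<^bsub>semigroup_ring sg\<^esub> x) \<and> finite {n. h n \<noteq> J (Suc n)}}"
  "monoid.mult (gr TYPE('k) sg) = (\<lambda>f h n. {(\<Oplus>\<^bsub>semigroup_ring sg\<^esub>j\<in>{..n}. u j * v (n - j)) + x | u v x.
      (\<forall>j\<le>n. u j \<in> f j \<and> v j \<in> h j) \<and> x \<in> J (Suc n)})"
  "ring.zero (gr TYPE('k) sg) = (\<lambda>n. J (Suc n))"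
  "ring.add (gr TYPE('k) sg) = (\<lambda>f h n. f n <+>\<^bsub>semigroup_ring sg\<^esub> h n)"
  by (simp_all add: gr_def assoc_graded_def ideal_power_eq semigroup_ring_simps del: ideal_power.simps)

lemma gr_map_surj: "gr_map sg ` polys d = carrier (gr TYPE('k::field) sg)"
proof (intro equalityI subsetI)
  fix h assume "h \<in> gr_map sg ` (polys d :: 'k mpoly set)"
  then obtain p :: "'k mpoly" where p: "p \<in> polys d" "h = gr_map sg p" by blast
  have "{n. h n \<noteq> J (Suc n)} \<subseteq> total_deg ` Poly_Mapping.keys p"
  proof
    fix n assume n: "n \<in> {n. h n \<noteq> J (Suc n)}"
    show "n \<in> total_deg ` Poly_Mapping.keys p"
    proof (rule ccontr)
      assume "n \<notin> total_deg ` Poly_Mapping.keys p"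
      then have "Poly_Mapping.keys (hom_component n p) = {}" by (auto simp: keys_hom_component)
      then have "hom_component n p = 0" by (simp only: keys_eq_empty)
      then show False using n by (simp add: p(2) gr_map_eq toric_zero coset_zero)
    qed
  qed
  then have "finite {n. h n \<noteq> J (Suc n)}" by (rule finite_subset) simp
  then show "h \<in> carrier (gr TYPE('k) sg)"
    unfolding gr_simps using toric_hom_component_in_J[OF p(1)] by (auto simp: p(2) gr_map_eq)
next
  fix h assume "h \<in> carrier (gr TYPE('k) sg)"
  then have "\<And>n. \<exists>x\<in>J n. h n = J (Suc n) +>\<^bsub>semigroup_ring sg\<^esub> x" and fin: "finite {n. h n \<noteq> J (Suc n)}"
    by (auto simp: gr_simps)
  then obtain x where x: "\<And>n. x n \<in> J n" "\<And>n. h n = J (Suc n) +>\<^bsub>semigroup_ring sg\<^esub> x n" by metis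
  have "\<exists>p :: 'k mpoly. p \<in> polys d \<and> x n - toric_map sg (hom_component n p) \<in> J (Suc n)" for n
  proof -
    obtain p :: "'k mpoly" where p: "p \<in> polys d" "\<And>e. e \<in> Poly_Mapping.keys p \<Longrightarrow> total_deg e \<ge> n" "toric_map sg p = x n"
      using J_eq_toric[OF x(1)] by blast
    \<comment> \<open>All terms of the lift have degree at least n; those beyond degree n vanish in
      the n-th graded piece.\<close>
    have "toric_map sg (p - hom_component n p) \<in> J (Suc n)"
    proof (rule toric_in_J)
      fix e assume "e \<in> Poly_Mapping.keys (p - hom_component n p)"
      then have "e \<in> Poly_Mapping.keys p" "total_deg e \<noteq> n"
        by (auto simp: in_keys_iff lookup_minus lookup_hom_component split: if_splits)
      then have "e \<in> exps" "total_deg e \<ge> Suc n" using p(1) p(2)[of e] by (force simp: polys_iff)+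
      then show "wt e \<in> weights (Suc n)" by (auto simp: weights_def)
    qed
    then show ?thesis using p by (auto simp: toric_diff)
  qed
  then obtain p :: "nat \<Rightarrow> 'k mpoly" where p: "\<And>n. p n \<in> polys d" "\<And>n. x n - toric_map sg (hom_component n (p n)) \<in> J (Suc n)"
    by metis
  define F where "F = {n. h n \<noteq> J (Suc n)}"
  \<comment> \<open>Only the finitely many nonzero components of \<open>h\<close> are lifted, which
    makes the sum a polynomial.\<close>
  define P where "P = (\<Sum>n\<in>F. hom_component n (p n))"
  have "P \<in> polys d"
    unfolding P_def using coeff_ring.sum_mem[OF coeff_ring_polys] hom_component_polys p(1) by metis
  moreover have "gr_map sg P = h"
  proof
    fix n
    have "hom_component n P = (\<Sum>i\<in>F. if i = n then hom_component n (p n) else 0)"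
      unfolding P_def hom_component_sum by (intro sum.cong refl) (simp add: hom_component_idem)
    also have "\<dots> = (if n \<in> F then hom_component n (p n) else 0)" using fin by (simp add: F_def)
    finally have P: "hom_component n P = (if n \<in> F then hom_component n (p n) else 0)" .
    show "gr_map sg P n = h n"
    proof (cases "n \<in> F")
      case True
      then show ?thesis using p(2)[of n] J_uminus[OF p(2)[of n]] by (simp add: gr_map_eq P x(2) coset_eq_iff)
    next
      case False
      then have "h n = J (Suc n)" by (simp add: F_def)
      then show ?thesis using False by (simp add: gr_map_eq P toric_zero coset_zero)
    qed
  qed
  ultimately show "h \<in> gr_map sg ` polys d" by blast
qed

lemma gr_map_eq_iff:
  fixes p q :: "'k::field mpoly"
  assumes "p \<in> polys d" "q \<in> polys d"
  shows "gr_map sg p = gr_map sg q \<longleftrightarrow> p - q \<in> initial_ideal"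
  unfolding gr_kernel[OF polys_diff[OF assms], symmetric]
  by (simp add: fun_eq_iff gr_map_eq coset_eq_iff hom_component_diff toric_diff)

lemma gr_map_add:
  fixes p q :: "'k::field mpoly"
  shows "(\<lambda>n. gr_map sg p n <+>\<^bsub>semigroup_ring sg\<^esub> gr_map sg q n) = gr_map sg (p + q)"
proof (intro ext Set.set_eqI)
  fix n and f :: "'k poly"
  let ?t = "\<lambda>p. toric_map sg (hom_component n p)"
  show "f \<in> gr_map sg p n <+>\<^bsub>semigroup_ring sg\<^esub> gr_map sg q n \<longleftrightarrow> f \<in> gr_map sg (p + q) n"
  proof
    assume "f \<in> gr_map sg p n <+>\<^bsub>semigroup_ring sg\<^esub> gr_map sg q n"
    then obtain u v where uv: "f = u + v" "u - ?t p \<in> J (Suc n)" "v - ?t q \<in> J (Suc n)"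
      by (auto simp: set_add_def' semigroup_ring_simps gr_map_mem)
    from J_add[OF uv(2,3)] show "f \<in> gr_map sg (p + q) n"
      by (simp add: gr_map_mem uv(1) hom_component_add toric_add algebra_simps)
  next
    assume "f \<in> gr_map sg (p + q) n"
    then have "(f - ?t q) - ?t p \<in> J (Suc n)"
      by (simp add: gr_map_mem hom_component_add toric_add algebra_simps)
    then have "f - ?t q \<in> gr_map sg p n" "?t q \<in> gr_map sg q n" "f = (f - ?t q) + ?t q"
      by (simp_all add: gr_map_mem J_zero)
    then show "f \<in> gr_map sg p n <+>\<^bsub>semigroup_ring sg\<^esub> gr_map sg q n"
      unfolding set_add_def' semigroup_ring_simps by blast
  qed
qed

text \<open>The product in \<open>gr\<close> collects the values for all choices of representatives;
  the point is that they fill exactly one coset of \<open>J (Suc n)\<close>, that of the n-th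
  component of the product.\<close>

lemma gr_map_mult:
  fixes p q :: "'k::field mpoly"
  assumes p: "p \<in> polys d" and q: "q \<in> polys d"
  shows "gr_map sg p \<otimes>\<^bsub>gr TYPE('k) sg\<^esub> gr_map sg q = gr_map sg (p * q)"
proof (intro ext Set.set_eqI)
  fix n and f :: "'k poly"
  define a where "a j = toric_map sg (hom_component j p)" for j
  define b where "b j = toric_map sg (hom_component j q)" for j
  have ab: "a j \<in> J j" "b j \<in> J j" for j
    unfolding a_def b_def using toric_hom_component_in_J p q by blast+
  have pq: "toric_map sg (hom_component n (p * q)) = (\<Sum>j\<le>n. a j * b (n - j))"
    by (simp add: hom_component_mult toric_sum toric_mult a_def b_def)
  have J0: "x \<in> J 0" if "x \<in> J i" for x :: "'k poly" and i using J_mono[of 0 i] that by blast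
  \<comment> \<open>Representatives of the j-th component lie in \<open>J j\<close>; this keeps
    products in the ring and gives the degree count below.\<close>
  have mem: "u \<in> J j" if "u - a j \<in> J (Suc j)" for u j
    using J_add[OF subsetD[OF J_mono[of j "Suc j"] that] ab(1)] by simp
  have mem': "v \<in> J j" if "v - b j \<in> J (Suc j)" for v j
    using J_add[OF subsetD[OF J_mono[of j "Suc j"] that] ab(2)] by simp
  have finsum: "(\<Oplus>\<^bsub>semigroup_ring sg\<^esub>j\<in>{..n}. u j * v (n - j)) = (\<Sum>j\<le>n. u j * v (n - j))"
    if uv: "\<forall>j\<le>n. u j \<in> J j \<and> v j \<in> J j" for u v :: "nat \<Rightarrow> 'k poly"
  proof (rule finsum_semigroup_ring)
    show "u j * v (n - j) \<in> J 0" if "j \<in> {..n}" for j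
      using J0[OF J_mult[of "u j" j "v (n - j)" "n - j"]] that uv by simp
  qed simp
  have "f \<in> (gr_map sg p \<otimes>\<^bsub>gr TYPE('k) sg\<^esub> gr_map sg q) n \<longleftrightarrow>
    (\<exists>u v x. f = (\<Oplus>\<^bsub>semigroup_ring sg\<^esub>j\<in>{..n}. u j * v (n - j)) + x \<and>
       (\<forall>j\<le>n. u j - a j \<in> J (Suc j) \<and> v j - b j \<in> J (Suc j)) \<and> x \<in> J (Suc n))"
    by (simp add: gr_simps gr_map_mem a_def b_def)
  also have "\<dots> \<longleftrightarrow> f \<in> gr_map sg (p * q) n"
  proof
    assume "f \<in> gr_map sg (p * q) n"
    then have "f - (\<Sum>j\<le>n. a j * b (n - j)) \<in> J (Suc n)" by (simp add: gr_map_mem pq)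
    then show "\<exists>u v x. f = (\<Oplus>\<^bsub>semigroup_ring sg\<^esub>j\<in>{..n}. u j * v (n - j)) + x \<and>
       (\<forall>j\<le>n. u j - a j \<in> J (Suc j) \<and> v j - b j \<in> J (Suc j)) \<and> x \<in> J (Suc n)"
      \<comment> \<open>The images of the homogeneous components serve as representatives, and the
        free summand in \<open>J (Suc n)\<close> absorbs the rest of \<open>f\<close>.\<close>
      using ab by (intro exI[of _ a] exI[of _ b] exI[of _ "f - (\<Sum>j\<le>n. a j * b (n - j))"])
        (simp add: finsum J_zero)
  next
    assume "\<exists>u v x. f = (\<Oplus>\<^bsub>semigroup_ring sg\<^esub>j\<in>{..n}. u j * v (n - j)) + x \<and>
       (\<forall>j\<le>n. u j - a j \<in> J (Suc j) \<and> v j - b j \<in> J (Suc j)) \<and> x \<in> J (Suc n)"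
    then obtain u v x where f: "f = (\<Oplus>\<^bsub>semigroup_ring sg\<^esub>j\<in>{..n}. u j * v (n - j)) + x"
      and u: "\<And>j. j \<le> n \<Longrightarrow> u j - a j \<in> J (Suc j)" and v: "\<And>j. j \<le> n \<Longrightarrow> v j - b j \<in> J (Suc j)"
      and x: "x \<in> J (Suc n)" by blast
    have "\<forall>j\<le>n. u j \<in> J j \<and> v j \<in> J j" using u v mem mem' by blast
    then have f': "f = (\<Sum>j\<le>n. u j * v (n - j)) + x" unfolding f by (simp only: finsum)
    \<comment> \<open>Changing representatives one factor at a time: u v - a b = (u - a) v + a (v -
      b), and in each summand one factor has gained a filtration step.\<close>
    have "(\<Sum>j\<le>n. (u j - a j) * v (n - j) + a j * (v (n - j) - b (n - j)))
        = (\<Sum>j\<le>n. u j * v (n - j)) - (\<Sum>j\<le>n. a j * b (n - j))"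
      unfolding sum_subtractf[symmetric] by (intro sum.cong refl) (simp add: algebra_simps)
    then have "f - (\<Sum>j\<le>n. a j * b (n - j)) = (\<Sum>j\<le>n. (u j - a j) * v (n - j) + a j * (v (n - j) - b (n - j))) + x"
      by (simp add: f')
    also have "\<dots> \<in> J (Suc n)"
    proof (intro J_add J_sum x)
      fix j assume "j \<in> {..n}"
      then have j: "j \<le> n" by simp
      show "(u j - a j) * v (n - j) \<in> J (Suc n)"
        using J_mult[OF u[OF j] mem'[OF v[of "n - j"]]] j by simp
      show "a j * (v (n - j) - b (n - j)) \<in> J (Suc n)"
        using J_mult[OF ab(1)[of j] v[of "n - j"]] j by simp
    qed
    finally show "f \<in> gr_map sg (p * q) n" by (simp add: gr_map_mem pq)
  qed
  finally show "f \<in> (gr_map sg p \<otimes>\<^bsub>gr TYPE('k) sg\<^esub> gr_map sg q) n \<longleftrightarrow> f \<in> gr_map sg (p * q) n" .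
qed

lemma cyclic_module_gr:
  "cyclic_module d initial_ideal (gr_map sg) (module_via (gr_map sg :: 'k::field mpoly \<Rightarrow> _) (gr TYPE('k) sg))"
proof
  show "gr_map sg ` polys d = carrier (module_via (gr_map sg :: 'k mpoly \<Rightarrow> _) (gr TYPE('k) sg))"
    by (simp add: module_via_def gr_map_surj)
  show "\<zero>\<^bsub>module_via (gr_map sg :: 'k mpoly \<Rightarrow> _) (gr TYPE('k) sg)\<^esub> = gr_map sg 0"
    by (simp add: module_via_def gr_simps fun_eq_iff gr_map_eq hom_component_zero toric_zero coset_zero)
qed (simp_all add: module_via_def gr_map_eq_iff gr_map_mult gr_simps(4) gr_map_add)

theorem homogeneous_type_sg: "homogeneous_type TYPE('k::field) sg"
  unfolding homogeneous_type_def embdim_sg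
proof (intro allI impI)
  fix i :: nat assume "i \<ge> 1"
  then obtain j where i: "i = Suc j" by (cases i) auto
  have c: "d - 1 < d" using d by simp
  have toric: "triangular_rel i (toric_rel i :: 'k mpoly)" if "i \<in> {1..d - 1}" for i
    using that d by (intro triangular_toric_rel) auto
  have "betti d (module_via (toric_map sg :: 'k mpoly \<Rightarrow> _) (semigroup_ring sg)) i = koszul_rank (d - 1) i"
    unfolding i
    by (rule cyclic_module.betti_eq_koszul_rank[OF cyclic_module_toric toric_ideal_def c toric]) simp_all
  moreover have "betti d (module_via (gr_map sg :: 'k mpoly \<Rightarrow> _) (gr TYPE('k) sg)) i = koszul_rank (d - 1) i"
    unfolding i
    by (rule cyclic_module.betti_eq_koszul_rank[OF cyclic_module_gr initial_ideal_def c triangular_initial_rel])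
  ultimately show "betti d (module_via (toric_map sg :: 'k mpoly \<Rightarrow> _) (semigroup_ring sg)) i
      = betti d (module_via (gr_map sg :: 'k mpoly \<Rightarrow> _) (gr TYPE('k) sg)) i" by simp
qed

end

theorem corollary5p13:
  fixes d :: nat
  assumes "d \<ge> 3"
  shows "infinite {S. numerical_semigroup S \<and> embdim S = d \<and>
                      homogeneous_type TYPE('k::field) S \<and> \<not> homogeneous S}"
proof -
  \<comment> \<open>2k + 5 runs through the odd numbers m >= 5.\<close>
  let ?S = "\<lambda>k. ladder.sg d (2 * k + 5)"
  have ladder: "ladder d (2 * k + 5)" for k
    by unfold_locales (use assms in auto)
  have "inj ?S"
  proof (rule injI)
    fix k l assume eq: "?S k = ?S l"
    \<comment> \<open>The second generator m 2^(d-2) determines m, so different parameters give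
      different semigroups.\<close>
    have "gen (?S k) 1 = (2 * k + 5) * 2 ^ (d - 1 - 1)" for k
      using ladder.gen_sg[OF ladder, of 1 k] assms by (simp add: ladder.g_def[OF ladder])
    from this[of k] this[of l] show "k = l" by (simp add: eq)
  qed
  then have "infinite (range ?S)" using finite_imageD by blast
  moreover have "range ?S \<subseteq> {S. numerical_semigroup S \<and> embdim S = d \<and>
                      homogeneous_type TYPE('k) S \<and> \<not> homogeneous S}"
    using ladder.numerical_semigroup_sg[OF ladder] ladder.embdim_sg[OF ladder]
      ladder.homogeneous_type_sg[OF ladder] ladder.not_homogeneous_sg[OF ladder] by blast
  ultimately show ?thesis using infinite_super by blast
qed

end
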